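(* For every $X\in\mathcal{HC}_n$ and $m\ge0$, $\Gamma_{n,m}(X^h)\cong\Gamma_{n,m}(X)^*$ as $\mathbb H_m$-modules.
   Context: Setup. $G=\mathrm{GL}_n(\mathbb C)$ with $K=U(n)$; the complexified Lie algebra of $\mathfrak g_0=\mathfrak{gl}_n(\mathbb C)$ is identified with $\mathfrak g_0\oplus\mathfrak g_0$ via $(E,E')\mapsto\frac12(E-j\,iE)+\frac12(\overline{E}+j\,i\overline{E})$ ($j$ the complexification's imaginary unit, $i=\sqrt{-1}I_n$). $\mathcal{HC}_n$ is the category of Harish-Chandra $(\mathfrak g,K)$-modules of $\mathrm{GL}_n(\mathbb C)$. The Hermitian dual $X^h$ of $X$ is the space of $K$-finite vectors in the algebraic dual with non-degenerate pairing $\langle,\rangle:X\times X^h\to\mathbb C$ such that $\langle x,(E_1,E_2)f\rangle=-\langle(\overline{E_2},\overline{E_1})x,f\rangle$ and $\langle x,kf\rangle=\langle k^{-1}x,f\rangle$ for $E_1,E_2\in\mathfrak g_0$, $k\in K$. $\mathbb H_m$ is the graded Hecke algebra of type $A$ (generators $y_1,\dots,y_m,s_1,\dots,s_{m-1}$; relations $y_ay_b=y_by_a$, $s_a^2=1$, braid relations, $s_ay_a-y_{a+1}s_a=1$, $s_ay_b=y_bs_a$ for $b\ne a,a+1$). The anti-involution $^*$ of $\mathbb H_m$ is the conjugate-linear... more precisely the anti-involution determined by $s_a^*=s_a$ and $y_a^*=-w_0y_{m+1-a}w_0^{-1}$, $w_0$ the longest element of $S_m\subset\mathbb H_m$. For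 an $\mathbb H_m$-module $\pi$, its Hermitian dual $\pi^*$ is the space of (conjugate-linear) functionals $f$ with $(hf)(x)=f(h^*x)$, i.e. there is a non-degenerate pairing with $\langle hx,f\rangle=\langle x,h^*f\rangle$. Functor. $V=\mathbb C^n$ with $g$ acting by $\overline g$; $(0,E)$ acts on $V$ by $E$, $(E,0)$ by $0$. $\Omega_{kl}=\sum_{a,b}1^{\otimes k}\otimes E_{ab}\otimes1^{\otimes(l-k-1)}\otimes E_{ba}\otimes1^{\otimes(m-l)}$ ($E_{ab}$ matrix units) acts on $X\otimes V^{\otimes m}$ with $E$ in slot $0$ acting on $X$ by $(0,E)$ and in slot $k\ge1$ on the $k$-th $V$ by $(0,E)$. $\Gamma_{n,m}(X)=\mathrm{Hom}_K(\mathrm{triv},X\otimes V^{\otimes m})$ with $s_a\mapsto-\Omega_{a,a+1}$, $y_l\mapsto\sum_{0\le x<l}\Omega_{xl}+\frac n2$. *)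

theory Defs
  imports "HOL-Analysis.Analysis" "HOL-Library.Function_Algebras"
begin

section \<open>Matrices, U(n), Lie algebra gl_n(C) + gl_n(C)\<close>

type_synonym 'n cmat = "complex^'n^'n"

definition cnjm :: "('n::finite) cmat \<Rightarrow> 'n cmat" where
  "cnjm A = (\<chi> i j. cnj (A $ i $ j))"

definition adj :: "('n::finite) cmat \<Rightarrow> 'n cmat" where
  "adj A = (\<chi> i j. cnj (A $ j $ i))"

definition smat :: "complex \<Rightarrow> ('n::finite) cmat \<Rightarrow> 'n cmat" where
  "smat c A = (\<chi> i j. c * A $ i $ j)"

definition is_unitary :: "('n::finite) cmat \<Rightarrow> bool" where
  "is_unitary k \<longleftrightarrow> k ** adj k = mat 1"

definition skew_herm :: "('n::finite) cmat \<Rightarrow> bool" where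
  "skew_herm Z \<longleftrightarrow> Z + adj Z = 0"

definition munit :: "'n \<Rightarrow> 'n \<Rightarrow> ('n::finite) cmat" where
  "munit a b = (\<chi> i j. if i = a \<and> j = b then 1 else 0)"

definition mpow :: "('n::finite) cmat \<Rightarrow> nat \<Rightarrow> 'n cmat" where
  "mpow Z k = (((**) Z) ^^ k) (mat 1)"

definition mexp :: "('n::finite) cmat \<Rightarrow> 'n cmat" where
  "mexp Z = (\<Sum>k. (1 / fact k) *\<^sub>R mpow Z k)"

text \<open>Lie bracket on g = gl_n(C) + gl_n(C), componentwise.\<close>
definition lbr :: "('n::finite) cmat \<times> 'n cmat \<Rightarrow> 'n cmat \<times> 'n cmat \<Rightarrow> 'n cmat \<times> 'n cmat" where
  "lbr E F = (fst E ** fst F - fst F ** fst E, snd E ** snd F - snd F ** snd E)"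

section \<open>Linear algebra over C on a carrier set with an explicit scalar action\<close>

definition lin_comb :: "(complex \<Rightarrow> 'v \<Rightarrow> 'v) \<Rightarrow> 'v set \<Rightarrow> ('v::ab_group_add) set" where
  "lin_comb sc B = {y. \<exists>F c. finite F \<and> F \<subseteq> B \<and> y = (\<Sum>b\<in>F. sc (c b) b)}"

definition findim :: "(complex \<Rightarrow> 'v \<Rightarrow> 'v) \<Rightarrow> ('v::ab_group_add) set \<Rightarrow> bool" where
  "findim sc S \<longleftrightarrow> (\<exists>B. finite B \<and> B \<subseteq> S \<and> S \<subseteq> lin_comb sc B)"

definition cvs :: "('v::ab_group_add) set \<Rightarrow> (complex \<Rightarrow> 'v \<Rightarrow> 'v) \<Rightarrow> bool" where
  "cvs V sc \<longleftrightarrow> 0 \<in> V \<and> (\<forall>x\<in>V. \<forall>y\<in>V. x + y \<in> V) \<and> (\<forall>c. \<forall>x\<in>V. sc c x \<in> V)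
     \<and> (\<forall>c. \<forall>x\<in>V. \<forall>y\<in>V. sc c (x + y) = sc c x + sc c y)
     \<and> (\<forall>c d. \<forall>x\<in>V. sc (c + d) x = sc c x + sc d x)
     \<and> (\<forall>c d. \<forall>x\<in>V. sc (c * d) x = sc c (sc d x))
     \<and> (\<forall>x\<in>V. sc 1 x = x)"

section \<open>Harish-Chandra modules of GL_n(C), K = U(n)\<close>

text \<open>A (g,K)-module is given by a carrier X (a complex vector space inside the type 'x
 with scalar action sc), an action act of g = gl_n(C) + gl_n(C) (pairs (E1,E2)) and an
 action kact of K = U(n).  Finite-dimensional continuous representations of U(n) of
 dimension d are given by continuous matrix coefficients rho k i j (i,j < d).\<close>

definition cont_rep :: "nat \<Rightarrow> (('n::finite) cmat \<Rightarrow> nat \<Rightarrow> nat \<Rightarrow> complex) \<Rightarrow> bool" where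
  "cont_rep d rho \<longleftrightarrow>
     (\<forall>i<d. \<forall>j<d. continuous_on {k. is_unitary k} (\<lambda>k. rho k i j))
   \<and> (\<forall>i<d. \<forall>j<d. rho (mat 1) i j = (if i = j then 1 else 0))
   \<and> (\<forall>k1 k2. is_unitary k1 \<and> is_unitary k2 \<longrightarrow>
        (\<forall>i<d. \<forall>j<d. rho (k1 ** k2) i j = (\<Sum>l<d. rho k1 i l * rho k2 l j)))"

definition homK :: "'x set \<Rightarrow> (complex \<Rightarrow> 'x \<Rightarrow> 'x) \<Rightarrow> (('n::finite) cmat \<Rightarrow> 'x \<Rightarrow> 'x)
    \<Rightarrow> nat \<Rightarrow> ('n cmat \<Rightarrow> nat \<Rightarrow> nat \<Rightarrow> complex) \<Rightarrow> (nat \<Rightarrow> 'x::ab_group_add) set" where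
  "homK X sc kact d rho = {v. (\<forall>j. d \<le> j \<longrightarrow> v j = 0) \<and> (\<forall>j<d. v j \<in> X) \<and>
      (\<forall>k j. is_unitary k \<and> j < d \<longrightarrow> kact k (v j) = (\<Sum>i<d. sc (rho k i j) (v i)))}"

definition HC_module :: "('x::ab_group_add) set \<Rightarrow> (complex \<Rightarrow> 'x \<Rightarrow> 'x)
    \<Rightarrow> (('n::finite) cmat \<times> 'n cmat \<Rightarrow> 'x \<Rightarrow> 'x) \<Rightarrow> ('n cmat \<Rightarrow> 'x \<Rightarrow> 'x) \<Rightarrow> bool" where
  "HC_module X sc act kact \<longleftrightarrow>
     cvs X sc
     \<comment> \<open>g-module structure\<close>
   \<and> (\<forall>E. \<forall>x\<in>X. act E x \<in> X)
   \<and> (\<forall>E. \<forall>x\<in>X. \<forall>y\<in>X. act E (x + y) = act E x + act E y)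
   \<and> (\<forall>E c. \<forall>x\<in>X. act E (sc c x) = sc c (act E x))
   \<and> (\<forall>E F. \<forall>x\<in>X. act (fst E + fst F, snd E + snd F) x = act E x + act F x)
   \<and> (\<forall>E c. \<forall>x\<in>X. act (smat c (fst E), smat c (snd E)) x = sc c (act E x))
   \<and> (\<forall>E F. \<forall>x\<in>X. act (lbr E F) x = act E (act F x) - act F (act E x))
     \<comment> \<open>K-module structure\<close>
   \<and> (\<forall>k. is_unitary k \<longrightarrow> (\<forall>x\<in>X. kact k x \<in> X))
   \<and> (\<forall>k. is_unitary k \<longrightarrow> (\<forall>x\<in>X. \<forall>y\<in>X. kact k (x + y) = kact k x + kact k y))
   \<and> (\<forall>k c. is_unitary k \<longrightarrow> (\<forall>x\<in>X. kact k (sc c x) = sc c (kact k x)))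
   \<and> (\<forall>x\<in>X. kact (mat 1) x = x)
   \<and> (\<forall>k1 k2. is_unitary k1 \<and> is_unitary k2 \<longrightarrow> (\<forall>x\<in>X. kact (k1 ** k2) x = kact k1 (kact k2 x)))
     \<comment> \<open>compatibility with Ad: k . (E1,E2) . k^-1 = (k E1 k^-1, conj k E2 (conj k)^-1)\<close>
   \<and> (\<forall>k E. is_unitary k \<longrightarrow> (\<forall>x\<in>X.
        kact k (act E x) = act (k ** fst E ** adj k, cnjm k ** snd E ** adj (cnjm k)) (kact k x)))
     \<comment> \<open>K-finite, continuous, and the differentiated K-action is the action of k = u(n),
         where E in g_0 sits in g as (E, conj E)\<close>
   \<and> (\<forall>x\<in>X. \<exists>(d::nat) b C lam.
        (\<forall>j<d. b j \<in> X)
      \<and> (\<forall>c. (\<Sum>i<d. sc (c i) (b i)) = 0 \<longrightarrow> (\<forall>i<d. c i = 0))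
      \<and> x = (\<Sum>j<d. sc (lam j) (b j))
      \<and> (\<forall>k j. is_unitary k \<and> j < d \<longrightarrow> kact k (b j) = (\<Sum>i<d. sc (C k i j) (b i)))
      \<and> (\<forall>i<d. \<forall>j<d. continuous_on {k. is_unitary k} (\<lambda>k. C k i j))
      \<and> (\<forall>Z. skew_herm Z \<longrightarrow> (\<exists>mu.
            (\<forall>i<d. ((\<lambda>t::real. \<Sum>j<d. C (mexp (t *\<^sub>R Z)) i j * lam j) has_vector_derivative mu i) (at 0))
          \<and> act (Z, cnjm Z) x = (\<Sum>i<d. sc (mu i) (b i)))))
     \<comment> \<open>admissible: every finite-dimensional continuous K-representation has finite multiplicity\<close>
   \<and> (\<forall>d rho. cont_rep d rho \<longrightarrow> findim (\<lambda>c v j. sc c (v j)) (homK X sc kact d rho))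
     \<comment> \<open>finitely generated over U(g)\<close>
   \<and> (\<exists>F. finite F \<and> F \<subseteq> X \<and> (\<forall>S. F \<subseteq> S \<and> 0 \<in> S \<and> (\<forall>x\<in>S. \<forall>y\<in>S. x + y \<in> S)
          \<and> (\<forall>c. \<forall>x\<in>S. sc c x \<in> S) \<and> (\<forall>E. \<forall>x\<in>S. act E x \<in> S) \<longrightarrow> X \<subseteq> S))"

section \<open>Hermitian dual X^h\<close>

text \<open>Elements of X^h: K-finite conjugate-linear functionals f on X (extended by 0 off X);
 the pairing is <x,f> = f x.\<close>

definition hd_kact :: "'x set \<Rightarrow> (('n::finite) cmat \<Rightarrow> 'x \<Rightarrow> 'x) \<Rightarrow> 'n cmat \<Rightarrow> ('x \<Rightarrow> complex) \<Rightarrow> ('x \<Rightarrow> complex)" where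
  "hd_kact X kact k f = (\<lambda>x. if x \<in> X then f (kact (adj k) x) else 0)"

definition hd_act :: "'x set \<Rightarrow> (('n::finite) cmat \<times> 'n cmat \<Rightarrow> 'x \<Rightarrow> 'x) \<Rightarrow> 'n cmat \<times> 'n cmat
    \<Rightarrow> ('x \<Rightarrow> complex) \<Rightarrow> ('x \<Rightarrow> complex)" where
  "hd_act X act E f = (\<lambda>x. if x \<in> X then - f (act (cnjm (snd E), cnjm (fst E)) x) else 0)"

definition hd_sc :: "complex \<Rightarrow> ('x \<Rightarrow> complex) \<Rightarrow> ('x \<Rightarrow> complex)" where
  "hd_sc c f = (\<lambda>x. c * f x)"

definition hd_carrier :: "('x::ab_group_add) set \<Rightarrow> (complex \<Rightarrow> 'x \<Rightarrow> 'x) \<Rightarrow> (('n::finite) cmat \<Rightarrow> 'x \<Rightarrow> 'x)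
    \<Rightarrow> ('x \<Rightarrow> complex) set" where
  "hd_carrier X sc kact = {f. (\<forall>x. x \<notin> X \<longrightarrow> f x = 0)
      \<and> (\<forall>x\<in>X. \<forall>y\<in>X. f (x + y) = f x + f y)
      \<and> (\<forall>c. \<forall>x\<in>X. f (sc c x) = cnj c * f x)
      \<and> (\<exists>B. finite B \<and> {hd_kact X kact k f | k. is_unitary k} \<subseteq> lin_comb hd_sc B)}"

section \<open>The functor Gamma_{n,m}\<close>

text \<open>X (x) V^(x)m is modelled as functions from words J (lists over 'n of length m) to X,
 w = sum_J w(J) (x) e_{J!0} (x) ... (x) e_{J!(m-1)}; slot k >= 1 is list position k-1.\<close>

definition words :: "nat \<Rightarrow> ('n::finite) list set" where
  "words m = {J. length J = m}"

definition kten :: "(complex \<Rightarrow> 'x \<Rightarrow> 'x) \<Rightarrow> (('n::finite) cmat \<Rightarrow> 'x \<Rightarrow> 'x) \<Rightarrow> nat \<Rightarrow> 'n cmat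
    \<Rightarrow> ('n list \<Rightarrow> 'x::ab_group_add) \<Rightarrow> ('n list \<Rightarrow> 'x)" where
  "kten sc kact m k w = (\<lambda>J. if length J = m then
      (\<Sum>I\<in>words m. sc (\<Prod>t<m. cnj (k $ (J ! t) $ (I ! t))) (kact k (w I))) else 0)"

definition GammaF :: "('x::ab_group_add) set \<Rightarrow> (complex \<Rightarrow> 'x \<Rightarrow> 'x) \<Rightarrow> (('n::finite) cmat \<Rightarrow> 'x \<Rightarrow> 'x)
    \<Rightarrow> nat \<Rightarrow> ('n list \<Rightarrow> 'x) set" where
  "GammaF X sc kact m = {w. (\<forall>J. length J \<noteq> m \<longrightarrow> w J = 0) \<and> (\<forall>J. w J \<in> X)
      \<and> (\<forall>k. is_unitary k \<longrightarrow> kten sc kact m k w = w)}"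

definition Gsc :: "(complex \<Rightarrow> 'x \<Rightarrow> 'x) \<Rightarrow> complex \<Rightarrow> ('n list \<Rightarrow> 'x) \<Rightarrow> ('n list \<Rightarrow> 'x)" where
  "Gsc sc c w = (\<lambda>J. sc c (w J))"

text \<open>E acting in slot k: slot 0 acts on X by (0,E), slot k>=1 on the k-th V by E.\<close>
definition slotop :: "(complex \<Rightarrow> 'x \<Rightarrow> 'x) \<Rightarrow> (('n::finite) cmat \<times> 'n cmat \<Rightarrow> 'x \<Rightarrow> 'x) \<Rightarrow> nat \<Rightarrow> nat
    \<Rightarrow> 'n cmat \<Rightarrow> ('n list \<Rightarrow> 'x::ab_group_add) \<Rightarrow> ('n list \<Rightarrow> 'x)" where
  "slotop sc act m k E w =
     (if k = 0 then (\<lambda>J. act (0, E) (w J))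
      else (\<lambda>J. if length J = m then (\<Sum>i\<in>UNIV. sc (E $ (J ! (k - 1)) $ i) (w (J[k - 1 := i]))) else 0))"

definition Omega :: "(complex \<Rightarrow> 'x \<Rightarrow> 'x) \<Rightarrow> (('n::finite) cmat \<times> 'n cmat \<Rightarrow> 'x \<Rightarrow> 'x) \<Rightarrow> nat \<Rightarrow> nat \<Rightarrow> nat
    \<Rightarrow> ('n list \<Rightarrow> 'x::ab_group_add) \<Rightarrow> ('n list \<Rightarrow> 'x)" where
  "Omega sc act m k l w = (\<Sum>a\<in>UNIV. \<Sum>b\<in>UNIV. slotop sc act m k (munit a b) (slotop sc act m l (munit b a) w))"

definition GS :: "(complex \<Rightarrow> 'x \<Rightarrow> 'x) \<Rightarrow> (('n::finite) cmat \<times> 'n cmat \<Rightarrow> 'x \<Rightarrow> 'x) \<Rightarrow> nat \<Rightarrow> nat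
    \<Rightarrow> ('n list \<Rightarrow> 'x::ab_group_add) \<Rightarrow> ('n list \<Rightarrow> 'x)" where
  "GS sc act m a w = - Omega sc act m a (a + 1) w"

definition GY :: "(complex \<Rightarrow> 'x \<Rightarrow> 'x) \<Rightarrow> (('n::finite) cmat \<times> 'n cmat \<Rightarrow> 'x \<Rightarrow> 'x) \<Rightarrow> nat \<Rightarrow> nat
    \<Rightarrow> ('n list \<Rightarrow> 'x::ab_group_add) \<Rightarrow> ('n list \<Rightarrow> 'x)" where
  "GY sc act m l w = (\<Sum>x<l. Omega sc act m x l w) + Gsc sc (of_nat CARD('n) / 2) w"

section \<open>Graded Hecke algebra H_m: modules given by the action of the generators\<close>

text \<open>Reduced word for w0: s_1 (s_2 s_1) (s_3 s_2 s_1) ... (s_{m-1} ... s_1).\<close>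
definition w0word :: "nat \<Rightarrow> nat list" where
  "w0word m = concat (map (\<lambda>j. rev [1..<j + 1]) [1..<m])"

text \<open>Action of the product s_{a1} ... s_{ar} of a word [a1,...,ar].\<close>
definition word_act :: "(nat \<Rightarrow> 'v \<Rightarrow> 'v) \<Rightarrow> nat list \<Rightarrow> 'v \<Rightarrow> 'v" where
  "word_act S ws = foldr (\<lambda>a h. S a \<circ> h) ws id"

text \<open>Hermitian dual pi^* of an H_m-module (V, sc, S, Y): conjugate-linear functionals,
 (h f)(v) = f(h^* v), with s_a^* = s_a, y_a^* = - w0 y_{m+1-a} w0^{-1}.\<close>
definition hm_dual_carrier :: "('v::ab_group_add) set \<Rightarrow> (complex \<Rightarrow> 'v \<Rightarrow> 'v) \<Rightarrow> ('v \<Rightarrow> complex) set" where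
  "hm_dual_carrier V sc = {f. (\<forall>v. v \<notin> V \<longrightarrow> f v = 0)
      \<and> (\<forall>u\<in>V. \<forall>v\<in>V. f (u + v) = f u + f v)
      \<and> (\<forall>c. \<forall>v\<in>V. f (sc c v) = cnj c * f v)}"

definition hm_dual_S :: "'v set \<Rightarrow> (nat \<Rightarrow> 'v \<Rightarrow> 'v) \<Rightarrow> nat \<Rightarrow> ('v \<Rightarrow> complex) \<Rightarrow> ('v \<Rightarrow> complex)" where
  "hm_dual_S V S a f = (\<lambda>v. if v \<in> V then f (S a v) else 0)"

definition hm_dual_Y :: "nat \<Rightarrow> 'v set \<Rightarrow> (nat \<Rightarrow> 'v \<Rightarrow> 'v) \<Rightarrow> (nat \<Rightarrow> 'v \<Rightarrow> 'v) \<Rightarrow> nat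
    \<Rightarrow> ('v \<Rightarrow> complex) \<Rightarrow> ('v::ab_group_add \<Rightarrow> complex)" where
  "hm_dual_Y m V S Y a f = (\<lambda>v. if v \<in> V then
      f (- word_act S (w0word m) (Y (m + 1 - a) (word_act S (rev (w0word m)) v))) else 0)"

definition hm_dual_sc :: "complex \<Rightarrow> ('v \<Rightarrow> complex) \<Rightarrow> ('v \<Rightarrow> complex)" where
  "hm_dual_sc c f = (\<lambda>v. c * f v)"

text \<open>Isomorphism of H_m-modules: a C-linear bijection intertwining the generators
 s_a (1 <= a < m) and y_l (1 <= l <= m).\<close>
definition hm_iso :: "nat \<Rightarrow> ('a::ab_group_add) set \<Rightarrow> (complex \<Rightarrow> 'a \<Rightarrow> 'a) \<Rightarrow> (nat \<Rightarrow> 'a \<Rightarrow> 'a) \<Rightarrow> (nat \<Rightarrow> 'a \<Rightarrow> 'a)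
    \<Rightarrow> ('b::ab_group_add) set \<Rightarrow> (complex \<Rightarrow> 'b \<Rightarrow> 'b) \<Rightarrow> (nat \<Rightarrow> 'b \<Rightarrow> 'b) \<Rightarrow> (nat \<Rightarrow> 'b \<Rightarrow> 'b) \<Rightarrow> bool" where
  "hm_iso m A scA SA YA B scB SB YB \<longleftrightarrow> (\<exists>\<Phi>. bij_betw \<Phi> A B
      \<and> (\<forall>u\<in>A. \<forall>v\<in>A. \<Phi> (u + v) = \<Phi> u + \<Phi> v)
      \<and> (\<forall>c. \<forall>u\<in>A. \<Phi> (scA c u) = scB c (\<Phi> u))
      \<and> (\<forall>a. 1 \<le> a \<and> a < m \<longrightarrow> (\<forall>u\<in>A. \<Phi> (SA a u) = SB a (\<Phi> u)))
      \<and> (\<forall>l. 1 \<le> l \<and> l \<le> m \<longrightarrow> (\<forall>u\<in>A. \<Phi> (YA l u) = YB l (\<Phi> u))))"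

end

theory Submission
  imports Defs
begin

text \<open>
  The isomorphism sends \<open>u\<close> to the functional \<open>w \<mapsto> \<Sum>\<^sub>J u(J)(w(J))\<close> on the \<open>K\<close>-invariants.
  It is bijective because the tensor space splits as its invariants plus the span of all \<open>kw - w\<close>;
  on the finite-dimensional \<open>K\<close>-stable pieces this splitting is obtained, without Haar measure, from
  the fixed point of a bounded group of matrices that minimises a uniformly convex invariant function.
  The reflections act by transpositions of the tensor factors, up to sign, and are self-adjoint.
  For \<open>y\<^sub>l\<close> the adjoint of \<open>\<Omega>\<^sub>0\<^sub>l\<close> uses the first factor of the Lie algebra; differentiating the
  \<open>K\<close>-invariance of \<open>w\<close> turns it into \<open>- \<Omega>\<^sub>0\<^sub>l - \<Sum>\<^sub>x \<Omega>\<^sub>x\<^sub>l - n\<close> with \<open>x\<close> running over the slots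
  \<open>x \<ge> 1\<close>, \<open>x \<noteq> l\<close>. The transpositions with \<open>x < l\<close> cancel, and what remains is \<open>- y\<^sub>m\<^sub>+\<^sub>1\<^sub>-\<^sub>l\<close> conjugated
  by the longest element, which reverses the tensor factors.
\<close>

section \<open>Fixed points of bounded matrix groups\<close>

text \<open>The carrier \<open>X\<close> has no topology, so every limit is taken in coordinates: a
  K-finite vector is expanded in a basis of a finite-dimensional stable space, and compactness of
  U(n) turns continuous matrix coefficients into bounded ones. Bases chosen for different vectors
  need not be independent of one another, so the map \<open>LL\<close> from the direct sum of
  coordinate spaces to the tensor space need not be injective. This is why fixed points are sought
  in cosets of arbitrary stable subspaces: an invariant tensor is lifted to an invariant coordinate
  vector by moving a lift inside its coset modulo the kernel. For surjectivity a functional on the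
  invariants is extended by zero on the displacements kw - w; the coordinates of the extension are
  functionals on \<open>X\<close>, and its invariance makes them both K-finite and an invariant
  tensor. The shift n/2 is what lets the last computation close: slot \<open>l\<close> meeting
  itself contributes -n, and -n + n/2 = -n/2 is again minus the shift of a y-generator.\<close>

definition fun_subspace :: "'i set \<Rightarrow> ('i \<Rightarrow> complex) set \<Rightarrow> bool" where
  "fun_subspace I S \<longleftrightarrow> (\<forall>z\<in>S. \<forall>i. i \<notin> I \<longrightarrow> z i = 0) \<and> 0 \<in> S
     \<and> (\<forall>x\<in>S. \<forall>y\<in>S. x + y \<in> S) \<and> (\<forall>c. \<forall>x\<in>S. (\<lambda>i. c * x i) \<in> S)"

text \<open>Gaussian elimination, one index at a time: if some member of \<open>S\<close> is nonzero
  at \<open>i\<close>, subtracting the multiple of it that kills coordinate \<open>i\<close> moves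
  sequence and limit into \<open>S'\<close>, a subspace over the smaller index set.\<close>

lemma fun_subspace_closed:
  assumes "finite I" "fun_subspace I S" "\<And>n. s n \<in> S" "\<And>i. (\<lambda>n. s n i) \<longlonglongrightarrow> x i"
  shows "x \<in> S"
  using assms
proof (induction I arbitrary: S s x rule: finite_induct)
  case empty
  have "s n = 0" for n
    using empty by (auto simp: fun_subspace_def fun_eq_iff)
  then have "x i = 0" for i
    using empty(3)[of i] by (simp add: LIMSEQ_const_iff)
  then have "x = 0" by (simp add: fun_eq_iff)
  then show ?case using empty(1) unfolding fun_subspace_def by blast
next
  case (insert i I)
  define S' where "S' = {z \<in> S. z i = 0}"
  have sub': "fun_subspace I S'"
    using insert(4) unfolding fun_subspace_def S'_def
    by (auto simp: fun_eq_iff)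
  show ?case
  proof (cases "S \<subseteq> S'")
    case True
    then show ?thesis
      using insert.IH[OF sub', of s x] insert(5,6) S'_def by blast
  next
    case False
    then obtain e0 where e0: "e0 \<in> S" "e0 i \<noteq> 0" by (auto simp: S'_def)
    define e where "e = (\<lambda>j. inverse (e0 i) * e0 j)"
    have e: "e \<in> S" "e i = 1"
      using e0 insert(4) by (auto simp: e_def fun_subspace_def)
    have scal: "(\<lambda>j. c * z j) \<in> S" if "z \<in> S" for c z
      using insert(4) that by (auto simp: fun_subspace_def)
    have add: "y + z \<in> S" if "y \<in> S" "z \<in> S" for y z
      using insert(4) that by (auto simp: fun_subspace_def)
    define s' where "s' = (\<lambda>n. s n + (\<lambda>j. (- s n i) * e j))"
    define x' where "x' = x + (\<lambda>j. (- x i) * e j)"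
    have "s' n \<in> S'" for n
      using add[OF insert(5) scal[OF e(1)], of n "- s n i"] e(2)
      unfolding s'_def S'_def mem_Collect_eq by auto
    moreover have "(\<lambda>n. s' n j) \<longlonglongrightarrow> x' j" for j
      unfolding s'_def x'_def plus_fun_def by (intro tendsto_intros insert(6))
    ultimately have "x' \<in> S'" using insert.IH[OF sub'] by blast
    then have "x' + (\<lambda>j. x i * e j) \<in> S"
      using add scal[OF e(1)] unfolding S'_def by blast
    also have "x' + (\<lambda>j. x i * e j) = x" unfolding x'_def by (intro ext) simp
    finally show ?thesis .
  qed
qed

definition mulv :: "'i set \<Rightarrow> ('i \<Rightarrow> 'i \<Rightarrow> complex) \<Rightarrow> ('i \<Rightarrow> complex) \<Rightarrow> ('i \<Rightarrow> complex)" where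
  "mulv I A z = (\<lambda>i. if i \<in> I then \<Sum>j\<in>I. A i j * z j else 0)"

definition sqnorm :: "'i set \<Rightarrow> ('i \<Rightarrow> complex) \<Rightarrow> real" where
  "sqnorm I z = (\<Sum>i\<in>I. (cmod (z i))\<^sup>2)"

text \<open>Boundedness stands in for continuity: continuity of the matrix coefficients enters only
  through \<open>unitary_continuous_bounded\<close>.\<close>

definition bdd_rep :: "'i set \<Rightarrow> (('n::finite) cmat \<Rightarrow> 'i \<Rightarrow> 'i \<Rightarrow> complex) \<Rightarrow> bool" where
  "bdd_rep I C \<longleftrightarrow> finite I
     \<and> (\<exists>M. \<forall>k. is_unitary k \<longrightarrow> (\<forall>i\<in>I. \<forall>j\<in>I. cmod (C k i j) \<le> M))
     \<and> (\<forall>i\<in>I. \<forall>j\<in>I. C (mat 1) i j = (if i = j then 1 else 0))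
     \<and> (\<forall>k1 k2. is_unitary k1 \<and> is_unitary k2 \<longrightarrow>
          (\<forall>i\<in>I. \<forall>j\<in>I. C (k1 ** k2) i j = (\<Sum>l\<in>I. C k1 i l * C k2 l j)))"

lemma adj_adj: "adj (adj k) = k"
  by (simp add: adj_def vec_eq_iff)

lemma adj_matrix_mul: "adj (k ** l) = adj l ** adj (k :: ('n::finite) cmat)"
  by (simp add: adj_def vec_eq_iff matrix_matrix_mult_def mult.commute)

lemma adj_mat_1: "adj (mat 1) = (mat 1 :: ('n::finite) cmat)"
  by (auto simp add: adj_def vec_eq_iff mat_def)

lemma is_unitary_1: "is_unitary (mat 1 :: ('n::finite) cmat)"
  by (simp add: is_unitary_def adj_mat_1)

lemma is_unitary_left: "is_unitary k \<Longrightarrow> adj k ** k = mat 1"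
  using matrix_left_right_inverse is_unitary_def by blast

lemma is_unitary_adj: "is_unitary k \<Longrightarrow> is_unitary (adj k)"
  using is_unitary_left by (auto simp: is_unitary_def adj_adj)

lemma is_unitary_mul: "is_unitary k \<Longrightarrow> is_unitary l \<Longrightarrow> is_unitary (k ** l)"
  unfolding is_unitary_def adj_matrix_mul
  by (metis matrix_mul_assoc matrix_mul_rid)

text \<open>The parallelogram law, in the form that gives uniform convexity: passing to the midpoint
  gains a quarter of the squared distance.\<close>

lemma sqnorm_midpoint:
  "sqnorm I (\<lambda>i. (a i + b i) / 2) = (sqnorm I a + sqnorm I b) / 2 - sqnorm I (\<lambda>i. a i - b i) / 4"
proof -
  have "(cmod ((x + y) / 2))\<^sup>2 = ((cmod x)\<^sup>2 + (cmod y)\<^sup>2) / 2 - (cmod (x - y))\<^sup>2 / 4" for x y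
    unfolding cmod_power2 by (simp add: power2_eq_square field_simps)
  then show ?thesis
    unfolding sqnorm_def by (simp only: sum_subtractf sum_divide_distrib[symmetric] sum.distrib)
qed

text \<open>Cauchy-Schwarz in each row gives one factor \<open>card I\<close>, the sum over the rows
  gives the other.\<close>

lemma sqnorm_mulv_le:
  assumes "finite I" "\<And>i j. i \<in> I \<Longrightarrow> j \<in> I \<Longrightarrow> cmod (A i j) \<le> M"
  shows "sqnorm I (mulv I A z) \<le> (of_nat (card I))\<^sup>2 * M\<^sup>2 * sqnorm I z"
proof -
  have "(cmod (mulv I A z i))\<^sup>2 \<le> of_nat (card I) * M\<^sup>2 * sqnorm I z" if i: "i \<in> I" for i
  proof -
    have "cmod (mulv I A z i) \<le> (\<Sum>j\<in>I. cmod (A i j) * cmod (z j))"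
      using i by (simp add: mulv_def norm_mult[symmetric] norm_sum)
    then have "(cmod (mulv I A z i))\<^sup>2 \<le> (\<Sum>j\<in>I. cmod (A i j) * cmod (z j))\<^sup>2"
      by (simp add: power_mono)
    also have "\<dots> \<le> (\<Sum>j\<in>I. (cmod (A i j))\<^sup>2) * (\<Sum>j\<in>I. (cmod (z j))\<^sup>2)"
      by (rule Cauchy_Schwarz_ineq_sum)
    also have "\<dots> \<le> (\<Sum>j\<in>I. M\<^sup>2) * (\<Sum>j\<in>I. (cmod (z j))\<^sup>2)"
      using assms(2)[OF i] by (intro mult_right_mono sum_mono power_mono sum_nonneg) auto
    finally show ?thesis by (simp add: sqnorm_def)
  qed
  then have "sqnorm I (mulv I A z) \<le> (\<Sum>i\<in>I. of_nat (card I) * M\<^sup>2 * sqnorm I z)"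
    unfolding sqnorm_def[of I "mulv I A z"] by (intro sum_mono) auto
  then show ?thesis by (simp add: power2_eq_square mult_ac)
qed

lemma mulv_mulv:
  assumes "finite I" "\<And>i j. i \<in> I \<Longrightarrow> j \<in> I \<Longrightarrow> A i j = (\<Sum>l\<in>I. B i l * C l j)"
  shows "mulv I A z = mulv I B (mulv I C z)"
proof
  fix i
  show "mulv I A z i = mulv I B (mulv I C z) i"
  proof (cases "i \<in> I")
    case True
    have "mulv I A z i = (\<Sum>j\<in>I. \<Sum>l\<in>I. B i l * C l j * z j)"
      using True assms(2) by (simp add: mulv_def sum_distrib_right)
    also have "\<dots> = (\<Sum>l\<in>I. \<Sum>j\<in>I. B i l * C l j * z j)" by (rule sum.swap)
    also have "\<dots> = mulv I B (mulv I C z) i"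
      using True by (simp add: mulv_def sum_distrib_left mult.assoc)
    finally show ?thesis .
  qed (simp add: mulv_def)
qed

lemma bdd_rep_mulv_mult:
  assumes "bdd_rep I C" "is_unitary k" "is_unitary l"
  shows "mulv I (C (k ** l)) z = mulv I (C k) (mulv I (C l) z)"
  using assms by (intro mulv_mulv) (auto simp: bdd_rep_def)

lemma bdd_rep_mulv_1:
  assumes "bdd_rep I C" "\<And>i. i \<notin> I \<Longrightarrow> z i = 0"
  shows "mulv I (C (mat 1)) z = z"
proof
  fix i
  have "(\<Sum>j\<in>I. C (mat 1) i j * z j) = (\<Sum>j\<in>I. if i = j then z j else 0)" if "i \<in> I"
    using assms that by (intro sum.cong) (auto simp: bdd_rep_def)
  then show "mulv I (C (mat 1)) z i = z i"
    using assms by (auto simp: mulv_def bdd_rep_def)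
qed

text \<open>The contragredient: transposition and inversion both reverse products, so together they
  preserve them.\<close>

lemma bdd_rep_dual:
  assumes "bdd_rep I C"
  shows "bdd_rep I (\<lambda>k i j. C (adj k) j i)"
proof -
  obtain M where M: "\<And>k i j. is_unitary k \<Longrightarrow> i \<in> I \<Longrightarrow> j \<in> I \<Longrightarrow> cmod (C k i j) \<le> M"
    using assms by (auto simp: bdd_rep_def)
  show ?thesis
    using assms unfolding bdd_rep_def adj_matrix_mul
    by (auto simp: adj_mat_1 is_unitary_adj mult.commute intro!: exI[of _ M] M)
qed

text \<open>The invariant function \<open>N z = sup\<^sub>k |C k z|\<^sup>2\<close> is uniformly convex because the
  matrices \<open>C k\<close> and their inverses are uniformly bounded; its unique minimiser is fixed.\<close>

lemma bdd_rep_fixed_point: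
  assumes rep: "bdd_rep I C" and ne: "A \<noteq> {}"
    and supp: "\<And>a i. a \<in> A \<Longrightarrow> i \<notin> I \<Longrightarrow> a i = 0"
    and mid: "\<And>a b. a \<in> A \<Longrightarrow> b \<in> A \<Longrightarrow> (\<lambda>i. (a i + b i) / 2) \<in> A"
    and closed: "\<And>s x. (\<And>n. s n \<in> A) \<Longrightarrow> (\<And>i. (\<lambda>n. s n i) \<longlonglongrightarrow> x i) \<Longrightarrow> x \<in> A"
    and stable: "\<And>k a. is_unitary k \<Longrightarrow> a \<in> A \<Longrightarrow> mulv I (C k) a \<in> A"
  shows "\<exists>z\<in>A. \<forall>k. is_unitary k \<longrightarrow> mulv I (C k) z = z"
proof -
  have fin: "finite I" using rep by (simp add: bdd_rep_def)
  obtain M where M: "\<And>k i j. is_unitary k \<Longrightarrow> i \<in> I \<Longrightarrow> j \<in> I \<Longrightarrow> cmod (C k i j) \<le> M"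
    using rep by (auto simp: bdd_rep_def)
  \<comment> \<open>The summand 1 keeps \<open>B\<close> positive, since later constants divide by
    it.\<close>
  define B where "B = (of_nat (card I))\<^sup>2 * M\<^sup>2 + 1"
  have B0: "B > 0" unfolding B_def by (smt (verit) zero_le_mult_iff zero_le_power2)
  have nn: "sqnorm I z \<ge> 0" for z by (simp add: sqnorm_def sum_nonneg)
  have bnd: "sqnorm I (mulv I (C k) z) \<le> B * sqnorm I z" if "is_unitary k" for k z
    using sqnorm_mulv_le[OF fin, of "C k" M z] M[OF that] nn[of z] by (simp add: B_def algebra_simps)
  have inv: "mulv I (C (adj k)) (mulv I (C k) z) = z"
    if "is_unitary k" "\<And>i. i \<notin> I \<Longrightarrow> z i = 0" for k z
    using bdd_rep_mulv_mult[OF rep is_unitary_adj[OF that(1)] that(1), of z]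
      bdd_rep_mulv_1[OF rep, of z] that(2) is_unitary_left[OF that(1)] by metis
  define N where "N z = (SUP k\<in>{k. is_unitary k}. sqnorm I (mulv I (C k) z))" for z
  have bdd: "bdd_above ((\<lambda>k. sqnorm I (mulv I (C k) z)) ` {k. is_unitary k})" for z
    using bnd by (intro bdd_aboveI[of _ "B * sqnorm I z"]) auto
  have Nge: "sqnorm I (mulv I (C k) z) \<le> N z" if "is_unitary k" for k z
    unfolding N_def using that by (intro cSUP_upper bdd) auto
  have Nle: "N z \<le> c" if "\<And>k. is_unitary k \<Longrightarrow> sqnorm I (mulv I (C k) z) \<le> c" for z c
    unfolding N_def using that is_unitary_1 by (intro cSUP_least) auto
  have N0: "N z \<ge> 0" for z using Nge[OF is_unitary_1, of z] nn order_trans by blast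
  define r where "r = (INF z\<in>A. N z)"
  have bddb: "bdd_below (N ` A)" using N0 by (intro bdd_belowI[of _ 0]) auto
  have r_le: "r \<le> N z" if "z \<in> A" for z
    unfolding r_def using that by (intro cINF_lower bddb)
  \<comment> \<open>For the midpoint \<open>c\<close> some \<open>k\<close> gives a squared norm
    above r - e. The parallelogram law for the images of \<open>a\<close> and \<open>b\<close> under
    \<open>C k\<close> then leaves at most 2e for a quarter of the squared distance of these images,
    and undoing \<open>C k\<close> costs the factor \<open>B\<close>.\<close>
  have close: "sqnorm I (\<lambda>i. a i - b i) \<le> B * (8 * e)"
    if ab: "a \<in> A" "b \<in> A" "N a \<le> r + e" "N b \<le> r + e" "e > 0" for a b e
  proof -
    define c where "c = (\<lambda>i. (a i + b i) / 2)"
    have "r - e < N c" using r_le[OF mid[OF ab(1,2)]] ab(5) by (simp add: c_def)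
    then obtain k where k: "is_unitary k" "r - e < sqnorm I (mulv I (C k) c)"
      unfolding N_def using less_cSUP_iff[OF _ bdd] is_unitary_1 by blast
    have "mulv I (C k) c = (\<lambda>i. (mulv I (C k) a i + mulv I (C k) b i) / 2)"
      by (auto simp: mulv_def c_def fun_eq_iff algebra_simps sum.distrib add_divide_distrib sum_divide_distrib)
    moreover have diff: "mulv I (C k) (\<lambda>i. a i - b i) = (\<lambda>i. mulv I (C k) a i - mulv I (C k) b i)"
      by (auto simp: mulv_def fun_eq_iff algebra_simps sum_subtractf)
    ultimately have "sqnorm I (mulv I (C k) (\<lambda>i. a i - b i)) / 4 \<le> 2 * e"
      using k(2) Nge[OF k(1), of a] Nge[OF k(1), of b] ab(3,4)
        sqnorm_midpoint[of I "mulv I (C k) a" "mulv I (C k) b"]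
      by (simp add: field_simps)
    moreover have "sqnorm I (\<lambda>i. a i - b i) \<le> B * sqnorm I (mulv I (C k) (\<lambda>i. a i - b i))"
      using bnd[OF is_unitary_adj[OF k(1)], of "mulv I (C k) (\<lambda>i. a i - b i)"]
        inv[OF k(1), of "\<lambda>i. a i - b i"] supp[OF ab(1)] supp[OF ab(2)] by simp
    ultimately show ?thesis
      using B0 by (elim order_trans) (intro mult_left_mono, auto)
  qed
  have close': "cmod (a i - b i) \<le> sqrt (B * (8 * e))"
    if "a \<in> A" "b \<in> A" "N a \<le> r + e" "N b \<le> r + e" "e > 0" for a b e i
  proof (cases "i \<in> I")
    case True
    then have "(cmod (a i - b i))\<^sup>2 \<le> sqnorm I (\<lambda>i. a i - b i)"
      unfolding sqnorm_def using fin by (intro member_le_sum[where f="\<lambda>i. (cmod (a i - b i))\<^sup>2"]) auto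
    then show ?thesis using close[OF that] by (intro real_le_rsqrt) simp
  next
    case False
    show ?thesis using supp[OF that(1) False] supp[OF that(2) False] that(5) B0 by simp
  qed
  have "\<exists>z\<in>A. N z < r + inverse (of_nat (Suc n))" for n
    using cINF_less_iff[OF ne bddb, of "r + inverse (of_nat (Suc n))"] by (simp add: r_def)
  then obtain s where s: "\<And>n. s n \<in> A" "\<And>n. N (s n) < r + inverse (of_nat (Suc n))"
    by metis
  have "Cauchy (\<lambda>n. s n i)" for i
  proof (rule CauchyI)
    fix \<epsilon> :: real assume e: "\<epsilon> > 0"
    \<comment> \<open>Makes the bound of \<open>close'\<close> equal to half of the given number,
      which leaves room for strict inequality.\<close>
    define \<delta> where "\<delta> = (\<epsilon> / 2)\<^sup>2 / (8 * B)"
    have d: "\<delta> > 0" using e B0 by (simp add: \<delta>_def)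
    have sq: "sqrt (B * (8 * \<delta>)) = \<epsilon> / 2" using e B0 by (simp add: \<delta>_def)
    obtain n0 where n0: "inverse (of_nat (Suc n0)) < \<delta>" using reals_Archimedean[OF d] by blast
    have "N (s n) \<le> r + \<delta>" if "n \<ge> n0" for n
    proof -
      have "inverse (of_nat (Suc n)) \<le> inverse (of_nat (Suc n0) :: real)"
        using that by (intro le_imp_inverse_le) auto
      then show ?thesis using n0 s(2)[of n] by linarith
    qed
    then have "cmod (s m i - s n i) < \<epsilon>" if "m \<ge> n0" "n \<ge> n0" for m n
      using close'[OF s(1) s(1) _ _ d, of m n i] that e sq by auto
    then show "\<exists>M. \<forall>m\<ge>M. \<forall>n\<ge>M. cmod (s m i - s n i) < \<epsilon>" by blast
  qed
  then have "\<forall>i. \<exists>l. (\<lambda>n. s n i) \<longlonglongrightarrow> l" by (simp add: Cauchy_convergent_iff convergent_def)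
  then obtain z where z: "\<And>i. (\<lambda>n. s n i) \<longlonglongrightarrow> z i" by metis
  have zA: "z \<in> A" using closed[OF s(1) z] .
  \<comment> \<open>\<open>N\<close> is a supremum of continuous functions, so the bound survives
    the limit for each \<open>k\<close> separately.\<close>
  have Nz: "N z \<le> r"
  proof (rule Nle)
    fix k :: "'b cmat" assume k: "is_unitary k"
    have "(\<lambda>n. mulv I (C k) (s n) i) \<longlonglongrightarrow> mulv I (C k) z i" for i
      by (cases "i \<in> I") (auto simp: mulv_def intro!: tendsto_intros z)
    then have "(\<lambda>n. sqnorm I (mulv I (C k) (s n))) \<longlonglongrightarrow> sqnorm I (mulv I (C k) z)"
      unfolding sqnorm_def by (intro tendsto_intros)
    moreover have "(\<lambda>n. r + inverse (of_nat (Suc n))) \<longlonglongrightarrow> r + 0"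
      by (intro tendsto_intros LIMSEQ_inverse_real_of_nat)
    moreover have "sqnorm I (mulv I (C k) (s n)) \<le> r + inverse (of_nat (Suc n))" for n
      using Nge[OF k, of "s n"] s(2)[of n] by linarith
    ultimately show "sqnorm I (mulv I (C k) z) \<le> r"
      using LIMSEQ_le by fastforce
  qed
  \<comment> \<open>A translate of \<open>z\<close> is again a minimiser, so the estimate for
    near-minimisers forces it to be \<open>z\<close>.\<close>
  have "mulv I (C g) z = z" if g: "is_unitary g" for g
  proof
    fix i
    have Ng: "N (mulv I (C g) z) \<le> r"
    proof (rule Nle)
      fix k :: "'b cmat" assume k: "is_unitary k"
      show "sqnorm I (mulv I (C k) (mulv I (C g) z)) \<le> r"
        using Nge[OF is_unitary_mul[OF k g], of z] bdd_rep_mulv_mult[OF rep k g, of z] Nz by simp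
    qed
    have "cmod (mulv I (C g) z i - z i) \<le> \<epsilon>" if e: "\<epsilon> > 0" for \<epsilon>
    proof -
      have "cmod (mulv I (C g) z i - z i) \<le> sqrt (B * (8 * (\<epsilon>\<^sup>2 / (8 * B))))"
        using Ng Nz zA stable[OF g zA] e B0 by (intro close') (auto intro: order_trans)
      then show ?thesis using e B0 by simp
    qed
    then have "cmod (mulv I (C g) z i - z i) \<le> 0" by (rule field_le_epsilon) simp
    then show "mulv I (C g) z i = z i" by simp
  qed
  then show ?thesis using zA by blast
qed

text \<open>The hypotheses make the coset z + S convex, closed and stable. With \<open>S\<close> the
  displacements this produces an invariant; with \<open>S\<close> a kernel it lifts one.\<close>

lemma bdd_rep_fixed_in_coset:
  assumes rep: "bdd_rep I C" and S: "fun_subspace I S"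
    and stab: "\<And>k x. is_unitary k \<Longrightarrow> x \<in> S \<Longrightarrow> mulv I (C k) x \<in> S"
    and z: "\<And>i. i \<notin> I \<Longrightarrow> z i = 0" "\<And>k. is_unitary k \<Longrightarrow> mulv I (C k) z - z \<in> S"
  shows "\<exists>p. p - z \<in> S \<and> (\<forall>i. i \<notin> I \<longrightarrow> p i = 0) \<and> (\<forall>k. is_unitary k \<longrightarrow> mulv I (C k) p = p)"
proof -
  have fin: "finite I" using rep by (simp add: bdd_rep_def)
  define A where "A = {p. p - z \<in> S}"
  have add: "y + x \<in> S" if "y \<in> S" "x \<in> S" for y x
    using S that by (auto simp: fun_subspace_def)
  have supp: "x i = 0" if "x \<in> S" "i \<notin> I" for x i
    using S that by (auto simp: fun_subspace_def)
  have "\<exists>p\<in>A. \<forall>k. is_unitary k \<longrightarrow> mulv I (C k) p = p"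
  proof (rule bdd_rep_fixed_point[OF rep])
    show "A \<noteq> {}" using S by (auto simp: A_def fun_subspace_def intro!: exI[of _ z])
    show "a i = 0" if "a \<in> A" "i \<notin> I" for a i
      using supp[of "a - z" i] that z(1) by (auto simp: A_def)
    show "(\<lambda>i. (a i + b i) / 2) \<in> A" if "a \<in> A" "b \<in> A" for a b
    proof -
      have "(\<lambda>i. (1/2) * ((a - z) + (b - z)) i) \<in> S"
        using add[of "a - z" "b - z"] that S unfolding A_def fun_subspace_def by blast
      also have "(\<lambda>i. (1/2) * ((a - z) + (b - z)) i) = (\<lambda>i. (a i + b i) / 2) - z"
        by (auto simp: fun_eq_iff field_simps)
      finally show ?thesis unfolding A_def by blast
    qed
    show "x \<in> A" if "\<And>n. s n \<in> A" "\<And>i. (\<lambda>n. s n i) \<longlonglongrightarrow> x i" for s x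
      unfolding A_def mem_Collect_eq
    proof (rule fun_subspace_closed[OF fin S, of "\<lambda>n. s n - z"])
      show "s n - z \<in> S" for n using that(1)[of n] unfolding A_def by blast
      show "(\<lambda>n. (s n - z) i) \<longlonglongrightarrow> (x - z) i" for i
        using tendsto_diff[OF that(2)[of i] tendsto_const[of "z i"]] by simp
    qed
    show "mulv I (C k) a \<in> A" if "is_unitary k" "a \<in> A" for k a
    proof -
      have "mulv I (C k) (a - z) + (mulv I (C k) z - z) \<in> S"
        using that by (intro add stab z(2)) (auto simp: A_def)
      also have "mulv I (C k) (a - z) + (mulv I (C k) z - z) = mulv I (C k) a - z"
        by (auto simp: mulv_def fun_eq_iff algebra_simps sum_subtractf)
      finally show ?thesis unfolding A_def by blast
    qed
  qed
  then obtain p where "p \<in> A" "\<forall>k. is_unitary k \<longrightarrow> mulv I (C k) p = p" by blast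
  moreover have "p i = 0" if "i \<notin> I" for i
    using supp[of "p - z" i] \<open>p \<in> A\<close> that z(1) by (auto simp: A_def)
  ultimately show ?thesis unfolding A_def by blast
qed

text \<open>The fixed point lemma is applied in the dual representation, to the functionals with value 1 at \<open>z\<close>.\<close>

lemma bdd_rep_fixed_functional:
  assumes rep: "bdd_rep I C" and z: "\<And>i. i \<notin> I \<Longrightarrow> z i = 0" "z \<noteq> 0"
    and fixed: "\<And>k. is_unitary k \<Longrightarrow> mulv I (C k) z = z"
  shows "\<exists>f. (\<Sum>i\<in>I. f i * z i) = 1 \<and>
    (\<forall>k x. is_unitary k \<longrightarrow> (\<Sum>i\<in>I. f i * mulv I (C k) x i) = (\<Sum>i\<in>I. f i * x i))"
proof -
  have fin: "finite I" using rep by (simp add: bdd_rep_def)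
  \<comment> \<open>For the pairing by summation over \<open>I\<close>, a vector fixed by this
    contragredient is an invariant functional.\<close>
  define D where "D = (\<lambda>k i j. C (adj k) j i)"
  have repD: "bdd_rep I D" unfolding D_def by (rule bdd_rep_dual[OF rep])
  have pair: "(\<Sum>i\<in>I. mulv I (D k) f i * x i) = (\<Sum>i\<in>I. f i * mulv I (C (adj k)) x i)" for k f x
  proof -
    have "(\<Sum>i\<in>I. mulv I (D k) f i * x i) = (\<Sum>i\<in>I. \<Sum>j\<in>I. C (adj k) j i * f j * x i)"
      by (simp add: mulv_def D_def sum_distrib_right)
    also have "\<dots> = (\<Sum>j\<in>I. \<Sum>i\<in>I. C (adj k) j i * f j * x i)" by (rule sum.swap)
    also have "\<dots> = (\<Sum>i\<in>I. f i * mulv I (C (adj k)) x i)"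
      by (simp add: mulv_def sum_distrib_left mult_ac)
    finally show ?thesis .
  qed
  define A where "A = {f. (\<forall>i. i \<notin> I \<longrightarrow> f i = 0) \<and> (\<Sum>i\<in>I. f i * z i) = 1}"
  have "\<exists>f\<in>A. \<forall>k. is_unitary k \<longrightarrow> mulv I (D k) f = f"
  proof (rule bdd_rep_fixed_point[OF repD])
    obtain i where i: "z i \<noteq> 0" using z(2) by (auto simp: fun_eq_iff)
    then have "i \<in> I" using z(1) by blast
    have "(\<lambda>j. if j = i then 1 / z i else 0) \<in> A"
      using i \<open>i \<in> I\<close> fin by (auto simp: A_def if_distrib[where f="\<lambda>c. c * _"] cong: if_cong)
    then show "A \<noteq> {}" by blast
    show "(\<lambda>i. (a i + b i) / 2) \<in> A" if "a \<in> A" "b \<in> A" for a b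
      using that by (simp add: A_def add_divide_distrib ring_distribs sum.distrib sum_divide_distrib[symmetric])
    show "x \<in> A" if s: "\<And>n. s n \<in> A" "\<And>i. (\<lambda>n. s n i) \<longlonglongrightarrow> x i" for s x
    proof -
      have "(\<lambda>n. \<Sum>i\<in>I. s n i * z i) \<longlonglongrightarrow> (\<Sum>i\<in>I. x i * z i)" by (intro tendsto_intros s)
      moreover have "x i = 0" if "i \<notin> I" for i
        using s(2)[of i] s(1) that by (simp add: A_def LIMSEQ_const_iff)
      ultimately show ?thesis using s(1) by (simp add: A_def LIMSEQ_const_iff)
    qed
    show "mulv I (D k) a \<in> A" if "is_unitary k" "a \<in> A" for k a
      using that pair[of k a z] fixed[OF is_unitary_adj[OF that(1)]]
      by (simp add: A_def mulv_def[of _ "D k"])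
  qed (auto simp: A_def)
  then obtain f where f: "f \<in> A" "\<And>k. is_unitary k \<Longrightarrow> mulv I (D k) f = f" by blast
  have "(\<Sum>i\<in>I. f i * mulv I (C k) x i) = (\<Sum>i\<in>I. f i * x i)" if "is_unitary k" for k x
    using pair[of "adj k" f x] f(2)[OF is_unitary_adj[OF that]] by (simp add: adj_adj)
  then show ?thesis using f(1) by (auto simp: A_def)
qed

section \<open>The matrix exponential\<close>

lemma mpow_0: "mpow Z 0 = mat 1" and mpow_Suc: "mpow Z (Suc k) = Z ** mpow Z k"
  by (simp_all add: mpow_def)

lemma mpow_scaleR: "mpow (t *\<^sub>R Z) k $ i $ j = of_real t ^ k * mpow Z k $ i $ j"
proof (induction k arbitrary: i j)
  case 0
  show ?case by (simp add: mpow_0)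
next
  case (Suc k)
  show ?case
    unfolding mpow_Suc matrix_matrix_mult_def
    by (simp add: Suc.IH sum_distrib_left mult_ac) (simp add: scaleR_conv_of_real mult_ac)
qed

lemma mpow_entry_bound:
  fixes Z :: "('n::finite) cmat"
  assumes "\<And>i j. cmod (Z $ i $ j) \<le> M" "M \<ge> 0"
  shows "cmod (mpow Z k $ i $ j) \<le> (of_nat CARD('n) * M) ^ k"
proof (induction k arbitrary: i j)
  case 0
  show ?case by (simp add: mpow_0 mat_def)
next
  case (Suc k)
  have "cmod (mpow Z (Suc k) $ i $ j) \<le> (\<Sum>l\<in>UNIV. cmod (Z $ i $ l) * cmod (mpow Z k $ l $ j))"
    by (simp add: mpow_Suc matrix_matrix_mult_def norm_mult[symmetric] norm_sum)
  also have "\<dots> \<le> (\<Sum>l\<in>(UNIV::'n set). M * (of_nat CARD('n) * M) ^ k)"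
    using assms by (intro sum_mono mult_mono Suc.IH) auto
  finally show ?case by simp
qed

text \<open>An entry of exp(xZ) as a scalar power series in a complex variable, so that termwise
  differentiation applies.\<close>

definition exp_entry :: "('n::finite) cmat \<Rightarrow> 'n \<Rightarrow> 'n \<Rightarrow> complex \<Rightarrow> complex" where
  "exp_entry Z i j x = (\<Sum>k. mpow Z k $ i $ j / fact k * x ^ k)"

lemma exp_entry_summable:
  fixes Z :: "('n::finite) cmat"
  shows "summable (\<lambda>k. mpow Z k $ i $ j / fact k * x ^ k)"
proof -
  obtain M where M: "\<And>i j. cmod (Z $ i $ j) \<le> M" "M \<ge> 0"
    by (meson Finite_Cartesian_Product.norm_nth_le norm_ge_zero order_trans)
  have "summable (\<lambda>k. (of_nat CARD('n) * M * cmod x) ^ k /\<^sub>R fact k)"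
    by (rule summable_exp_generic)
  then show ?thesis
  proof (rule summable_comparison_test')
    fix k
    have "cmod (mpow Z k $ i $ j / fact k * x ^ k) = cmod (mpow Z k $ i $ j) * cmod x ^ k / fact k"
      by (simp add: norm_mult norm_divide norm_power)
    also have "\<dots> \<le> (of_nat CARD('n) * M) ^ k * cmod x ^ k / fact k"
      using mpow_entry_bound[OF M, of k i j] by (intro divide_right_mono mult_right_mono) auto
    finally show "cmod (mpow Z k $ i $ j / fact k * x ^ k) \<le> (of_nat CARD('n) * M * cmod x) ^ k /\<^sub>R fact k"
      by (simp add: power_mult_distrib divide_inverse mult_ac)
  qed
qed

lemma mexp_entry: "mexp (t *\<^sub>R Z) $ i $ j = exp_entry Z i j (of_real t)"
proof -
  have "(\<lambda>k. (1 / fact k) *\<^sub>R mpow (t *\<^sub>R Z) k) sums (\<chi> i j. exp_entry Z i j (of_real t))"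
    unfolding sums_def
  proof (intro vec_tendstoI)
    fix i j
    have "(\<lambda>n. \<Sum>k<n. mpow Z k $ i $ j / fact k * (of_real t) ^ k) \<longlonglongrightarrow> exp_entry Z i j (of_real t)"
      using exp_entry_summable[of Z i j "of_real t"] unfolding exp_entry_def
      by (simp add: summable_LIMSEQ)
    also have "(\<lambda>n. \<Sum>k<n. mpow Z k $ i $ j / fact k * (of_real t) ^ k)
        = (\<lambda>n. (\<Sum>k<n. (1 / fact k) *\<^sub>R mpow (t *\<^sub>R Z) k) $ i $ j)"
      by (intro ext) (auto simp: mpow_scaleR scaleR_conv_of_real[where 'a=complex] field_simps intro!: sum.cong)
    finally show "(\<lambda>n. (\<Sum>k<n. (1 / fact k) *\<^sub>R mpow (t *\<^sub>R Z) k) $ i $ j)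
        \<longlonglongrightarrow> (\<chi> i j. exp_entry Z i j (of_real t)) $ i $ j" by simp
  qed
  then show ?thesis unfolding mexp_def by (simp add: sums_unique[symmetric])
qed

lemma exp_entry_0: "exp_entry Z i j 0 = (if i = j then 1 else 0)"
  unfolding exp_entry_def powser_zero by (simp add: mpow_0 mat_def)

text \<open>Termwise differentiation turns the coefficient of Z^k / k! into that of Z^(k+1) / k!;
  splitting off the left factor \<open>Z\<close> gives Z exp(xZ).\<close>

lemma exp_entry_has_derivative:
  "(exp_entry Z i j has_field_derivative (\<Sum>l\<in>UNIV. Z $ i $ l * exp_entry Z l j x)) (at x)"
proof -
  have "(exp_entry Z i j has_field_derivative
      (\<Sum>k. diffs (\<lambda>k. mpow Z k $ i $ j / fact k) k * x ^ k)) (at x)"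
    unfolding exp_entry_def
    by (rule termdiffs_strong_converges_everywhere) (rule exp_entry_summable)
  also have "(\<lambda>k. diffs (\<lambda>k. mpow Z k $ i $ j / fact k) k * x ^ k)
      = (\<lambda>k. \<Sum>l\<in>UNIV. Z $ i $ l * (mpow Z k $ l $ j / fact k * x ^ k))"
  proof
    fix k
    have "diffs (\<lambda>k. mpow Z k $ i $ j / fact k) k = mpow Z (Suc k) $ i $ j / fact k"
      by (simp add: diffs_def del: of_nat_Suc)
    also have "\<dots> = (\<Sum>l\<in>UNIV. Z $ i $ l * (mpow Z k $ l $ j / fact k))"
      by (simp add: mpow_Suc matrix_matrix_mult_def sum_divide_distrib)
    finally show "diffs (\<lambda>k. mpow Z k $ i $ j / fact k) k * x ^ k
      = (\<Sum>l\<in>UNIV. Z $ i $ l * (mpow Z k $ l $ j / fact k * x ^ k))"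
      by (simp add: sum_distrib_right mult.assoc)
  qed
  also have "(\<Sum>k. \<Sum>l\<in>UNIV. Z $ i $ l * (mpow Z k $ l $ j / fact k * x ^ k))
      = (\<Sum>l\<in>UNIV. Z $ i $ l * exp_entry Z l j x)"
    unfolding exp_entry_def
    by (simp only: suminf_sum[OF summable_mult[OF exp_entry_summable]] suminf_mult[OF exp_entry_summable])
  finally show ?thesis .
qed

lemma mexp_entry_has_derivative:
  "((\<lambda>t::real. mexp (t *\<^sub>R Z) $ i $ j) has_vector_derivative
     (\<Sum>l\<in>UNIV. Z $ i $ l * mexp (t *\<^sub>R Z) $ l $ j)) (at t)"
  unfolding mexp_entry
  by (rule has_vector_derivative_real_field) (rule exp_entry_has_derivative)

lemma mexp_0: "mexp (0 *\<^sub>R Z) = mat 1"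
  by (simp add: vec_eq_iff mexp_entry[of 0 Z, simplified] exp_entry_0 mat_def)

text \<open>For skew-Hermitian \<open>Z\<close> the matrix \<open>adj (mexp (t Z)) ** mexp (t Z)\<close> has derivative zero in \<open>t\<close>.\<close>

lemma mexp_unitary:
  assumes "skew_herm Z"
  shows "is_unitary (mexp (t *\<^sub>R Z))"
proof -
  define g where "g = (\<lambda>i j (t::real). mexp (t *\<^sub>R Z) $ i $ j)"
  define g' where "g' = (\<lambda>i j t. \<Sum>l\<in>UNIV. Z $ i $ l * g l j t)"
  have g: "(g i j has_vector_derivative g' i j t) (at t)" for i j t
    unfolding g_def g'_def by (rule mexp_entry_has_derivative)
  have skew: "cnj (Z $ a $ b) = - Z $ b $ a" for a b
  proof -
    have "(Z + adj Z) $ b $ a = 0" using assms by (simp add: skew_herm_def)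
    then show ?thesis by (simp add: adj_def eq_neg_iff_add_eq_0 add.commute)
  qed
  \<comment> \<open>The product rule gives two terms, and moving \<open>Z\<close> across with its
    adjoint -Z makes them cancel.\<close>
  have zero: "(\<Sum>l\<in>UNIV. cnj (g l i t) * g' l j t + cnj (g' l i t) * g l j t) = 0" for i j t
  proof -
    have "(\<Sum>l\<in>UNIV. cnj (g' l i t) * g l j t)
        = (\<Sum>l\<in>UNIV. \<Sum>b\<in>UNIV. - (cnj (g b i t) * (Z $ b $ l * g l j t)))"
      by (simp add: g'_def skew sum_distrib_left sum_negf mult_ac)
    also have "\<dots> = (\<Sum>b\<in>UNIV. \<Sum>l\<in>UNIV. - (cnj (g b i t) * (Z $ b $ l * g l j t)))"
      by (rule sum.swap)
    also have "\<dots> = - (\<Sum>l\<in>UNIV. cnj (g l i t) * g' l j t)"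
      by (simp add: g'_def sum_distrib_left sum_negf)
    finally show ?thesis by (simp add: sum.distrib)
  qed
  have "(\<Sum>l\<in>UNIV. cnj (g l i t) * g l j t) = (if i = j then 1 else 0)" for i j
  proof -
    have "((\<lambda>t. \<Sum>l\<in>UNIV. cnj (g l i t) * g l j t) has_vector_derivative 0) (at s within UNIV)" for s
      unfolding zero[of i s j, symmetric]
      by (intro has_vector_derivative_sum has_vector_derivative_mult has_vector_derivative_cnj g)
    then obtain c where "\<And>s. (\<Sum>l\<in>UNIV. cnj (g l i s) * g l j s) = c"
      using has_vector_derivative_zero_constant[of UNIV "\<lambda>t. \<Sum>l\<in>UNIV. cnj (g l i t) * g l j t"] by auto
    then have "(\<Sum>l\<in>UNIV. cnj (g l i t) * g l j t) = (\<Sum>l\<in>UNIV. cnj (g l i 0) * g l j 0)" by simp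
    also have "\<dots> = (\<Sum>l\<in>UNIV. if l = i then (if i = j then 1 else 0) else 0)"
      unfolding g_def mexp_0 by (intro sum.cong) (auto simp: mat_def)
    finally show ?thesis by simp
  qed
  then have "adj (mexp (t *\<^sub>R Z)) ** mexp (t *\<^sub>R Z) = mat 1"
    by (simp add: vec_eq_iff matrix_matrix_mult_def adj_def mat_def g_def)
  then show ?thesis unfolding is_unitary_def using matrix_left_right_inverse by blast
qed

section \<open>Tensor powers of the standard representation\<close>

lemma finite_words: "finite (words m :: ('n::finite) list set)"
  using finite_lists_length_eq[of "UNIV :: 'n set" m] by (simp add: words_def)

lemma words_Suc: "words (Suc m) = (\<lambda>(i, J). i # J) ` (UNIV \<times> words m)"
  by (auto simp: words_def length_Suc_conv)

text \<open>Expanding the product picks one index per slot, that is, a word.\<close>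

lemma prod_sum_words:
  "(\<Prod>t<m. \<Sum>i\<in>UNIV. f t i) = (\<Sum>J\<in>words m. \<Prod>t<m. f t (J ! t :: 'n::finite) :: complex)"
proof (induction m arbitrary: f)
  case 0
  show ?case by (simp add: words_def)
next
  case (Suc m)
  have "(\<Sum>J\<in>words (Suc m). \<Prod>t<Suc m. f t (J ! t)) =
      (\<Sum>(i, J)\<in>UNIV \<times> words m. f 0 i * (\<Prod>t<m. f (Suc t) (J ! t)))"
    unfolding words_Suc
    by (subst sum.reindex) (auto simp: inj_on_def prod.lessThan_Suc_shift simp del: prod.lessThan_Suc intro!: sum.cong)
  also have "\<dots> = (\<Sum>i\<in>UNIV. f 0 i) * (\<Sum>J\<in>words m. \<Prod>t<m. f (Suc t) (J ! t))"
    by (simp add: sum.cartesian_product[symmetric] sum_product)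
  also have "\<dots> = (\<Prod>t<Suc m. \<Sum>i\<in>UNIV. f t i)"
    by (simp add: Suc.IH[of "\<lambda>t. f (Suc t)"] prod.lessThan_Suc_shift del: prod.lessThan_Suc)
  finally show ?case by simp
qed

text \<open>Matrix coefficient of \<open>k\<close> on the m-th tensor power of \<open>V\<close>; the
  conjugate is there because g acts on \<open>V\<close> by its conjugate.\<close>

definition tcoef :: "nat \<Rightarrow> ('n::finite) cmat \<Rightarrow> 'n list \<Rightarrow> 'n list \<Rightarrow> complex" where
  "tcoef m k J I = (\<Prod>t<m. cnj (k $ (J ! t) $ (I ! t)))"

lemma tcoef_mult:
  "tcoef m (k ** l) J I = (\<Sum>H\<in>words m. tcoef m k J H * tcoef m l H I)"
proof -
  have "tcoef m (k ** l) J I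
      = (\<Prod>t<m. \<Sum>i\<in>UNIV. cnj (k $ (J ! t) $ i) * cnj (l $ i $ (I ! t)))"
    by (simp add: tcoef_def matrix_matrix_mult_def)
  also have "\<dots> = (\<Sum>H\<in>words m. tcoef m k J H * tcoef m l H I)"
    unfolding prod_sum_words tcoef_def prod.distrib ..
  finally show ?thesis .
qed

lemma tcoef_1:
  assumes "length J = m" "length I = m"
  shows "tcoef m (mat 1) J I = (if J = I then 1 else 0)"
proof (cases "J = I")
  case False
  then obtain t where "t < m" "J ! t \<noteq> I ! t" using assms nth_equalityI by metis
  then have "tcoef m (mat 1) J I = 0"
    unfolding tcoef_def by (intro prod_zero) (auto simp: mat_def)
  then show ?thesis using False by simp
qed (simp add: tcoef_def mat_def)

lemma tcoef_adj: "cnj (tcoef m k J I) = tcoef m (adj k) I J"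
  by (simp add: tcoef_def adj_def)

text \<open>Each row of a unitary matrix has Euclidean norm 1.\<close>

lemma unitary_entry_le_1:
  assumes "is_unitary k"
  shows "cmod (k $ i $ j) \<le> 1"
proof -
  have "(k ** adj k) $ i $ i = 1" using assms by (simp add: is_unitary_def mat_def)
  then have "(\<Sum>l\<in>UNIV. k $ i $ l * cnj (k $ i $ l)) = 1"
    by (simp add: matrix_matrix_mult_def adj_def)
  then have "of_real (\<Sum>l\<in>UNIV. (cmod (k $ i $ l))\<^sup>2) = (1 :: complex)"
    by (simp add: complex_norm_square del: of_real_power)
  then have "(\<Sum>l\<in>UNIV. (cmod (k $ i $ l))\<^sup>2) = 1" by (simp only: of_real_eq_1_iff)
  moreover have "(cmod (k $ i $ j))\<^sup>2 \<le> (\<Sum>l\<in>UNIV. (cmod (k $ i $ l))\<^sup>2)"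
    by (rule member_le_sum[where f="\<lambda>l. (cmod (k $ i $ l))\<^sup>2"]) auto
  ultimately show ?thesis by (simp add: power_le_one_iff)
qed

lemma tcoef_le_1: "is_unitary k \<Longrightarrow> cmod (tcoef m k J I) \<le> 1"
  unfolding tcoef_def by (simp add: prod_norm[symmetric] prod_le_1 unitary_entry_le_1)

lemma compact_unitary: "compact {k :: ('n::finite) cmat. is_unitary k}"
proof -
  have "is_unitary k \<longleftrightarrow> (\<forall>i j. (\<Sum>l\<in>UNIV. k $ i $ l * cnj (k $ j $ l)) = (if i = j then 1 else 0))"
    for k :: "'n cmat"
    by (simp add: is_unitary_def vec_eq_iff matrix_matrix_mult_def adj_def mat_def)
  then have "closed {k :: 'n cmat. is_unitary k}"
    by (simp only:) (intro closed_Collect_all closed_Collect_eq continuous_intros)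
  moreover have "bounded {k :: 'n cmat. is_unitary k}"
  proof (rule boundedI)
    fix k :: "'n cmat" assume "k \<in> {k. is_unitary k}"
    then have k: "is_unitary k" by simp
    have "norm k \<le> (\<Sum>i\<in>UNIV. norm (k $ i))" unfolding norm_vec_def by (rule L2_set_le_sum) simp
    also have "\<dots> \<le> (\<Sum>i\<in>(UNIV::'n set). \<Sum>j\<in>(UNIV::'n set). 1)"
    proof (rule sum_mono)
      fix i
      have "norm (k $ i) \<le> (\<Sum>j\<in>UNIV. norm (k $ i $ j))"
        unfolding norm_vec_def[of "k $ i"] by (rule L2_set_le_sum) simp
      also have "\<dots> \<le> (\<Sum>j\<in>(UNIV::'n set). 1)" using unitary_entry_le_1[OF k] by (rule sum_mono)
      finally show "norm (k $ i) \<le> (\<Sum>j\<in>(UNIV::'n set). 1)" .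
    qed
    finally show "norm k \<le> (\<Sum>i\<in>(UNIV::'n set). \<Sum>j\<in>(UNIV::'n set). 1)" .
  qed
  ultimately show ?thesis by (simp add: compact_eq_bounded_closed)
qed

lemma unitary_continuous_bounded:
  fixes f :: "('n::finite) cmat \<Rightarrow> complex"
  assumes "continuous_on {k. is_unitary k} f"
  shows "\<exists>M. \<forall>k. is_unitary k \<longrightarrow> cmod (f k) \<le> M"
  using compact_imp_bounded[OF compact_continuous_image[OF assms compact_unitary]]
  by (auto simp: bounded_iff)

section \<open>Vector space arithmetic on a carrier set\<close>

locale complex_space =
  fixes X :: "('x::ab_group_add) set" and sc :: "complex \<Rightarrow> 'x \<Rightarrow> 'x"
  assumes cvs: "cvs X sc"
begin

lemma zero_in: "0 \<in> X"
  and add_in: "x \<in> X \<Longrightarrow> y \<in> X \<Longrightarrow> x + y \<in> X"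
  and sc_in: "x \<in> X \<Longrightarrow> sc c x \<in> X"
  and sc_add: "x \<in> X \<Longrightarrow> y \<in> X \<Longrightarrow> sc c (x + y) = sc c x + sc c y"
  and sc_plus: "x \<in> X \<Longrightarrow> sc (c + d) x = sc c x + sc d x"
  and sc_mult: "x \<in> X \<Longrightarrow> sc (c * d) x = sc c (sc d x)"
  and sc_1: "x \<in> X \<Longrightarrow> sc 1 x = x"
  using cvs by (simp_all add: cvs_def)

lemma sc_0: "x \<in> X \<Longrightarrow> sc 0 x = 0"
  using sc_plus[of x 0 0] by simp

lemma sc_zero: "sc c 0 = 0"
  using sc_add[OF zero_in zero_in, of c] by simp

lemma sc_m1: "x \<in> X \<Longrightarrow> sc (- 1) x = - x"
  using sc_plus[of x "-1" 1] by (simp add: sc_0 sc_1 eq_neg_iff_add_eq_0)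

lemma uminus_in: "x \<in> X \<Longrightarrow> - x \<in> X"
  using sc_m1 sc_in by metis

lemma diff_in: "x \<in> X \<Longrightarrow> y \<in> X \<Longrightarrow> x - y \<in> X"
  using add_in[of x "- y"] uminus_in by simp

lemma sum_in: "(\<And>i. i \<in> A \<Longrightarrow> f i \<in> X) \<Longrightarrow> sum f A \<in> X"
  by (induction A rule: infinite_finite_induct) (auto simp: zero_in add_in)

lemma sc_sum: "(\<And>i. i \<in> A \<Longrightarrow> f i \<in> X) \<Longrightarrow> sc c (sum f A) = (\<Sum>i\<in>A. sc c (f i))"
  by (induction A rule: infinite_finite_induct) (auto simp: sc_zero sc_add sum_in)

lemma sum_sc: "x \<in> X \<Longrightarrow> sc (\<Sum>i\<in>A. c i) x = (\<Sum>i\<in>A. sc (c i) x)"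
  by (induction A rule: infinite_finite_induct) (auto simp: sc_0 sc_plus)

lemma sc_uminus: "x \<in> X \<Longrightarrow> sc (- c) x = - sc c x"
  using sc_plus[of x "- c" c] by (simp add: sc_0 eq_neg_iff_add_eq_0)

lemma sc_minus: "x \<in> X \<Longrightarrow> sc (c - d) x = sc c x - sc d x"
  using sc_plus[of x c "- d"] by (simp add: sc_uminus)

lemma sc_neg: "x \<in> X \<Longrightarrow> sc c (- x) = - sc c x"
  using sc_mult[of x c "-1"] by (simp add: sc_m1 sc_uminus sc_1)

lemma sc_diff: "x \<in> X \<Longrightarrow> y \<in> X \<Longrightarrow> sc c (x - y) = sc c x - sc c y"
  using sc_add[of x "- y" c] by (simp add: sc_neg uminus_in)

lemma sc_delta: "x \<in> X \<Longrightarrow> sc (if b then 1 else 0) x = (if b then x else 0)"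
  by (simp add: sc_1 sc_0)

end

section \<open>Splitting off the invariants\<close>

text \<open>The span of all displacements of coordinate vectors. Scalars can be absorbed into
  \<open>y\<close>, so adding generators one at a time already yields a subspace.\<close>

inductive_set cospan :: "'i set \<Rightarrow> (('n::finite) cmat \<Rightarrow> 'i \<Rightarrow> 'i \<Rightarrow> complex) \<Rightarrow> ('i \<Rightarrow> complex) set"
  for I C where
  zero: "0 \<in> cospan I C"
| step: "z \<in> cospan I C \<Longrightarrow> (\<forall>i. i \<notin> I \<longrightarrow> y i = 0) \<Longrightarrow> is_unitary k
    \<Longrightarrow> z + (mulv I (C k) y - y) \<in> cospan I C"

text \<open>As simp rules these would unfold eta-expanded sums of functions pointwise.\<close>

declare plus_fun_apply [simp del] zero_fun_apply [simp del] minus_apply [simp del] uminus_apply [simp del]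

lemmas fun_ops = plus_fun_apply zero_fun_apply minus_apply uminus_apply

lemma cospan_zero: "0 \<in> cospan I C"
  by (rule cospan.zero)

lemma cospan_step: "z \<in> cospan I C \<Longrightarrow> (\<forall>i. i \<notin> I \<longrightarrow> y i = 0) \<Longrightarrow> is_unitary k
    \<Longrightarrow> z + (mulv I (C k) y - y) \<in> cospan I C"
  by (rule cospan.step)

lemma cospan_induct [consumes 1, case_names zero step]:
  assumes "z \<in> cospan I C" "P 0"
    and "\<And>z y k. z \<in> cospan I C \<Longrightarrow> P z \<Longrightarrow> (\<forall>i. i \<notin> I \<longrightarrow> y i = 0) \<Longrightarrow> is_unitary k
      \<Longrightarrow> P (z + (mulv I (C k) y - y))"
  shows "P z"
  using assms by (rule cospan.induct)

lemma mulv_scale: "mulv I A (\<lambda>i. c * x i) = (\<lambda>i. c * mulv I A x i)"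
  by (auto simp: mulv_def fun_eq_iff fun_ops algebra_simps sum_distrib_left)

lemma cospan_supp: "z \<in> cospan I C \<Longrightarrow> i \<notin> I \<Longrightarrow> z i = 0"
  by (induction rule: cospan_induct) (auto simp: mulv_def fun_ops)

lemma cospan_add: "y \<in> cospan I C \<Longrightarrow> x \<in> cospan I C \<Longrightarrow> x + y \<in> cospan I C"
proof (induction rule: cospan_induct)
  case (step z y k)
  have "x + z + (mulv I (C k) y - y) \<in> cospan I C"
    using step by (intro cospan_step) auto
  then show ?case by (simp only: add.assoc)
qed simp

lemma cospan_scale: "y \<in> cospan I C \<Longrightarrow> (\<lambda>i. c * y i) \<in> cospan I C"
proof (induction rule: cospan_induct)
  case zero
  have "(\<lambda>i. c * (0 :: 'a \<Rightarrow> complex) i) = 0" by (simp add: fun_eq_iff fun_ops)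
  then show ?case using cospan_zero by metis
next
  case (step z y k)
  have "(\<lambda>i. c * z i) + (mulv I (C k) (\<lambda>i. c * y i) - (\<lambda>i. c * y i)) \<in> cospan I C"
    using step by (intro cospan_step) auto
  also have "(\<lambda>i. c * z i) + (mulv I (C k) (\<lambda>i. c * y i) - (\<lambda>i. c * y i))
      = (\<lambda>i. c * (z + (mulv I (C k) y - y)) i)"
    by (simp add: mulv_scale fun_eq_iff fun_ops algebra_simps)
  finally show ?case .
qed

lemma cospan_subspace: "fun_subspace I (cospan I C)"
  unfolding fun_subspace_def
  by (intro conjI ballI allI impI cospan_zero cospan_scale cospan_add) (rule cospan_supp)

lemma cospan_displacement:
  "(\<forall>i. i \<notin> I \<longrightarrow> y i = 0) \<Longrightarrow> is_unitary k \<Longrightarrow> mulv I (C k) y - y \<in> cospan I C"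
  using cospan_step[OF cospan_zero, of I y k C] by simp

lemma cospan_stable:
  assumes "z \<in> cospan I C" "is_unitary k"
  shows "mulv I (C k) z \<in> cospan I C"
proof -
  have "mulv I (C k) z - z \<in> cospan I C"
    using assms cospan_supp by (intro cospan_displacement) auto
  from cospan_add[OF assms(1) this] show ?thesis by simp
qed

text \<open>A nonzero fixed vector has an invariant functional with value 1 on it, but invariant
  functionals vanish on displacements.\<close>

lemma cospan_fixed_eq_0:
  assumes rep: "bdd_rep I C" and z: "z \<in> cospan I C"
    and fixed: "\<And>k. is_unitary k \<Longrightarrow> mulv I (C k) z = z"
  shows "z = 0"
proof (rule ccontr)
  assume "z \<noteq> 0"
  then obtain f where f: "(\<Sum>i\<in>I. f i * z i) = 1"
    "\<And>k x. is_unitary k \<Longrightarrow> (\<Sum>i\<in>I. f i * mulv I (C k) x i) = (\<Sum>i\<in>I. f i * x i)"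
    using bdd_rep_fixed_functional[OF rep cospan_supp[OF z] _ fixed] by blast
  have "(\<Sum>i\<in>I. f i * z i) = 0"
    using z
  proof (induction rule: cospan_induct)
    case (step z y k)
    then show ?case using f(2)[of k y] by (simp add: fun_ops ring_distribs sum.distrib sum_subtractf)
  qed (simp add: fun_ops)
  then show False using f(1) by simp
qed

text \<open>The tensor product of \<open>X\<close> with the m-th power of \<open>V\<close>. Values
  at words of other lengths are pinned to 0, so that equal tensors are equal functions.\<close>

definition tspace :: "('x::ab_group_add) set \<Rightarrow> nat \<Rightarrow> ('n::finite list \<Rightarrow> 'x) set" where
  "tspace X m = {w. (\<forall>J. length J \<noteq> m \<longrightarrow> w J = 0) \<and> (\<forall>J. w J \<in> X)}"

lemma kten_eq:
  "kten sc kact m k w J = (if length J = m then \<Sum>I\<in>words m. sc (tcoef m k J I) (kact k (w I)) else 0)"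
  by (simp add: kten_def tcoef_def)

lemma GammaF_eq:
  "GammaF X sc kact m = {w \<in> tspace X m. \<forall>k. is_unitary k \<longrightarrow> kten sc kact m k w = w}"
  by (auto simp: GammaF_def tspace_def)

context complex_space
begin

lemma tspaceD: "w \<in> tspace X m \<Longrightarrow> w J \<in> X" "w \<in> tspace X m \<Longrightarrow> length J \<noteq> m \<Longrightarrow> w J = 0"
  by (auto simp: tspace_def)

lemma tspace_cvs: "cvs (tspace X m) (Gsc sc)"
  unfolding cvs_def tspace_def Gsc_def
  by (auto simp: fun_eq_iff fun_ops zero_in add_in sc_in sc_add sc_plus sc_mult sc_1 sc_zero)

end

section \<open>Harish-Chandra modules and the displacements in the tensor space\<close>

locale hc_module =
  fixes X :: "('x::ab_group_add) set" and sc :: "complex \<Rightarrow> 'x \<Rightarrow> 'x"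
    and act :: "('n::finite) cmat \<times> 'n cmat \<Rightarrow> 'x \<Rightarrow> 'x" and kact :: "'n cmat \<Rightarrow> 'x \<Rightarrow> 'x"
  assumes HC: "HC_module X sc act kact"
begin

sublocale complex_space X sc
  by unfold_locales (rule HC[unfolded HC_module_def, THEN conjunct1])

lemmas act_in = HC[unfolded HC_module_def, THEN conjunct2, THEN conjunct1, rule_format]
lemmas act_add = HC[unfolded HC_module_def, THEN conjunct2, THEN conjunct2, THEN conjunct1, rule_format]
lemmas act_sc = HC[unfolded HC_module_def, THEN conjunct2, THEN conjunct2, THEN conjunct2, THEN conjunct1, rule_format]
lemmas act_plus = HC[unfolded HC_module_def, THEN conjunct2, THEN conjunct2, THEN conjunct2, THEN conjunct2, THEN conjunct1, rule_format]
lemmas act_scale = HC[unfolded HC_module_def, THEN conjunct2, THEN conjunct2, THEN conjunct2, THEN conjunct2, THEN conjunct2, THEN conjunct1, rule_format]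
lemmas kact_in = HC[unfolded HC_module_def, THEN conjunct2, THEN conjunct2, THEN conjunct2, THEN conjunct2, THEN conjunct2, THEN conjunct2, THEN conjunct2, THEN conjunct1, rule_format]
lemmas kact_add = HC[unfolded HC_module_def, THEN conjunct2, THEN conjunct2, THEN conjunct2, THEN conjunct2, THEN conjunct2, THEN conjunct2, THEN conjunct2, THEN conjunct2, THEN conjunct1, rule_format]
lemmas kact_sc = HC[unfolded HC_module_def, THEN conjunct2, THEN conjunct2, THEN conjunct2, THEN conjunct2, THEN conjunct2, THEN conjunct2, THEN conjunct2, THEN conjunct2, THEN conjunct2, THEN conjunct1, rule_format]
lemmas kact_1 = HC[unfolded HC_module_def, THEN conjunct2, THEN conjunct2, THEN conjunct2, THEN conjunct2, THEN conjunct2, THEN conjunct2, THEN conjunct2, THEN conjunct2, THEN conjunct2, THEN conjunct2, THEN conjunct1, rule_format]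
lemmas kact_mult = HC[unfolded HC_module_def, THEN conjunct2, THEN conjunct2, THEN conjunct2, THEN conjunct2, THEN conjunct2, THEN conjunct2, THEN conjunct2, THEN conjunct2, THEN conjunct2, THEN conjunct2, THEN conjunct2, THEN conjunct1, rule_format]
lemmas kact_act = HC[unfolded HC_module_def, THEN conjunct2, THEN conjunct2, THEN conjunct2, THEN conjunct2, THEN conjunct2, THEN conjunct2, THEN conjunct2, THEN conjunct2, THEN conjunct2, THEN conjunct2, THEN conjunct2, THEN conjunct2, THEN conjunct1, rule_format]
lemmas K_finite = HC[unfolded HC_module_def, THEN conjunct2, THEN conjunct2, THEN conjunct2, THEN conjunct2, THEN conjunct2, THEN conjunct2, THEN conjunct2, THEN conjunct2, THEN conjunct2, THEN conjunct2, THEN conjunct2, THEN conjunct2, THEN conjunct2, THEN conjunct1]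

lemma kact_zero: "is_unitary k \<Longrightarrow> kact k 0 = 0"
  using kact_add[of k 0 0] zero_in by simp

lemma kact_sum: "is_unitary k \<Longrightarrow> (\<And>i. i \<in> A \<Longrightarrow> f i \<in> X) \<Longrightarrow> kact k (sum f A) = (\<Sum>i\<in>A. kact k (f i))"
  by (induction A rule: infinite_finite_induct) (auto simp: kact_zero kact_add sum_in)

lemma act_zero: "act E 0 = 0"
  using act_add[of 0 0 E] zero_in by simp

lemma act_sum: "(\<And>i. i \<in> A \<Longrightarrow> f i \<in> X) \<Longrightarrow> act E (sum f A) = (\<Sum>i\<in>A. act E (f i))"
  by (induction A rule: infinite_finite_induct) (auto simp: act_zero act_add sum_in)

abbreviation kt :: "nat \<Rightarrow> 'n cmat \<Rightarrow> ('n list \<Rightarrow> 'x) \<Rightarrow> ('n list \<Rightarrow> 'x)" where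
  "kt \<equiv> kten sc kact"

lemma kt_in: "is_unitary k \<Longrightarrow> w \<in> tspace X m \<Longrightarrow> kt m k w \<in> tspace X m"
  by (auto simp: tspace_def kten_eq zero_in intro!: sum_in sc_in kact_in)

lemma kt_add:
  assumes "is_unitary k" "v \<in> tspace X m" "w \<in> tspace X m"
  shows "kt m k (v + w) = kt m k v + kt m k w"
proof
  fix J
  show "kt m k (v + w) J = (kt m k v + kt m k w) J"
    using assms by (simp add: kten_eq fun_ops kact_add kact_in sc_add tspaceD sum.distrib)
qed

lemma kt_sc:
  assumes "is_unitary k" "w \<in> tspace X m"
  shows "kt m k (Gsc sc c w) = Gsc sc c (kt m k w)"
proof
  fix J
  have "kact k (w I) \<in> X" for I using assms by (simp add: kact_in tspaceD)
  then show "kt m k (Gsc sc c w) J = Gsc sc c (kt m k w) J"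
    using assms
    by (simp add: kten_eq Gsc_def kact_sc tspaceD sc_sum sc_in sc_zero sc_mult[symmetric] mult.commute)
qed

text \<open>The counterpart of \<open>cospan\<close> in the tensor space itself, which may be
  infinite-dimensional.\<close>

inductive_set displ :: "nat \<Rightarrow> ('n list \<Rightarrow> 'x) set" for m where
  zero: "0 \<in> displ m"
| step: "v \<in> displ m \<Longrightarrow> w \<in> tspace X m \<Longrightarrow> is_unitary k \<Longrightarrow> v + (kt m k w - w) \<in> displ m"

lemma displ_zero: "0 \<in> displ m"
  by (rule displ.zero)

lemma displ_step: "v \<in> displ m \<Longrightarrow> w \<in> tspace X m \<Longrightarrow> is_unitary k \<Longrightarrow> v + (kt m k w - w) \<in> displ m"
  by (rule displ.step)

lemma displ_induct [consumes 1, case_names zero step]: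
  assumes "v \<in> displ m" "P 0"
    and "\<And>v w k. v \<in> displ m \<Longrightarrow> P v \<Longrightarrow> w \<in> tspace X m \<Longrightarrow> is_unitary k \<Longrightarrow> P (v + (kt m k w - w))"
  shows "P v"
  using assms by (rule displ.induct)

end

sublocale hc_module \<subseteq> T: complex_space "tspace X m :: ('n list \<Rightarrow> 'x) set" "Gsc sc" for m
  by unfold_locales (rule tspace_cvs)

context hc_module
begin

lemma displ_in: "v \<in> displ m \<Longrightarrow> v \<in> tspace X m"
  by (induction rule: displ_induct) (auto intro!: T.zero_in T.add_in T.diff_in kt_in)

lemma displ_add: "v \<in> displ m \<Longrightarrow> u \<in> displ m \<Longrightarrow> u + v \<in> displ m"
proof (induction rule: displ_induct)
  case (step v w k)
  have "u + v + (kt m k w - w) \<in> displ m" using step by (intro displ_step) auto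
  then show ?case by (simp only: add.assoc)
qed simp

lemma displ_scale: "v \<in> displ m \<Longrightarrow> Gsc sc c v \<in> displ m"
proof (induction rule: displ_induct)
  case zero
  show ?case by (simp add: T.sc_zero displ_zero)
next
  case (step v w k)
  have "Gsc sc c v + (kt m k (Gsc sc c w) - Gsc sc c w) \<in> displ m"
    using step by (intro displ_step T.sc_in) auto
  moreover have "Gsc sc c (v + (kt m k w - w)) = Gsc sc c v + (kt m k (Gsc sc c w) - Gsc sc c w)"
    using step displ_in[OF step(1)] kt_in[of k w m]
    by (simp add: T.sc_add[of _ m] T.sc_diff[of _ m] kt_sc T.diff_in)
  ultimately show ?case by simp
qed

lemma displ_diff: "v \<in> displ m \<Longrightarrow> u \<in> displ m \<Longrightarrow> u - v \<in> displ m"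
  using displ_add[OF displ_scale[of v m "- 1"], of u] by (simp add: T.sc_m1[OF displ_in])

lemma displacement_in: "w \<in> tspace X m \<Longrightarrow> is_unitary k \<Longrightarrow> kt m k w - w \<in> displ m"
  using displ_step[OF displ_zero, of w m k] by simp

end

text \<open>A choice, for every vector, of a finite-dimensional \<open>K\<close>-stable space containing it; the
  tensor space is exhausted by images of direct sums of these coordinate representations.\<close>

locale hc_coords = hc_module X sc act kact
  for X :: "('x::ab_group_add) set" and sc :: "complex \<Rightarrow> 'x \<Rightarrow> 'x"
    and act :: "('n::finite) cmat \<times> 'n cmat \<Rightarrow> 'x \<Rightarrow> 'x" and kact :: "'n cmat \<Rightarrow> 'x \<Rightarrow> 'x" +
  fixes dd :: "'x \<Rightarrow> nat" and bb :: "'x \<Rightarrow> nat \<Rightarrow> 'x"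
    and CC :: "'x \<Rightarrow> 'n cmat \<Rightarrow> nat \<Rightarrow> nat \<Rightarrow> complex" and ll :: "'x \<Rightarrow> nat \<Rightarrow> complex"
  assumes bb_in: "x \<in> X \<Longrightarrow> bb x j \<in> X"
    and indep: "x \<in> X \<Longrightarrow> (\<Sum>i<dd x. sc (c i) (bb x i)) = 0 \<Longrightarrow> i < dd x \<Longrightarrow> c i = 0"
    and expand: "x \<in> X \<Longrightarrow> x = (\<Sum>j<dd x. sc (ll x j) (bb x j))"
    and kact_bb: "x \<in> X \<Longrightarrow> is_unitary k \<Longrightarrow> j < dd x \<Longrightarrow> kact k (bb x j) = (\<Sum>i<dd x. sc (CC x k i j) (bb x i))"
    and CC_cont: "x \<in> X \<Longrightarrow> i < dd x \<Longrightarrow> j < dd x \<Longrightarrow> continuous_on {k. is_unitary k} (\<lambda>k. CC x k i j)"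
begin

text \<open>Uniqueness of coordinates turns identities for the action on \<open>X\<close> into
  identities of coefficients; this makes \<open>CC x\<close> a matrix representation in
  \<open>CC_1\<close> and \<open>CC_mult\<close>.\<close>

lemma indep_eq:
  assumes "x \<in> X" "(\<Sum>i<dd x. sc (c i) (bb x i)) = (\<Sum>i<dd x. sc (d i) (bb x i))" "i < dd x"
  shows "c i = d i"
proof -
  have "(\<Sum>i<dd x. sc (c i - d i) (bb x i)) = 0"
    using assms by (simp add: sc_minus bb_in sum_subtractf)
  from indep[OF assms(1) this assms(3)] show ?thesis by simp
qed

lemma CC_1:
  assumes "x \<in> X" "i < dd x" "j < dd x"
  shows "CC x (mat 1) i j = (if i = j then 1 else 0)"
proof (rule indep_eq[OF assms(1) _ assms(2)])
  have "(\<Sum>i<dd x. sc (CC x (mat 1) i j) (bb x i)) = bb x j"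
    using kact_bb[OF assms(1) is_unitary_1 assms(3)] kact_1[OF bb_in[OF assms(1)]] by simp
  also have "\<dots> = (\<Sum>i<dd x. if i = j then bb x i else 0)" using assms(3) by simp
  also have "\<dots> = (\<Sum>i<dd x. sc (if i = j then 1 else 0) (bb x i))"
    using assms by (intro sum.cong) (auto simp: sc_delta bb_in)
  finally show "(\<Sum>i<dd x. sc (CC x (mat 1) i j) (bb x i))
      = (\<Sum>i<dd x. sc (if i = j then 1 else 0) (bb x i))" .
qed

lemma kact_comb:
  assumes "x \<in> X" "is_unitary k"
  shows "kact k (\<Sum>j<dd x. sc (c j) (bb x j)) = (\<Sum>i<dd x. sc (\<Sum>j<dd x. CC x k i j * c j) (bb x i))"
proof -
  have "kact k (\<Sum>j<dd x. sc (c j) (bb x j)) = (\<Sum>j<dd x. sc (c j) (kact k (bb x j)))"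
    using assms by (simp add: kact_sum sc_in bb_in kact_sc)
  also have "\<dots> = (\<Sum>j<dd x. \<Sum>i<dd x. sc (CC x k i j * c j) (bb x i))"
    using assms by (intro sum.cong)
      (auto simp: kact_bb sc_sum sc_in bb_in sc_mult[symmetric] mult.commute intro!: sum.cong)
  also have "\<dots> = (\<Sum>i<dd x. \<Sum>j<dd x. sc (CC x k i j * c j) (bb x i))" by (rule sum.swap)
  also have "\<dots> = (\<Sum>i<dd x. sc (\<Sum>j<dd x. CC x k i j * c j) (bb x i))"
    using assms by (simp add: sum_sc bb_in)
  finally show ?thesis .
qed

lemma CC_mult:
  assumes "x \<in> X" "is_unitary k" "is_unitary l" "i < dd x" "j < dd x"
  shows "CC x (k ** l) i j = (\<Sum>h<dd x. CC x k i h * CC x l h j)"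
proof (rule indep_eq[OF assms(1) _ assms(4)])
  have "(\<Sum>i<dd x. sc (CC x (k ** l) i j) (bb x i)) = kact (k ** l) (bb x j)"
    using assms by (simp add: kact_bb is_unitary_mul)
  also have "\<dots> = kact k (\<Sum>h<dd x. sc (CC x l h j) (bb x h))"
    using assms by (simp add: kact_mult bb_in kact_bb[symmetric])
  also have "\<dots> = (\<Sum>i<dd x. sc (\<Sum>h<dd x. CC x k i h * CC x l h j) (bb x i))"
    using assms by (rule_tac kact_comb)
  finally show "(\<Sum>i<dd x. sc (CC x (k ** l) i j) (bb x i))
      = (\<Sum>i<dd x. sc (\<Sum>h<dd x. CC x k i h * CC x l h j) (bb x i))" .
qed

text \<open>Indexes a basis of the formal direct sum, over \<open>x\<close> in \<open>F\<close>, of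
  the chosen spaces tensored with the power of \<open>V\<close>. The tag \<open>x\<close> keeps
  spaces apart that overlap inside \<open>X\<close>; \<open>RR\<close> is block diagonal for
  it.\<close>

definition idx :: "nat \<Rightarrow> 'x set \<Rightarrow> ('x \<times> nat \<times> 'n list) set" where
  "idx m F = (SIGMA x:F. {..<dd x} \<times> words m)"

definition RR :: "nat \<Rightarrow> 'n cmat \<Rightarrow> 'x \<times> nat \<times> 'n list \<Rightarrow> 'x \<times> nat \<times> 'n list \<Rightarrow> complex" where
  "RR m k = (\<lambda>(x, i, J) (y, j, I). if x = y then CC x k i j * tcoef m k J I else 0)"

lemma sum_idx:
  assumes "finite F"
  shows "(\<Sum>a\<in>idx m F. f a) = (\<Sum>x\<in>F. \<Sum>i<dd x. \<Sum>J\<in>words m. f (x, i, J))"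
proof -
  have "(\<Sum>a\<in>idx m F. f a) = (\<Sum>x\<in>F. \<Sum>p\<in>{..<dd x} \<times> words m. f (x, p))"
    unfolding idx_def using assms by (subst sum.Sigma) (auto simp: finite_words)
  then show ?thesis by (simp add: sum.cartesian_product)
qed

lemma finite_idx: "finite F \<Longrightarrow> finite (idx m F)"
  by (auto simp: idx_def finite_words)

lemma sum_RR:
  assumes "finite F" "x \<in> F"
  shows "(\<Sum>a\<in>idx m F. RR m k (x, i, J) a * f a) =
    (\<Sum>j<dd x. \<Sum>I\<in>words m. CC x k i j * tcoef m k J I * f (x, j, I))"
proof -
  have "(\<Sum>a\<in>idx m F. RR m k (x, i, J) a * f a)
      = (\<Sum>y\<in>F. if x = y then \<Sum>j<dd x. \<Sum>I\<in>words m. CC x k i j * tcoef m k J I * f (x, j, I) else 0)"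
    unfolding sum_idx[OF assms(1)] by (intro sum.cong) (auto simp: RR_def)
  then show ?thesis using assms by simp
qed

lemma RR_bdd_rep:
  assumes F: "finite F" "F \<subseteq> X"
  shows "bdd_rep (idx m F) (RR m)"
  unfolding bdd_rep_def
proof (intro conjI allI impI ballI)
  show "finite (idx m F)" by (rule finite_idx[OF F(1)])
  define P where "P = (SIGMA x:F. {..<dd x} \<times> {..<dd x})"
  have "\<forall>p\<in>P. \<exists>M. \<forall>k. is_unitary k \<longrightarrow> cmod (CC (fst p) k (fst (snd p)) (snd (snd p))) \<le> M"
    using F by (intro ballI unitary_continuous_bounded CC_cont) (auto simp: P_def)
  then obtain M where M: "\<And>p k. p \<in> P \<Longrightarrow> is_unitary k \<Longrightarrow>
      cmod (CC (fst p) k (fst (snd p)) (snd (snd p))) \<le> M p" by metis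
  have finP: "finite P" using F by (auto simp: P_def)
  \<comment> \<open>The sum of the finitely many coefficient bounds dominates each of them, and the
    tensor coefficients have modulus at most 1.\<close>
  have "cmod (RR m k a b) \<le> (\<Sum>p\<in>P. \<bar>M p\<bar>)"
    if k: "is_unitary k" and ab: "a \<in> idx m F" "b \<in> idx m F" for k a b
  proof -
    obtain x i J y j I where e: "a = (x, i, J)" "b = (y, j, I)" by (metis prod_cases3)
    show ?thesis
    proof (cases "x = y")
      case True
      then have p: "(x, i, j) \<in> P" using ab e by (auto simp: P_def idx_def)
      have "cmod (RR m k a b) = cmod (CC x k i j) * cmod (tcoef m k J I)"
        using True e by (simp add: RR_def norm_mult)
      also have "\<dots> \<le> \<bar>M (x, i, j)\<bar> * 1"
        using M[OF p k] tcoef_le_1[OF k, of m J I] by (intro mult_mono) auto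
      also have "\<dots> \<le> (\<Sum>p\<in>P. \<bar>M p\<bar>)"
        using member_le_sum[OF p, of "\<lambda>p. \<bar>M p\<bar>"] finP by simp
      finally show ?thesis .
    next
      case False
      then show ?thesis using e by (simp add: RR_def sum_nonneg)
    qed
  qed
  then show "\<exists>M. \<forall>k. is_unitary k \<longrightarrow> (\<forall>i\<in>idx m F. \<forall>j\<in>idx m F. cmod (RR m k i j) \<le> M)" by blast
next
  fix a b assume ab: "a \<in> idx m F" "b \<in> idx m F"
  obtain x i J y j I where e: "a = (x, i, J)" "b = (y, j, I)" by (metis prod_cases3)
  then have "x \<in> X" "y \<in> X" "i < dd x" "j < dd y" "length J = m" "length I = m"
    using ab F(2) by (auto simp: idx_def words_def)
  then show "RR m (mat 1) a b = (if a = b then 1 else 0)"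
    using e by (auto simp: RR_def CC_1 tcoef_1)
next
  fix k l :: "'n cmat" and a b
  assume "is_unitary k \<and> is_unitary l" and ab: "a \<in> idx m F" "b \<in> idx m F"
  then have kl: "is_unitary k" "is_unitary l" by auto
  obtain x i J y j I where e: "a = (x, i, J)" "b = (y, j, I)" by (metis prod_cases3)
  then have x: "x \<in> F" "x \<in> X" "y \<in> X" "i < dd x" "j < dd y" "length J = m" "length I = m"
    using ab F(2) by (auto simp: idx_def words_def)
  have "(\<Sum>c\<in>idx m F. RR m k a c * RR m l c b)
     = (\<Sum>h<dd x. \<Sum>H\<in>words m. CC x k i h * tcoef m k J H * RR m l (x, h, H) b)"
    unfolding e(1) by (rule sum_RR[OF F(1) x(1)])
  also have "\<dots> = RR m (k ** l) a b"
  proof (cases "x = y")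
    case True
    then have "RR m (k ** l) a b = (\<Sum>h<dd x. CC x k i h * CC x l h j) * (\<Sum>H\<in>words m. tcoef m k J H * tcoef m l H I)"
      using e x kl by (simp add: RR_def CC_mult tcoef_mult)
    also have "\<dots> = (\<Sum>h<dd x. \<Sum>H\<in>words m. CC x k i h * tcoef m k J H * (CC x l h j * tcoef m l H I))"
      unfolding sum_product by (simp only: mult_ac)
    finally show ?thesis using True e by (simp add: RR_def)
  qed (simp add: e RR_def)
  finally show "RR m (k ** l) a b = (\<Sum>c\<in>idx m F. RR m k a c * RR m l c b)" by simp
qed

text \<open>The tensor with coordinates \<open>c\<close>; injectivity can fail when chosen spaces
  overlap.\<close>

definition LL :: "nat \<Rightarrow> 'x set \<Rightarrow> ('x \<times> nat \<times> 'n list \<Rightarrow> complex) \<Rightarrow> ('n list \<Rightarrow> 'x)" where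
  "LL m F c = (\<lambda>J. if length J = m then \<Sum>x\<in>F. \<Sum>i<dd x. sc (c (x, i, J)) (bb x i) else 0)"

lemma bb_in_subset: "F \<subseteq> X \<Longrightarrow> x \<in> F \<Longrightarrow> bb x i \<in> X"
  by (intro bb_in) auto

lemma LL_in: "F \<subseteq> X \<Longrightarrow> LL m F c \<in> tspace X m"
  by (auto simp: LL_def tspace_def zero_in bb_in_subset intro!: sum_in sc_in)

lemma LL_add: "F \<subseteq> X \<Longrightarrow> LL m F (c + d) = LL m F c + LL m F d"
  by (rule ext) (simp add: LL_def fun_ops sc_plus bb_in_subset sum.distrib)

lemma LL_diff: "F \<subseteq> X \<Longrightarrow> LL m F (c - d) = LL m F c - LL m F d"
  by (rule ext) (simp add: LL_def fun_ops sc_minus bb_in_subset sum_subtractf)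

lemma LL_0: "F \<subseteq> X \<Longrightarrow> LL m F 0 = 0"
  by (rule ext) (simp add: LL_def fun_ops sc_0 bb_in_subset)

lemma LL_scale: "F \<subseteq> X \<Longrightarrow> LL m F (\<lambda>a. e * c a) = Gsc sc e (LL m F c)"
  by (rule ext) (simp add: LL_def Gsc_def sc_sum sc_zero sc_mult bb_in_subset sc_in sum_in)

text \<open>Carries fixed points of matrices over to invariant tensors: each block is expanded
  separately and the coefficient of every basis vector collected.\<close>

lemma kt_LL:
  assumes F: "finite F" "F \<subseteq> X" and k: "is_unitary k"
  shows "kt m k (LL m F c) = LL m F (mulv (idx m F) (RR m k) c)"
proof
  fix J
  show "kt m k (LL m F c) J = LL m F (mulv (idx m F) (RR m k) c) J"
  proof (cases "length J = m")
    case True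
    have bX: "bb x i \<in> X" if "x \<in> F" for x i using that F bb_in by auto
    have "kt m k (LL m F c) J = (\<Sum>I\<in>words m. sc (tcoef m k J I)
        (\<Sum>x\<in>F. \<Sum>i<dd x. sc (\<Sum>j<dd x. CC x k i j * c (x, j, I)) (bb x i)))"
      unfolding kten_eq if_P[OF True]
    proof (intro sum.cong refl arg_cong[where f="sc _"])
      fix I :: "'n list" assume "I \<in> words m"
      then have "kact k (LL m F c I) = (\<Sum>x\<in>F. kact k (\<Sum>i<dd x. sc (c (x, i, I)) (bb x i)))"
        using k by (subst kact_sum[symmetric]) (auto simp: LL_def words_def intro!: sum_in sc_in bX)
      also have "\<dots> = (\<Sum>x\<in>F. \<Sum>i<dd x. sc (\<Sum>j<dd x. CC x k i j * c (x, j, I)) (bb x i))"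
        using F k by (intro sum.cong kact_comb) auto
      finally show "kact k (LL m F c I)
          = (\<Sum>x\<in>F. \<Sum>i<dd x. sc (\<Sum>j<dd x. CC x k i j * c (x, j, I)) (bb x i))" .
    qed
    also have "\<dots> = (\<Sum>I\<in>words m. \<Sum>x\<in>F. \<Sum>i<dd x.
        sc (tcoef m k J I * (\<Sum>j<dd x. CC x k i j * c (x, j, I))) (bb x i))"
      by (simp add: sc_sum sum_in sc_in bX sc_mult)
    also have "\<dots> = (\<Sum>x\<in>F. \<Sum>I\<in>words m. \<Sum>i<dd x.
        sc (tcoef m k J I * (\<Sum>j<dd x. CC x k i j * c (x, j, I))) (bb x i))"
      by (rule sum.swap)
    also have "\<dots> = (\<Sum>x\<in>F. \<Sum>i<dd x. \<Sum>I\<in>words m.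
        sc (tcoef m k J I * (\<Sum>j<dd x. CC x k i j * c (x, j, I))) (bb x i))"
      by (intro sum.cong refl sum.swap)
    also have "\<dots> = (\<Sum>x\<in>F. \<Sum>i<dd x. sc (mulv (idx m F) (RR m k) c (x, i, J)) (bb x i))"
    proof (intro sum.cong refl)
      fix x i assume x: "x \<in> F" "i \<in> {..<dd x}"
      have "mulv (idx m F) (RR m k) c (x, i, J)
          = (\<Sum>j<dd x. \<Sum>I\<in>words m. CC x k i j * tcoef m k J I * c (x, j, I))"
        using x True sum_RR[OF F(1) x(1)] by (simp add: mulv_def idx_def words_def)
      also have "\<dots> = (\<Sum>I\<in>words m. \<Sum>j<dd x. CC x k i j * tcoef m k J I * c (x, j, I))"
        by (rule sum.swap)
      also have "\<dots> = (\<Sum>I\<in>words m. tcoef m k J I * (\<Sum>j<dd x. CC x k i j * c (x, j, I)))"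
        by (simp add: sum_distrib_left mult_ac)
      finally show "(\<Sum>I\<in>words m. sc (tcoef m k J I * (\<Sum>j<dd x. CC x k i j * c (x, j, I))) (bb x i))
          = sc (mulv (idx m F) (RR m k) c (x, i, J)) (bb x i)"
        using x by (simp add: sum_sc bX)
    qed
    also have "\<dots> = LL m F (mulv (idx m F) (RR m k) c) J" using True by (simp add: LL_def)
    finally show ?thesis .
  qed (simp add: kten_eq LL_def)
qed

lemma LL_surj:
  assumes F: "finite F" "F \<subseteq> X" and w: "w \<in> tspace X m" "w ` words m \<subseteq> F"
  shows "\<exists>c. (\<forall>a. a \<notin> idx m F \<longrightarrow> c a = 0) \<and> LL m F c = w"
proof (intro exI conjI)
  \<comment> \<open>Each value \<open>w J\<close> is expanded in the basis chosen for that value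
    itself; all other blocks get 0 at the word \<open>J\<close>.\<close>
  define c where "c = (\<lambda>a. if a \<in> idx m F \<and> fst a = w (snd (snd a)) then ll (fst a) (fst (snd a)) else 0)"
  show "\<forall>a. a \<notin> idx m F \<longrightarrow> c a = 0" by (simp add: c_def)
  show "LL m F c = w"
  proof
    fix J
    show "LL m F c J = w J"
    proof (cases "length J = m")
      case True
      then have wJ: "w J \<in> F" "w J \<in> X" using w F by (auto simp: words_def)
      have "LL m F c J = (\<Sum>x\<in>F. if x = w J then \<Sum>i<dd x. sc (ll x i) (bb x i) else 0)"
        unfolding LL_def if_P[OF True]
        using True F by (intro sum.cong)
          (auto simp: c_def idx_def words_def sc_0 bb_in subset_iff intro!: sum.neutral)
      also have "\<dots> = w J" using wJ F(1) expand[OF wJ(2)] by simp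
      finally show ?thesis .
    qed (simp add: LL_def tspaceD[OF w(1)])
  qed
qed

lemma LL_cospan:
  assumes F: "finite F" "F \<subseteq> X" and c: "c \<in> cospan (idx m F) (RR m)"
  shows "LL m F c \<in> displ m"
  using c
proof (induction rule: cospan_induct)
  case (step z y k)
  then show ?case
    using F by (simp add: LL_add LL_diff kt_LL[symmetric] displ_step LL_in)
qed (simp add: LL_0 F displ_zero)

text \<open>Lift \<open>w\<close> to coordinates, move to a fixed point in its coset modulo
  \<open>cospan\<close>, and map back by \<open>LL\<close>.\<close>

lemma fixed_exists:
  assumes w: "w \<in> tspace X m"
  shows "\<exists>p\<in>GammaF X sc kact m. p - w \<in> displ m"
proof -
  define F where "F = w ` words m"
  have F: "finite F" "F \<subseteq> X" using w by (auto simp: F_def finite_words tspaceD)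
  obtain c where c: "\<And>a. a \<notin> idx m F \<Longrightarrow> c a = 0" "LL m F c = w"
    using LL_surj[OF F w] F_def by blast
  obtain p where p: "p - c \<in> cospan (idx m F) (RR m)"
     "\<And>k. is_unitary k \<Longrightarrow> mulv (idx m F) (RR m k) p = p"
    using bdd_rep_fixed_in_coset[OF RR_bdd_rep[OF F] cospan_subspace, where z=c]
      cospan_stable cospan_displacement[of "idx m F" c _ "RR m"] c(1) by blast
  have "LL m F p - w \<in> displ m" using LL_cospan[OF F p(1)] c(2) F by (simp add: LL_diff)
  moreover have "LL m F p \<in> GammaF X sc kact m"
    using F p(2) by (simp add: GammaF_eq LL_in kt_LL)
  ultimately show ?thesis by blast
qed

text \<open>Claimed for every sufficiently large \<open>F\<close>, because each displacement in
  \<open>v\<close> brings its own finite set and the induction needs one \<open>F\<close> that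
  serves them all.\<close>

lemma displ_lift:
  assumes "v \<in> displ m"
  shows "\<exists>F0. finite F0 \<and> F0 \<subseteq> X \<and> (\<forall>F. finite F \<and> F0 \<subseteq> F \<and> F \<subseteq> X \<longrightarrow>
    (\<exists>q\<in>cospan (idx m F) (RR m). LL m F q = v))"
  using assms
proof (induction rule: displ_induct)
  case zero
  show ?case using LL_0 cospan_zero by (intro exI[of _ "{}"]) blast
next
  case (step v w k)
  from step.IH obtain F0 where F0: "finite F0" "F0 \<subseteq> X"
    "\<forall>F. finite F \<and> F0 \<subseteq> F \<and> F \<subseteq> X \<longrightarrow> (\<exists>q\<in>cospan (idx m F) (RR m). LL m F q = v)"
    by (elim exE conjE)
  have "\<exists>q\<in>cospan (idx m F) (RR m). LL m F q = v + (kt m k w - w)"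
    if F: "finite F" "F0 \<union> w ` words m \<subseteq> F" "F \<subseteq> X" for F
  proof -
    obtain q where q: "q \<in> cospan (idx m F) (RR m)" "LL m F q = v" using F0(3) F by (metis le_sup_iff)
    obtain c where c: "\<forall>a. a \<notin> idx m F \<longrightarrow> c a = 0" "LL m F c = w"
      using LL_surj[OF F(1,3) step(2)] F by auto
    have "q + (mulv (idx m F) (RR m k) c - c) \<in> cospan (idx m F) (RR m)"
      using q(1) c(1) step(3) by (rule cospan_step)
    moreover have "LL m F (q + (mulv (idx m F) (RR m k) c - c)) = v + (kt m k w - w)"
      using F step(3) q c by (simp add: LL_add LL_diff kt_LL[symmetric])
    ultimately show ?thesis by blast
  qed
  then show ?case
  proof (intro exI conjI allI impI; (elim conjE)?)
    show "finite (F0 \<union> w ` words m)" "F0 \<union> w ` words m \<subseteq> X"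
      using F0 step(2) by (auto simp: finite_words tspaceD)
  qed
qed

text \<open>A lift \<open>q\<close> of \<open>v\<close> inside \<open>cospan\<close> need not be
  fixed, but it is fixed modulo the kernel of \<open>LL\<close> in \<open>cospan\<close>. Its coset
  therefore contains a fixed \<open>p\<close> with the same image, and a fixed vector of
  \<open>cospan\<close> is 0.\<close>

lemma fixed_displ_eq_0:
  assumes v: "v \<in> displ m" "v \<in> GammaF X sc kact m"
  shows "v = 0"
proof -
  obtain F q where F: "finite F" "F \<subseteq> X" and q: "q \<in> cospan (idx m F) (RR m)" "LL m F q = v"
    using displ_lift[OF v(1)] by blast
  define S where "S = {c \<in> cospan (idx m F) (RR m). LL m F c = 0}"
  have S: "fun_subspace (idx m F) S"
    using cospan_subspace[of "idx m F" "RR m"] F(2) unfolding fun_subspace_def S_def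
    by (simp add: LL_0 LL_add LL_scale T.sc_zero)
  have inv: "kt m k v = v" if "is_unitary k" for k using v(2) that by (simp add: GammaF_eq)
  have stab: "mulv (idx m F) (RR m k) x \<in> S" if "is_unitary k" "x \<in> S" for k x
    using that F cospan_stable T.sc_zero kt_sc[OF that(1) T.zero_in[of m], of 0]
    by (auto simp: S_def kt_LL[symmetric] kten_eq fun_eq_iff fun_ops kact_zero sc_zero)
  have "mulv (idx m F) (RR m k) q - q \<in> S" if k: "is_unitary k" for k
    using cospan_displacement[OF _ k, of "idx m F" q] cospan_supp[OF q(1)] F k q inv[OF k]
    by (simp add: S_def LL_diff kt_LL[symmetric])
  then obtain p where p: "p - q \<in> S" "\<And>k. is_unitary k \<Longrightarrow> mulv (idx m F) (RR m k) p = p"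
    using bdd_rep_fixed_in_coset[OF RR_bdd_rep[OF F] S, where z=q] stab cospan_supp[OF q(1)] by blast
  have "p - q \<in> cospan (idx m F) (RR m)" using p(1) by (simp only: S_def mem_Collect_eq)
  from cospan_add[OF q(1) this] have "p \<in> cospan (idx m F) (RR m)" by simp
  from cospan_fixed_eq_0[OF RR_bdd_rep[OF F] this p(2)] have "p = 0" .
  moreover have "LL m F p = LL m F q"
    using p(1) F by (simp add: S_def LL_diff)
  ultimately show ?thesis using q(2) F by (simp add: LL_0)
qed

end

context hc_module
begin

lemma ex_coords: "\<exists>dd bb CC ll. hc_coords X sc act kact dd bb CC ll"
proof -
  have "\<forall>x. \<exists>(d::nat) b C lam. x \<in> X \<longrightarrow>
        (\<forall>j<d. b j \<in> X)
      \<and> (\<forall>c. (\<Sum>i<d. sc (c i) (b i)) = 0 \<longrightarrow> (\<forall>i<d. c i = 0))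
      \<and> x = (\<Sum>j<d. sc (lam j) (b j))
      \<and> (\<forall>k j. is_unitary k \<and> j < d \<longrightarrow> kact k (b j) = (\<Sum>i<d. sc (C k i j) (b i)))
      \<and> (\<forall>i<d. \<forall>j<d. continuous_on {k. is_unitary k} (\<lambda>k. C k i j))" (is "\<forall>x. \<exists>d b C lam. ?P x d b C lam")
  proof
    fix x
    show "\<exists>d b C lam. ?P x d b C lam"
    proof (cases "x \<in> X")
      case True
      from bspec[OF K_finite this] show ?thesis
      proof (elim exE conjE)
        fix d :: nat and b C lam
        assume "\<forall>j<d. b j \<in> X"
          "\<forall>c. (\<Sum>i<d. sc (c i) (b i)) = 0 \<longrightarrow> (\<forall>i<d. c i = 0)"
          "x = (\<Sum>j<d. sc (lam j) (b j))"
          "\<forall>k j. is_unitary k \<and> j < d \<longrightarrow> kact k (b j) = (\<Sum>i<d. sc (C k i j) (b i))"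
          "\<forall>i<d. \<forall>j<d. continuous_on {k. is_unitary k} (\<lambda>k. C k i j)"
        then have "?P x d b C lam" by (intro impI conjI)
        then show ?thesis by (intro exI)
      qed
    qed simp
  qed
  then have "\<exists>dd b0 CC ll. \<forall>x. ?P x (dd x) (b0 x) (CC x) (ll x)" by (simp only: choice_iff)
  then obtain dd b0 CC ll where P: "\<forall>x. ?P x (dd x) (b0 x) (CC x) (ll x)" by (elim exE)
  \<comment> \<open>Padding with 0 beyond the dimension puts every \<open>bb x j\<close> in
    \<open>X\<close>, with no bound on \<open>j\<close>.\<close>
  define bb where "bb = (\<lambda>x j. if j < dd x then b0 x j else 0)"
  have eq: "(\<Sum>i<dd x. sc (c i) (bb x i)) = (\<Sum>i<dd x. sc (c i) (b0 x i))" for x c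
    by (intro sum.cong) (auto simp: bb_def)
  have "hc_coords X sc act kact dd bb CC ll"
  proof
    fix x assume x: "x \<in> X"
    show "bb x j \<in> X" for j using P x zero_in by (simp add: bb_def)
    show "(\<Sum>i<dd x. sc (c i) (bb x i)) = 0 \<Longrightarrow> i < dd x \<Longrightarrow> c i = 0" for c i
      unfolding eq using P x by blast
    show "x = (\<Sum>j<dd x. sc (ll x j) (bb x j))" unfolding eq using P x by blast
    show "is_unitary k \<Longrightarrow> j < dd x \<Longrightarrow> kact k (bb x j) = (\<Sum>i<dd x. sc (CC x k i j) (bb x i))" for k j
      unfolding eq using P x by (simp add: bb_def)
    show "i < dd x \<Longrightarrow> j < dd x \<Longrightarrow> continuous_on {k. is_unitary k} (\<lambda>k. CC x k i j)" for i j
      using P x by blast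
  qed
  then show ?thesis by blast
qed

text \<open>This is the projection onto the invariants along the displacements. It is unique since
  the difference of two candidates is both invariant and a displacement.\<close>

lemma ex1_invariant:
  assumes "w \<in> tspace X m"
  shows "\<exists>!p. p \<in> GammaF X sc kact m \<and> p - w \<in> displ m"
proof -
  obtain dd bb CC ll where "hc_coords X sc act kact dd bb CC ll" using ex_coords by blast
  then interpret hc_coords X sc act kact dd bb CC ll .
  have "p = q" if p: "p \<in> GammaF X sc kact m" "p - w \<in> displ m"
    and q: "q \<in> GammaF X sc kact m" "q - w \<in> displ m" for p q
  proof -
    have "(p - w) - (q - w) \<in> displ m" by (rule displ_diff[OF q(2) p(2)])
    then have d: "p - q \<in> displ m" by simp
    have "kt m k (p - q) = p - q" if "is_unitary k" for k
    proof -
      have "kt m k (p + Gsc sc (- 1) q) = p + Gsc sc (- 1) q"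
        using p q that by (simp add: GammaF_eq kt_add kt_sc T.sc_in)
      then show ?thesis using q T.sc_m1[of q m] by (simp add: GammaF_eq)
    qed
    then have "p - q \<in> GammaF X sc kact m" using d displ_in by (simp add: GammaF_eq)
    from fixed_displ_eq_0[OF d this] show ?thesis by simp
  qed
  then show ?thesis using fixed_exists[OF assms] by blast
qed

end

section \<open>Infinitesimal invariance\<close>

text \<open>Difference quotients along 1/(n+1) put the derivative within reach of
  \<open>fun_subspace_closed\<close>, which speaks of sequences.\<close>

lemma has_vector_derivative_seq:
  fixes f :: "real \<Rightarrow> complex"
  assumes "(f has_vector_derivative D) (at 0)"
  shows "(\<lambda>n. of_nat (Suc n) * (f (inverse (of_nat (Suc n))) - f 0)) \<longlonglongrightarrow> D"
proof -
  define h :: "nat \<Rightarrow> real" where "h = (\<lambda>n. inverse (of_nat (Suc n)))"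
  have "((\<lambda>y. norm (f (0 + y) - f 0 - y *\<^sub>R D) / norm y) \<longlongrightarrow> 0) (at 0)"
    using assms by (simp add: has_vector_derivative_def has_derivative_at)
  moreover have "filterlim h (at 0) sequentially"
    unfolding h_def using LIMSEQ_inverse_real_of_nat by (intro filterlim_atI) auto
  ultimately have "((\<lambda>n. norm (f (0 + h n) - f 0 - h n *\<^sub>R D) / norm (h n)) \<longlongrightarrow> 0) sequentially"
    by (rule filterlim_compose)
  also have "(\<lambda>n. norm (f (0 + h n) - f 0 - h n *\<^sub>R D) / norm (h n))
      = (\<lambda>n. norm (of_nat (Suc n) * (f (h n) - f 0) - D))"
  proof
    fix n
    have "norm (of_nat (Suc n) * (f (h n) - f 0) - D) = norm (of_nat (Suc n) * (f (h n) - f 0 - h n *\<^sub>R D))"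
      unfolding right_diff_distrib[of _ _ "h n *\<^sub>R D"]
      by (simp add: h_def scaleR_conv_of_real mult.assoc[symmetric] del: of_nat_Suc)
    then show "norm (f (0 + h n) - f 0 - h n *\<^sub>R D) / norm (h n)
        = norm (of_nat (Suc n) * (f (h n) - f 0) - D)"
      by (simp add: norm_mult h_def divide_inverse mult.commute del: of_nat_Suc)
  qed
  finally have "(\<lambda>n. of_nat (Suc n) * (f (h n) - f 0) - D) \<longlonglongrightarrow> 0" by (rule tendsto_norm_zero_cancel)
  then show ?thesis unfolding h_def by (rule LIM_zero_cancel)
qed

context complex_space
begin

text \<open>Linear relations among finitely many vectors form a closed set of coefficient vectors, so a
  relation with differentiable coefficients may be differentiated without a topology on \<open>X\<close>.\<close>

lemma differentiate_relation:
  fixes q :: "real \<Rightarrow> 'i \<Rightarrow> complex"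
  assumes A: "finite A" and b: "\<And>a. a \<in> A \<Longrightarrow> b a \<in> X"
    and const: "\<And>t. (\<Sum>a\<in>A. sc (q t a) (b a)) = y"
    and der: "\<And>a. a \<in> A \<Longrightarrow> ((\<lambda>t. q t a) has_vector_derivative q' a) (at 0)"
  shows "(\<Sum>a\<in>A. sc (q' a) (b a)) = 0"
proof -
  define S where "S = {c :: 'i \<Rightarrow> complex. (\<forall>a. a \<notin> A \<longrightarrow> c a = 0) \<and> (\<Sum>a\<in>A. sc (c a) (b a)) = 0}"
  have S: "fun_subspace A S"
    using b unfolding fun_subspace_def S_def
    by (auto simp: fun_ops sc_0 sc_plus sum.distrib sc_mult sc_zero sc_sum[symmetric] sc_in)
  \<comment> \<open>Difference quotients at 1/(n+1). Each is itself a relation, because the sums at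
    both times equal \<open>y\<close>.\<close>
  define s where "s = (\<lambda>n a. if a \<in> A then of_nat (Suc n) * (q (inverse (of_nat (Suc n))) a - q 0 a) else 0)"
  have "(\<lambda>a. if a \<in> A then q' a else 0) \<in> S"
  proof (rule fun_subspace_closed[OF A S])
    fix n
    have "(\<Sum>a\<in>A. sc (s n a) (b a)) = (\<Sum>a\<in>A. sc (of_nat (Suc n)) (sc (q (inverse (of_nat (Suc n))) a) (b a) - sc (q 0 a) (b a)))"
      using b by (intro sum.cong) (auto simp: s_def sc_mult sc_minus simp del: of_nat_Suc)
    also have "\<dots> = sc (of_nat (Suc n)) ((\<Sum>a\<in>A. sc (q (inverse (of_nat (Suc n))) a) (b a)) - (\<Sum>a\<in>A. sc (q 0 a) (b a)))"
      using b by (simp add: sc_sum[symmetric] diff_in sc_in sum_subtractf del: of_nat_Suc)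
    also have "\<dots> = 0" by (simp add: const sc_zero)
    finally show "s n \<in> S" by (simp add: S_def s_def)
  next
    fix a
    show "(\<lambda>n. s n a) \<longlonglongrightarrow> (if a \<in> A then q' a else 0)"
      using has_vector_derivative_seq[OF der[of a]] by (simp add: s_def del: of_nat_Suc)
  qed
  then have "(\<Sum>a\<in>A. sc (if a \<in> A then q' a else 0) (b a)) = 0" by (simp only: S_def mem_Collect_eq)
  then show ?thesis by simp
qed

end

lemma mexp_entry_derivative_0:
  "((\<lambda>t::real. mexp (t *\<^sub>R Z) $ i $ j) has_vector_derivative Z $ i $ j) (at 0)"
proof -
  have "(\<Sum>l\<in>UNIV. Z $ i $ l * mexp (0 *\<^sub>R Z) $ l $ j) = (\<Sum>l\<in>UNIV. if l = j then Z $ i $ l else 0)"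
    unfolding mexp_0 by (intro sum.cong) (auto simp: mat_def)
  then show ?thesis using mexp_entry_has_derivative[of Z i j 0] by simp
qed

text \<open>Product rule at 0: the undifferentiated factors are entries of the identity, so the term
  of slot \<open>s\<close> survives exactly when \<open>I\<close> and \<open>J\<close> agree off
  \<open>s\<close>.\<close>

lemma tcoef_mexp_derivative:
  assumes "length J = m" "length I = m"
  shows "((\<lambda>t::real. tcoef m (mexp (t *\<^sub>R Z)) J I) has_vector_derivative
    (\<Sum>s<m. if I = J[s := I ! s] then cnj (Z $ (J ! s) $ (I ! s)) else 0)) (at 0)"
proof -
  have "((\<lambda>t::real. cnj (mexp (t *\<^sub>R Z) $ (J ! s) $ (I ! s))) has_derivative
      (\<lambda>y. y *\<^sub>R cnj (Z $ (J ! s) $ (I ! s)))) (at 0)" for s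
    using has_vector_derivative_cnj[OF mexp_entry_derivative_0] by (simp add: has_vector_derivative_def)
  then have "((\<lambda>t::real. tcoef m (mexp (t *\<^sub>R Z)) J I) has_derivative
    (\<lambda>y. \<Sum>s<m. y *\<^sub>R cnj (Z $ (J ! s) $ (I ! s)) *
        (\<Prod>r\<in>{..<m} - {s}. cnj (mexp (0 *\<^sub>R Z) $ (J ! r) $ (I ! r))))) (at 0)"
    unfolding tcoef_def by (rule has_derivative_prod)
  also have "(\<lambda>y. \<Sum>s<m. y *\<^sub>R cnj (Z $ (J ! s) $ (I ! s)) *
        (\<Prod>r\<in>{..<m} - {s}. cnj (mexp (0 *\<^sub>R Z) $ (J ! r) $ (I ! r))))
     = (\<lambda>y. y *\<^sub>R (\<Sum>s<m. if I = J[s := I ! s] then cnj (Z $ (J ! s) $ (I ! s)) else 0))"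
  proof
    fix y :: real
    have "(\<Prod>r\<in>{..<m} - {s}. cnj (mexp (0 *\<^sub>R Z) $ (J ! r) $ (I ! r))) = (if I = J[s := I ! s] then 1 else 0)"
      if s: "s < m" for s
    proof (cases "I = J[s := I ! s]")
      case True
      then have "J ! r = I ! r" if "r \<noteq> s" for r using that by (metis nth_list_update_neq)
      then show ?thesis using True unfolding mexp_0 by (simp add: mat_def)
    next
      case False
      then obtain r where "r < m" "I ! r \<noteq> J[s := I ! s] ! r"
        using assms by (metis length_list_update nth_equalityI)
      then have "r \<in> {..<m} - {s}" "J ! r \<noteq> I ! r" using assms s
        by (auto simp: nth_list_update split: if_splits)
      then show ?thesis using False unfolding mexp_0
        by (simp only: if_False) (rule prod_zero, auto simp: mat_def)
    qed
    then show "(\<Sum>s<m. y *\<^sub>R cnj (Z $ (J ! s) $ (I ! s)) *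
        (\<Prod>r\<in>{..<m} - {s}. cnj (mexp (0 *\<^sub>R Z) $ (J ! r) $ (I ! r))))
      = y *\<^sub>R (\<Sum>s<m. if I = J[s := I ! s] then cnj (Z $ (J ! s) $ (I ! s)) else 0)"
      unfolding scaleR_sum_right by (intro sum.cong) auto
  qed
  finally show ?thesis by (simp add: has_vector_derivative_def)
qed

text \<open>The words that agree with \<open>J\<close> off slot \<open>s\<close> are parametrised by
  their letter there.\<close>

lemma sum_words_update:
  fixes f :: "'n::finite \<Rightarrow> 'n list \<Rightarrow> 'v::comm_monoid_add"
  assumes "length J = m" "s < m"
  shows "(\<Sum>I\<in>words m. if I = J[s := I ! s] then f (I ! s) I else 0) = (\<Sum>i\<in>UNIV. f i (J[s := i]))"
proof -
  have inj: "inj (\<lambda>i. J[s := i])" using assms by (intro injI) (metis nth_list_update_eq)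
  have "{I \<in> words m. I = J[s := I ! s]} = range (\<lambda>i. J[s := i])"
    using assms by (auto simp: words_def)
  moreover have "(\<Sum>I\<in>words m. if I = J[s := I ! s] then f (I ! s) I else 0)
      = (\<Sum>I\<in>{I \<in> words m. I = J[s := I ! s]}. f (I ! s) I)"
    using finite_words by (subst sum.inter_filter) auto
  ultimately show ?thesis using assms by (simp add: sum.reindex[OF inj])
qed

context hc_module
begin

text \<open>Recasts the differentiability clause of \<open>HC_module\<close> as a curve in fixed
  finite coordinates, the form that \<open>differentiate_relation\<close> accepts.\<close>

lemma ex_curve:
  assumes "x \<in> X" "skew_herm Z"
  shows "\<exists>(d::nat) b c mu. (\<forall>j. b j \<in> X)
    \<and> (\<forall>t::real. kact (mexp (t *\<^sub>R Z)) x = (\<Sum>i<d. sc (c t i) (b i)))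
    \<and> (\<forall>i<d. ((\<lambda>t. c t i) has_vector_derivative mu i) (at 0))
    \<and> act (Z, cnjm Z) x = (\<Sum>i<d. sc (mu i) (b i))"
  using bspec[OF K_finite assms(1)]
proof (elim exE conjE)
  fix d :: nat and b C lam
  assume b: "\<forall>j<d. b j \<in> X" and x: "x = (\<Sum>j<d. sc (lam j) (b j))"
    and C: "\<forall>k j. is_unitary k \<and> j < d \<longrightarrow> kact k (b j) = (\<Sum>i<d. sc (C k i j) (b i))"
    and mu: "\<forall>Z. skew_herm Z \<longrightarrow> (\<exists>mu.
            (\<forall>i<d. ((\<lambda>t::real. \<Sum>j<d. C (mexp (t *\<^sub>R Z)) i j * lam j) has_vector_derivative mu i) (at 0))
          \<and> act (Z, cnjm Z) x = (\<Sum>i<d. sc (mu i) (b i)))"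
  define b' where "b' = (\<lambda>j. if j < d then b j else 0)"
  have b'X: "b' j \<in> X" for j using b zero_in by (simp add: b'_def)
  have eq: "(\<Sum>i<d. sc (c i) (b' i)) = (\<Sum>i<d. sc (c i) (b i))" for c
    by (intro sum.cong) (auto simp: b'_def)
  from mu assms(2) obtain mu where mu:
    "\<forall>i<d. ((\<lambda>t::real. \<Sum>j<d. C (mexp (t *\<^sub>R Z)) i j * lam j) has_vector_derivative mu i) (at 0)"
    "act (Z, cnjm Z) x = (\<Sum>i<d. sc (mu i) (b i))" by blast
  have "kact (mexp (t *\<^sub>R Z)) x = (\<Sum>i<d. sc (\<Sum>j<d. C (mexp (t *\<^sub>R Z)) i j * lam j) (b' i))" for t :: real
  proof -
    have u: "is_unitary (mexp (t *\<^sub>R Z))" by (rule mexp_unitary[OF assms(2)])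
    have "kact (mexp (t *\<^sub>R Z)) (\<Sum>j<d. sc (lam j) (b' j)) = (\<Sum>j<d. sc (lam j) (kact (mexp (t *\<^sub>R Z)) (b' j)))"
      using u by (simp add: kact_sum sc_in b'X kact_sc)
    also have "\<dots> = (\<Sum>j<d. sc (lam j) (\<Sum>i<d. sc (C (mexp (t *\<^sub>R Z)) i j) (b' i)))"
      unfolding eq using C u by (intro sum.cong refl) (auto simp: b'_def)
    also have "\<dots> = (\<Sum>j<d. \<Sum>i<d. sc (C (mexp (t *\<^sub>R Z)) i j * lam j) (b' i))"
      by (simp add: sc_sum sc_in b'X sc_mult[symmetric] mult.commute)
    also have "\<dots> = (\<Sum>i<d. \<Sum>j<d. sc (C (mexp (t *\<^sub>R Z)) i j * lam j) (b' i))" by (rule sum.swap)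
    finally show ?thesis by (simp add: sum_sc b'X x eq)
  qed
  then show ?thesis
    using b'X mu(1) mu(2)[folded eq]
    by (intro exI[of _ d] exI[of _ b'] exI[of _ "\<lambda>t i. \<Sum>j<d. C (mexp (t *\<^sub>R Z)) i j * lam j"]
        exI[of _ mu]) auto
qed

text \<open>Differentiate the invariance under exp(tZ) at t = 0. The factor in \<open>X\<close>
  contributes the Lie algebra action; the tensor coefficients change one letter at a time, with
  conjugated entries of \<open>Z\<close>.\<close>

lemma invariant_skew:
  assumes w: "w \<in> GammaF X sc kact m" and Z: "skew_herm Z" and J: "length J = m"
  shows "act (Z, cnjm Z) (w J) + (\<Sum>s<m. \<Sum>i\<in>UNIV. sc (cnj (Z $ (J ! s) $ i)) (w (J[s := i]))) = 0"
proof -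
  have wX: "w I \<in> X" for I using w by (simp add: GammaF_def)
  have "\<forall>I. \<exists>(d::nat) b c mu. (\<forall>j. b j \<in> X)
    \<and> (\<forall>t::real. kact (mexp (t *\<^sub>R Z)) (w I) = (\<Sum>i<d. sc (c t i) (b i)))
    \<and> (\<forall>i<d. ((\<lambda>t. c t i) has_vector_derivative mu i) (at 0))
    \<and> act (Z, cnjm Z) (w I) = (\<Sum>i<d. sc (mu i) (b i))" (is "\<forall>I. \<exists>d b c mu. ?P I d b c mu")
    using ex_curve[OF wX Z] by blast
  then have "\<exists>d b c mu. \<forall>I. ?P I (d I) (b I) (c I) (mu I)" by (simp only: choice_iff)
  then obtain d b c mu where P: "\<forall>I. ?P I (d I) (b I) (c I) (mu I)" by (elim exE)
  have bX: "b I j \<in> X" for I j using P by blast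
  have kx: "kact (mexp (t *\<^sub>R Z)) (w I) = (\<Sum>i<d I. sc (c I t i) (b I i))" for t I using P by blast
  have der: "((\<lambda>t. c I t i) has_vector_derivative mu I i) (at 0)" if "i < d I" for I i using P that by blast
  have ax: "act (Z, cnjm Z) (w I) = (\<Sum>i<d I. sc (mu I i) (b I i))" for I using P by blast
  define A where "A = (SIGMA I:words m. {..<d I})"
  define T' where "T' = (\<lambda>I. \<Sum>s<m. if I = J[s := I ! s] then cnj (Z $ (J ! s) $ (I ! s)) else 0)"
  have finA: "finite A" by (simp add: A_def finite_words)
  have sumA: "(\<Sum>a\<in>A. f a) = (\<Sum>I\<in>words m. \<Sum>i<d I. f (I, i))" for f :: "'n list \<times> nat \<Rightarrow> 'x"
    unfolding A_def by (subst sum.Sigma) (auto simp: finite_words)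
  have "(\<Sum>a\<in>A. sc (T' (fst a) * c (fst a) 0 (snd a) + tcoef m (mat 1) J (fst a) * mu (fst a) (snd a)) (b (fst a) (snd a))) = 0"
  proof (rule differentiate_relation[OF finA, where q="\<lambda>t a. tcoef m (mexp (t *\<^sub>R Z)) J (fst a) * c (fst a) t (snd a)" and y="w J"])
    show "b (fst a) (snd a) \<in> X" for a by (rule bX)
    fix t :: real
    have "(\<Sum>a\<in>A. sc (tcoef m (mexp (t *\<^sub>R Z)) J (fst a) * c (fst a) t (snd a)) (b (fst a) (snd a)))
      = (\<Sum>I\<in>words m. sc (tcoef m (mexp (t *\<^sub>R Z)) J I) (kact (mexp (t *\<^sub>R Z)) (w I)))"
      unfolding sumA kx by (simp add: sc_sum sc_in bX sc_mult)
    also have "\<dots> = kt m (mexp (t *\<^sub>R Z)) w J" using J by (simp add: kten_eq)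
    also have "\<dots> = w J" using w mexp_unitary[OF Z] by (simp add: GammaF_def)
    finally show "(\<Sum>a\<in>A. sc (tcoef m (mexp (t *\<^sub>R Z)) J (fst a) * c (fst a) t (snd a)) (b (fst a) (snd a))) = w J" .
  next
    fix a assume a: "a \<in> A"
    then have l: "length (fst a) = m" and i: "snd a < d (fst a)" by (auto simp: A_def words_def)
    have "((\<lambda>t. tcoef m (mexp (t *\<^sub>R Z)) J (fst a) * c (fst a) t (snd a)) has_vector_derivative
      tcoef m (mexp (0 *\<^sub>R Z)) J (fst a) * mu (fst a) (snd a) + T' (fst a) * c (fst a) 0 (snd a)) (at 0)"
      unfolding T'_def by (rule has_vector_derivative_mult[OF tcoef_mexp_derivative[OF J l] der[OF i]])
    then show "((\<lambda>t. tcoef m (mexp (t *\<^sub>R Z)) J (fst a) * c (fst a) t (snd a)) has_vector_derivative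
      T' (fst a) * c (fst a) 0 (snd a) + tcoef m (mat 1) J (fst a) * mu (fst a) (snd a)) (at 0)"
      unfolding mexp_0 by (simp add: add.commute)
  qed
  then have "0 = (\<Sum>I\<in>words m. sc (T' I) (kact (mexp (0 *\<^sub>R Z)) (w I)) + sc (tcoef m (mat 1) J I) (act (Z, cnjm Z) (w I)))"
    unfolding sumA kx ax by (simp add: sc_sum sc_in bX sc_mult sc_plus sum.distrib)
  also have "\<dots> = (\<Sum>I\<in>words m. sc (T' I) (w I)) + (\<Sum>I\<in>words m. if J = I then act (Z, cnjm Z) (w I) else 0)"
    unfolding mexp_0 sum.distrib kact_1[OF wX]
    using J by (intro arg_cong2[where f="(+)"] sum.cong) (auto simp: tcoef_1 words_def sc_0 sc_1 act_in wX)
  also have "(\<Sum>I\<in>words m. if J = I then act (Z, cnjm Z) (w I) else 0) = act (Z, cnjm Z) (w J)"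
    unfolding sum.delta'[OF finite_words] using J by (simp add: words_def)
  also have "(\<Sum>I\<in>words m. sc (T' I) (w I)) = (\<Sum>I\<in>words m. \<Sum>s<m. if I = J[s := I ! s] then sc (cnj (Z $ (J ! s) $ (I ! s))) (w I) else 0)"
    unfolding T'_def sum_sc[OF wX] by (intro sum.cong) (auto simp: sc_0 wX)
  also have "\<dots> = (\<Sum>s<m. \<Sum>I\<in>words m. if I = J[s := I ! s] then sc (cnj (Z $ (J ! s) $ (I ! s))) (w I) else 0)"
    by (rule sum.swap)
  also have "\<dots> = (\<Sum>s<m. \<Sum>i\<in>UNIV. sc (cnj (Z $ (J ! s) $ i)) (w (J[s := i])))"
    using J by (intro sum.cong refl sum_words_update[where f="\<lambda>i I. sc (cnj (Z $ (J ! s) $ i)) (w I)" for s]) auto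
  finally show ?thesis by (simp add: add.commute)
qed

text \<open>Written for E = \<open>cnjm Z\<close>, where Z = \<open>- transpose E\<close> by
  skewness, the identity of \<open>invariant_skew\<close> contains no conjugate and is complex
  linear in \<open>E\<close>. It then extends to all matrices, since E = A + iB with
  \<open>A\<close> and \<open>B\<close> skew-Hermitian.\<close>

lemma invariant_infinitesimal:
  assumes w: "w \<in> GammaF X sc kact m" and J: "length J = m"
  shows "act (- transpose E, E) (w J) + (\<Sum>s<m. \<Sum>i\<in>UNIV. sc (E $ (J ! s) $ i) (w (J[s := i]))) = 0"
proof -
  have wX: "w I \<in> X" for I using w by (simp add: GammaF_def)
  define Q where "Q = (\<lambda>E. act (- transpose E, E) (w J) + (\<Sum>s<m. \<Sum>i\<in>UNIV. sc (E $ (J ! s) $ i) (w (J[s := i]))))"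
  have skew: "Q A = 0" if "skew_herm A" for A
  proof -
    have e: "cnj (A $ i $ j) = - A $ j $ i" for i j
      using that by (simp add: skew_herm_def adj_def vec_eq_iff eq_neg_iff_add_eq_0 add.commute)
    then have "skew_herm (cnjm A)" "cnjm A = - transpose A" "cnjm (cnjm A) = A"
      by (simp_all add: skew_herm_def adj_def cnjm_def transpose_def vec_eq_iff)
    with invariant_skew[OF w, of "cnjm A" J] J show ?thesis by (simp add: Q_def cnjm_def)
  qed
  have add: "Q (A + B) = Q A + Q B" for A B
  proof -
    have "(- transpose (A + B), A + B) = (- transpose A + - transpose B, A + B)"
      by (simp add: transpose_def vec_eq_iff)
    then have "act (- transpose (A + B), A + B) (w J) = act (- transpose A, A) (w J) + act (- transpose B, B) (w J)"
      using act_plus[OF wX, of "(- transpose A, A)" "(- transpose B, B)" J] by (simp only: fst_conv snd_conv)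
    then show ?thesis by (simp add: Q_def sc_plus wX sum.distrib)
  qed
  have scale: "Q (smat c A) = sc c (Q A)" for c A
  proof -
    have "(- transpose (smat c A), smat c A) = (smat c (- transpose A), smat c A)"
      by (simp add: transpose_def smat_def vec_eq_iff)
    then have "act (- transpose (smat c A), smat c A) (w J) = sc c (act (- transpose A, A) (w J))"
      using act_scale[OF wX, of c "(- transpose A, A)" J] by simp
    then show ?thesis by (simp add: Q_def sc_add sum_in sc_in wX act_in sc_sum sc_mult smat_def)
  qed
  define A where "A = smat (1/2) (E - adj E)"
  define B where "B = smat (- \<i> / 2) (E + adj E)"
  have "skew_herm A" "skew_herm B" "E = A + smat \<i> B"
    by (simp_all add: skew_herm_def A_def B_def smat_def adj_def vec_eq_iff field_simps)
  then have "Q E = 0" by (simp add: add scale skew sc_zero)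
  then show ?thesis by (simp add: Q_def)
qed

end

section \<open>The action of the Hecke generators\<close>

lemma fun_sum_apply: "(\<Sum>i\<in>A. f i) x = (\<Sum>i\<in>A. f i x)"
  by (induction A rule: infinite_finite_induct) (auto simp: fun_ops)

text \<open>Positions count from 0 but generators from 1, so the generator s_a corresponds to
  \<open>swp (a - 1) a\<close>.\<close>

definition swp :: "nat \<Rightarrow> nat \<Rightarrow> 'a list \<Rightarrow> 'a list" where
  "swp p q J = J[p := J ! q, q := J ! p]"

lemma length_swp [simp]: "length (swp p q J) = length J"
  by (simp add: swp_def)

lemma nth_swp:
  "p < length J \<Longrightarrow> q < length J \<Longrightarrow> t < length J \<Longrightarrow>
    swp p q J ! t = J ! (if t = p then q else if t = q then p else t)"
  by (auto simp: swp_def nth_list_update)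

lemma swp_swp: "p < length J \<Longrightarrow> q < length J \<Longrightarrow> swp p q (swp p q J) = J"
  by (rule nth_equalityI) (auto simp: nth_swp)

text \<open>The swaps for j, j - 1, ..., 1 carry the letter at \<open>j\<close> step by step to the
  front and shift the earlier letters right.\<close>

lemma fold_swp_to_front:
  "j < length J \<Longrightarrow> fold (\<lambda>a. swp (a - 1) a) (rev [1..<j + 1]) J = (J ! j) # take j J @ drop (Suc j) J"
proof (induction j arbitrary: J)
  case 0
  then show ?case by (cases J) auto
next
  case (Suc j)
  let ?K = "swp j (Suc j) J"
  have "fold (\<lambda>a. swp (a - 1) a) (rev [1..<Suc j + 1]) J = fold (\<lambda>a. swp (a - 1) a) (rev [1..<j + 1]) ?K"
    by simp
  also have "\<dots> = (?K ! j) # take j ?K @ drop (Suc j) ?K" using Suc by simp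
  also have "?K ! j = J ! Suc j" using Suc(2) by (simp add: nth_swp)
  also have "take j ?K = take j J" by (simp add: swp_def)
  also have "drop (Suc j) ?K = (J ! j) # drop (Suc (Suc j)) J"
    using Suc(2) by (intro nth_equalityI) (auto simp: nth_swp nth_Cons split: nat.splits)
  finally show ?case using Suc(2) by (simp add: take_Suc_conv_app_nth)
qed

text \<open>Insertion: once the first \<open>k\<close> letters are reversed, the next block of the
  word brings the letter at index \<open>k\<close> to the front.\<close>

lemma fold_swp_w0word: "length J = m \<Longrightarrow> fold (\<lambda>a. swp (a - 1) a) (w0word m) J = rev J"
proof -
  assume J: "length J = m"
  have "k \<le> m \<Longrightarrow> fold (\<lambda>a. swp (a - 1) a) (w0word k) J = rev (take k J) @ drop k J" for k
  proof (induction k)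
    case 0
    show ?case by (simp add: w0word_def)
  next
    case (Suc k)
    show ?case
    proof (cases k)
      case 0
      then show ?thesis using J Suc(2) by (cases J) (auto simp: w0word_def)
    next
      case (Suc i)
      let ?K = "rev (take k J) @ drop k J"
      have "w0word (Suc k) = w0word k @ rev [1..<k + 1]"
        using Suc by (simp add: w0word_def)
      then have "fold (\<lambda>a. swp (a - 1) a) (w0word (Suc k)) J = fold (\<lambda>a. swp (a - 1) a) (rev [1..<k + 1]) ?K"
        using Suc.IH Suc.prems by simp
      also have "\<dots> = (?K ! k) # take k ?K @ drop (Suc k) ?K"
        using J Suc.prems by (intro fold_swp_to_front) simp
      also have "\<dots> = rev (take (Suc k) J) @ drop (Suc k) J"
        using J Suc.prems by (simp add: nth_append take_Suc_conv_app_nth)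
      finally show ?thesis .
    qed
  qed
  from this[of m] J show ?thesis by simp
qed

lemma fold_swp_rev:
  assumes "\<And>a. a \<in> set ws \<Longrightarrow> 1 \<le> a \<and> a < length J"
  shows "fold (\<lambda>a. swp (a - 1) a) (rev ws) (fold (\<lambda>a. swp (a - 1) a) ws J) = J"
  using assms
proof (induction ws arbitrary: J)
  case (Cons a ws)
  have "1 \<le> a" "a < length J" using Cons.prems[of a] by auto
  moreover have "fold (\<lambda>a. swp (a - 1) a) (rev ws) (fold (\<lambda>a. swp (a - 1) a) ws (swp (a - 1) a J)) = swp (a - 1) a J"
    using Cons.prems by (intro Cons.IH) auto
  ultimately show ?case by (simp add: swp_swp)
qed simp

lemma set_w0word: "a \<in> set (w0word m) \<Longrightarrow> 1 \<le> a \<and> a < m"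
  by (auto simp: w0word_def)

text \<open>The reversed word undoes the original one, whose effect is an involution.\<close>

lemma fold_swp_rev_w0word:
  assumes "length J = m"
  shows "fold (\<lambda>a. swp (a - 1) a) (rev (w0word m)) J = rev J"
  using fold_swp_rev[of "w0word m" "rev J"] fold_swp_w0word[of "rev J" m] set_w0word[of _ m] assms
  by simp

lemma rev_swp_rev:
  assumes "p < length J" "q < length J"
  shows "rev (swp p q (rev J)) = swp (length J - 1 - p) (length J - 1 - q) J"
  using assms by (intro nth_equalityI) (auto simp: nth_swp rev_nth)

lemma rev_update_rev:
  assumes "p < length J"
  shows "rev ((rev J)[p := a]) = J[length J - 1 - p := a]"
  using assms by (simp add: rev_update)

lemma tcoef_reindex:
  assumes "bij_betw f {..<m} {..<m}"
    and "\<And>t. t < m \<Longrightarrow> J' ! t = J ! f t" "\<And>t. t < m \<Longrightarrow> I' ! t = I ! f t"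
  shows "tcoef m k J' I' = tcoef m k J I"
proof -
  have "tcoef m k J' I' = (\<Prod>t<m. cnj (k $ (J ! f t) $ (I ! f t)))"
    using assms(2,3) by (simp add: tcoef_def)
  also have "\<dots> = tcoef m k J I"
    unfolding tcoef_def using assms(1) by (rule prod.reindex_bij_betw)
  finally show ?thesis .
qed

text \<open>Covers transpositions and the reversal at once. A permutation of slots that is its own
  inverse passes unchanged to the other side of the pairing.\<close>

definition place_involution :: "nat \<Rightarrow> ('a list \<Rightarrow> 'a list) \<Rightarrow> bool" where
  "place_involution m h \<longleftrightarrow> (\<forall>J. length (h J) = length J) \<and> (\<forall>J. length J = m \<longrightarrow> h (h J) = J)
     \<and> (\<exists>f. bij_betw f {..<m} {..<m} \<and> (\<forall>J t. length J = m \<longrightarrow> t < m \<longrightarrow> h J ! t = J ! f t))"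

lemma place_involution_swp:
  assumes "p < m" "q < m"
  shows "place_involution m (swp p q)"
  unfolding place_involution_def
proof (intro conjI allI impI exI)
  show "bij_betw (\<lambda>t. if t = p then q else if t = q then p else t) {..<m} {..<m}"
    using assms by (intro bij_betw_byWitness[where f'="\<lambda>t. if t = p then q else if t = q then p else t"]) auto
qed (use assms in \<open>auto simp: swp_swp nth_swp\<close>)

lemma place_involution_rev: "place_involution m rev"
  unfolding place_involution_def
proof (intro conjI allI impI exI)
  show "bij_betw (\<lambda>t. m - Suc t) {..<m} {..<m}"
    by (intro bij_betw_byWitness[where f'="\<lambda>t. m - Suc t"]) auto
qed (auto simp: rev_nth)

lemma place_involution_bij: "place_involution m h \<Longrightarrow> bij_betw h (words m) (words m)"
  by (intro bij_betw_byWitness[where f'=h]) (auto simp: place_involution_def words_def)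

lemma tcoef_place_involution:
  "place_involution m h \<Longrightarrow> length J = m \<Longrightarrow> length I = m \<Longrightarrow> tcoef m k (h J) (h I) = tcoef m k J I"
  using tcoef_reindex[of _ m "h J" J "h I" I k] by (auto simp: place_involution_def)

context complex_space
begin

text \<open>Like the formulas that follow, this is proved for any \<open>complex_space\<close>, so
  that it serves \<open>X\<close> and, through the interpretation \<open>hd\<close>, also the
  functionals on \<open>X\<close>.\<close>

lemma slotop_munit:
  assumes "w \<in> tspace X m" "k \<ge> 1"
  shows "slotop sc act m k (munit a b) w
    = (\<lambda>J. if length J = m \<and> J ! (k - 1) = a then w (J[k - 1 := b]) else 0)"
proof
  fix J
  have "(\<Sum>i\<in>UNIV. sc (munit a b $ (J ! (k - 1)) $ i) (w (J[k - 1 := i])))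
     = (\<Sum>i\<in>UNIV. if i = b then (if J ! (k - 1) = a then w (J[k - 1 := b]) else 0) else 0)"
    using tspaceD(1)[OF assms(1)] by (intro sum.cong) (auto simp: munit_def sc_1 sc_0)
  also have "\<dots> = (if J ! (k - 1) = a then w (J[k - 1 := b]) else 0)" by simp
  finally have eq: "(\<Sum>i\<in>UNIV. sc (munit a b $ (J ! (k - 1)) $ i) (w (J[k - 1 := i])))
     = (if J ! (k - 1) = a then w (J[k - 1 := b]) else 0)" .
  have "k \<noteq> 0" using assms(2) by simp
  then show "slotop sc act m k (munit a b) w J = (if length J = m \<and> J ! (k - 1) = a then w (J[k - 1 := b]) else 0)"
    by (simp only: slotop_def if_False eq) simp
qed

lemma slotop_munit_in:
  assumes "w \<in> tspace X m" "k \<ge> 1"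
  shows "slotop sc act m k (munit a b) w \<in> tspace X m"
  using tspaceD(1)[OF assms(1)] by (auto simp: slotop_munit[OF assms] tspace_def zero_in)

text \<open>The sum of E_ab tensor E_ba is the flip of two tensor factors: the letters of
  \<open>J\<close> in the two slots select a single pair (a, b).\<close>

lemma Omega_swp:
  assumes w: "w \<in> tspace X m" and kl: "1 \<le> k" "1 \<le> l" "k \<noteq> l" "k \<le> m" "l \<le> m"
  shows "Omega sc act m k l w = (\<lambda>J. w (swp (k - 1) (l - 1) J))"
proof
  fix J
  show "Omega sc act m k l w J = w (swp (k - 1) (l - 1) J)"
  proof (cases "length J = m")
    case True
    have "Omega sc act m k l w J = (\<Sum>a\<in>UNIV. \<Sum>b\<in>UNIV. slotop sc act m k (munit a b) (slotop sc act m l (munit b a) w) J)"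
      by (simp add: Omega_def fun_sum_apply)
    also have "\<dots> = (\<Sum>a\<in>UNIV. \<Sum>b\<in>UNIV. if length J = m \<and> J ! (k - 1) = a then
         slotop sc act m l (munit b a) w (J[k - 1 := b]) else 0)"
      by (simp only: slotop_munit[OF slotop_munit_in[OF w kl(2)] kl(1)])
    also have "\<dots> = (\<Sum>a\<in>UNIV. \<Sum>b\<in>UNIV. if b = J ! (l - 1) then (if a = J ! (k - 1) then
         w (J[k - 1 := b, l - 1 := a]) else 0) else 0)"
      unfolding slotop_munit[OF w kl(2)]
      using True kl by (intro sum.cong refl) auto
    also have "\<dots> = w (swp (k - 1) (l - 1) J)" by (simp add: swp_def)
    finally show ?thesis .
  next
    case False
    then show ?thesis
      by (simp add: Omega_def fun_sum_apply slotop_munit[OF slotop_munit_in[OF w kl(2)] kl(1)] tspaceD(2)[OF w])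
  qed
qed

lemma Omega_0:
  assumes w: "w \<in> tspace X m" and l: "1 \<le> l" and z: "\<And>E. act E 0 = 0"
  shows "Omega sc act m 0 l w
    = (\<lambda>J. if length J = m then \<Sum>a\<in>UNIV. act (0, munit a (J ! (l - 1))) (w (J[l - 1 := a])) else 0)"
proof
  fix J
  have "Omega sc act m 0 l w J = (\<Sum>a\<in>UNIV. \<Sum>b\<in>UNIV. act (0, munit a b) (slotop sc act m l (munit b a) w J))"
    by (simp add: Omega_def fun_sum_apply slotop_def[of _ _ _ 0])
  also have "\<dots> = (\<Sum>a\<in>UNIV. \<Sum>b\<in>UNIV. if b = J ! (l - 1) then
      (if length J = m then act (0, munit a b) (w (J[l - 1 := a])) else 0) else 0)"
    unfolding slotop_munit[OF w l] by (intro sum.cong refl) (auto simp: z)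
  also have "\<dots> = (if length J = m then \<Sum>a\<in>UNIV. act (0, munit a (J ! (l - 1))) (w (J[l - 1 := a])) else 0)"
    by simp
  finally show "Omega sc act m 0 l w J = (if length J = m then \<Sum>a\<in>UNIV. act (0, munit a (J ! (l - 1))) (w (J[l - 1 := a])) else 0)" .
qed

lemma GS_swp:
  assumes "w \<in> tspace X m" "1 \<le> a" "a < m"
  shows "GS sc act m a w = (\<lambda>J. - w (swp (a - 1) a J))"
  using Omega_swp[OF assms(1), of a "a + 1" act] assms by (simp add: GS_def fun_eq_iff fun_ops)

lemma GY_eq:
  assumes w: "w \<in> tspace X m" and l: "1 \<le> l" "l \<le> m" and z: "\<And>E. act E 0 = 0" and J: "length J = m"
  shows "GY sc act m l w J = (\<Sum>a\<in>UNIV. act (0, munit a (J ! (l - 1))) (w (J[l - 1 := a])))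
    + (\<Sum>x<l - 1. w (swp x (l - 1) J)) + sc (of_nat CARD('n) / 2) (w (J :: 'n::finite list))"
proof -
  \<comment> \<open>Slot 0 is the factor \<open>X\<close> and has its own formula; slot
    \<open>Suc x\<close> is list position \<open>x\<close>.\<close>
  have "(\<Sum>x<l. Omega sc act m x l w J) = Omega sc act m 0 l w J + (\<Sum>x<l - 1. Omega sc act m (Suc x) l w J)"
    using l(1) sum.lessThan_Suc_shift[of "\<lambda>x. Omega sc act m x l w J" "l - 1"] by simp
  also have "(\<Sum>x<l - 1. Omega sc act m (Suc x) l w J) = (\<Sum>x<l - 1. w (swp x (l - 1) J))"
    using l Omega_swp[OF w, of "Suc _" l act] by (intro sum.cong) auto
  finally show ?thesis
    using J by (simp add: GY_def fun_ops fun_sum_apply Gsc_def Omega_0[where act=act, OF w l(1) z])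
qed

lemma tspace_place:
  assumes "w \<in> tspace X m" "place_involution m h"
  shows "(\<lambda>J. w (h J)) \<in> tspace X m"
  using assms by (auto simp: tspace_def place_involution_def)

text \<open>Each generator is a sign and a substitution in the argument. The outermost one
  substitutes first, so \<open>foldr\<close> on tensors becomes \<open>fold\<close> on
  words.\<close>

lemma word_act_GS:
  assumes "\<And>a. a \<in> set ws \<Longrightarrow> 1 \<le> a \<and> a < m" and w: "w \<in> tspace X m"
  shows "word_act (GS sc act m) ws w = (\<lambda>J. sc ((- 1) ^ length ws) (w (fold (\<lambda>a. swp (a - 1) a) ws J)))"
    (is "_ = ?R ws")
proof -
  have "word_act (GS sc act m) ws w = ?R ws \<and> ?R ws \<in> tspace X m"
    using assms(1)
  proof (induction ws)
    case Nil
    have "?R [] = w" using tspaceD(1)[OF w] by (simp add: sc_1)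
    then show ?case using w by (simp add: word_act_def)
  next
    case (Cons a ws)
    then have IH: "word_act (GS sc act m) ws w = ?R ws" "?R ws \<in> tspace X m" and a: "1 \<le> a" "a < m" by auto
    have "word_act (GS sc act m) (a # ws) w = GS sc act m a (?R ws)"
      using IH(1) by (simp add: word_act_def)
    also have "\<dots> = (\<lambda>J. - ?R ws (swp (a - 1) a J))" by (rule GS_swp[OF IH(2) a])
    also have "\<dots> = ?R (a # ws)" using tspaceD(1)[OF w] by (simp add: sc_uminus)
    finally have e: "word_act (GS sc act m) (a # ws) w = ?R (a # ws)"
      "(\<lambda>J. - ?R ws (swp (a - 1) a J)) = ?R (a # ws)" using \<open>_ = ?R (a # ws)\<close> by blast+
    have "(\<lambda>J. ?R ws (swp (a - 1) a J)) \<in> tspace X m"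
      using a by (intro tspace_place[OF IH(2)] place_involution_swp) auto
    then have "(\<lambda>J. - ?R ws (swp (a - 1) a J)) \<in> tspace X m"
      by (auto simp: tspace_def uminus_in)
    then show ?case unfolding e(2) using e(1) by blast
  qed
  then show ?thesis by blast
qed

end

lemma tcoef_remove:
  assumes "p < m"
  shows "tcoef m k J I = cnj (k $ (J ! p) $ (I ! p)) * (\<Prod>t\<in>{..<m} - {p}. cnj (k $ (J ! t) $ (I ! t)))"
  unfolding tcoef_def using assms by (subst prod.remove[of _ p]) auto

text \<open>Both sides have the same two factors in slot \<open>p\<close> and agree elsewhere. In
  \<open>Gam_Omega_0\<close> this trades a changed letter of \<open>I\<close> for one of
  \<open>J\<close>.\<close>

lemma tcoef_update:
  assumes "p < m" "length J = m" "length I = m"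
  shows "tcoef m k J (I[p := c]) * cnj (k $ i $ (I ! p)) = tcoef m k (J[p := i]) I * cnj (k $ (J ! p) $ c)"
proof -
  have "(\<Prod>t\<in>{..<m} - {p}. cnj (k $ (J ! t) $ (I[p := c] ! t))) = (\<Prod>t\<in>{..<m} - {p}. cnj (k $ (J[p := i] ! t) $ (I ! t)))"
    by (intro prod.cong) auto
  then show ?thesis using assms by (simp add: tcoef_remove[OF assms(1)] mult_ac)
qed

text \<open>Exchanging the letter at \<open>p\<close> with the free letter is an involution on pairs
  of a word and a letter.\<close>

lemma sum_words_UNIV_exchange:
  fixes f :: "'n::finite list \<Rightarrow> 'n \<Rightarrow> 'v::comm_monoid_add"
  assumes "p < m"
  shows "(\<Sum>J\<in>words m. \<Sum>a\<in>UNIV. f J a) = (\<Sum>J\<in>words m. \<Sum>a\<in>UNIV. f (J[p := a]) (J ! p))"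
proof -
  have "(\<Sum>z\<in>words m \<times> UNIV. f (fst z) (snd z)) = (\<Sum>z\<in>words m \<times> UNIV. f ((fst z)[p := snd z]) (fst z ! p))"
    by (rule sum.reindex_bij_witness[where i="\<lambda>z. ((fst z)[p := snd z], fst z ! p)"
          and j="\<lambda>z. ((fst z)[p := snd z], fst z ! p)"])
      (use assms in \<open>auto simp: words_def\<close>)
  then show ?thesis by (simp add: sum.cartesian_product case_prod_beta)
qed

lemma minus_add_eq_swap: "- S + b = c \<longleftrightarrow> b = c + (S :: 'a::ab_group_add)"
  by (auto simp: algebra_simps)

context hc_module
begin

lemma act_0_sum: "finite A \<Longrightarrow> x \<in> X \<Longrightarrow> act (0, \<Sum>i\<in>A. M i) x = (\<Sum>i\<in>A. act (0, M i) x)"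
proof (induction A rule: finite_induct)
  case empty
  have "(smat 0 (0 :: 'n cmat)) = 0" by (simp add: smat_def vec_eq_iff)
  then show ?case using act_scale[OF empty, of 0 "(0, 0)"] empty by (simp add: sc_0 act_in)
next
  case (insert i A)
  then show ?case using act_plus[of x "(0, M i)" "(0, \<Sum>i\<in>A. M i)"] by simp
qed

lemma act_0_matrix:
  assumes "x \<in> X"
  shows "act (0, M) x = (\<Sum>i\<in>UNIV. \<Sum>j\<in>UNIV. sc (M $ i $ j) (act (0, munit i j) x))"
proof -
  have "M = (\<Sum>i\<in>UNIV. \<Sum>j\<in>UNIV. smat (M $ i $ j) (munit i j))"
    unfolding vec_eq_iff
  proof (intro allI)
    fix a b
    have "(\<Sum>i\<in>UNIV. \<Sum>j\<in>UNIV. smat (M $ i $ j) (munit i j)) $ a $ b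
        = (\<Sum>i\<in>UNIV. \<Sum>j\<in>UNIV. if j = b then (if i = a then M $ a $ b else 0) else 0)"
      unfolding sum_component by (intro sum.cong refl) (auto simp: smat_def munit_def)
    then show "M $ a $ b = (\<Sum>i\<in>UNIV. \<Sum>j\<in>UNIV. smat (M $ i $ j) (munit i j)) $ a $ b" by simp
  qed
  then have "act (0, M) x = act (0, \<Sum>i\<in>UNIV. \<Sum>j\<in>UNIV. smat (M $ i $ j) (munit i j)) x" by simp
  also have "\<dots> = (\<Sum>i\<in>UNIV. \<Sum>j\<in>UNIV. act (0, smat (M $ i $ j) (munit i j)) x)"
    using assms by (simp add: act_0_sum)
  also have "\<dots> = (\<Sum>i\<in>UNIV. \<Sum>j\<in>UNIV. sc (M $ i $ j) (act (0, munit i j) x))"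
  proof (intro sum.cong refl)
    fix i j
    have "smat (M $ i $ j) 0 = (0 :: 'n cmat)" by (simp add: smat_def vec_eq_iff)
    then show "act (0, smat (M $ i $ j) (munit i j)) x = sc (M $ i $ j) (act (0, munit i j) x)"
      using act_scale[OF assms, of "M $ i $ j" "(0, munit i j)"] by simp
  qed
  finally show ?thesis .
qed

section \<open>The Hecke generators preserve the invariants\<close>

abbreviation Gam :: "nat \<Rightarrow> ('n list \<Rightarrow> 'x) set" where
  "Gam m \<equiv> GammaF X sc kact m"

lemma Gam_in: "w \<in> Gam m \<Longrightarrow> w \<in> tspace X m"
  by (simp add: GammaF_eq)

lemma Gam_inv: "w \<in> Gam m \<Longrightarrow> is_unitary k \<Longrightarrow> kt m k w = w"
  by (simp add: GammaF_eq)

lemma Gam_add: "v \<in> Gam m \<Longrightarrow> w \<in> Gam m \<Longrightarrow> v + w \<in> Gam m"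
  by (simp add: GammaF_eq kt_add T.add_in)

lemma Gam_sc: "w \<in> Gam m \<Longrightarrow> Gsc sc c w \<in> Gam m"
  by (simp add: GammaF_eq kt_sc T.sc_in)

lemma Gam_0: "0 \<in> Gam m"
proof -
  have "kt m k 0 = 0" if "is_unitary k" for k
    using that by (intro ext) (simp add: kten_eq fun_ops kact_zero sc_zero)
  then show ?thesis by (simp add: GammaF_eq T.zero_in)
qed

lemma Gam_uminus: "w \<in> Gam m \<Longrightarrow> - w \<in> Gam m"
  using Gam_sc[of w m "- 1"] T.sc_m1[OF Gam_in] by simp

lemma Gam_sum: "(\<And>i. i \<in> A \<Longrightarrow> f i \<in> Gam m) \<Longrightarrow> sum f A \<in> Gam m"
  by (induction A rule: infinite_finite_induct) (auto simp: Gam_0 Gam_add)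

text \<open>Permuting the tensor factors commutes with the diagonal action of
  \<open>k\<close>.\<close>

lemma Gam_place:
  assumes w: "w \<in> Gam m" and h: "place_involution m h"
  shows "(\<lambda>J. w (h J)) \<in> Gam m"
proof -
  have "kt m k (\<lambda>J. w (h J)) J = w (h J)" if k: "is_unitary k" for k J
  proof (cases "length J = m")
    case True
    have hJ: "length (h J) = m" using h True by (simp add: place_involution_def)
    have "kt m k (\<lambda>J. w (h J)) J = (\<Sum>I\<in>words m. sc (tcoef m k (h J) (h I)) (kact k (w (h I))))"
      using True tcoef_place_involution[OF h True] by (simp add: kten_eq words_def)
    also have "\<dots> = (\<Sum>I\<in>words m. sc (tcoef m k (h J) I) (kact k (w I)))"
      by (rule sum.reindex_bij_betw[OF place_involution_bij[OF h]])
    also have "\<dots> = kt m k w (h J)" using hJ by (simp add: kten_eq)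
    finally show ?thesis using Gam_inv[OF w k] by simp
  next
    case False
    then have "length (h J) \<noteq> m" using h by (simp add: place_involution_def)
    then show ?thesis using False tspaceD(2)[OF Gam_in[OF w]] by (simp add: kten_eq)
  qed
  then show ?thesis using tspace_place[OF Gam_in[OF w] h] by (simp add: GammaF_eq fun_eq_iff)
qed

lemma Gam_GS: "w \<in> Gam m \<Longrightarrow> 1 \<le> a \<Longrightarrow> a < m \<Longrightarrow> GS sc act m a w \<in> Gam m"
proof -
  assume w: "w \<in> Gam m" and a: "1 \<le> a" "a < m"
  have "GS sc act m a w = - (\<lambda>J. w (swp (a - 1) a J))"
    by (simp add: GS_swp[OF Gam_in[OF w] a] fun_eq_iff fun_ops)
  then show ?thesis using a by (simp add: Gam_uminus Gam_place[OF w place_involution_swp])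
qed

text \<open>The sum of E_ab tensor E_ba is invariant under conjugation. In coordinates,
  \<open>k\<close> conjugates the matrix units in \<open>conj\<close>, the letter exchange frees the
  index \<open>c\<close>, and orthogonality of the rows of \<open>k\<close> collapses the sum over
  it.\<close>

lemma Gam_Omega_0:
  assumes w: "w \<in> Gam m" and l: "1 \<le> l" "l \<le> m"
  shows "Omega sc act m 0 l w \<in> Gam m"
proof -
  define p where "p = l - 1"
  have p: "p < m" using l by (simp add: p_def)
  have wX: "w I \<in> X" for I by (rule tspaceD(1)[OF Gam_in[OF w]])
  have Om: "Omega sc act m 0 l w = (\<lambda>J. if length J = m then \<Sum>a\<in>UNIV. act (0, munit a (J ! p)) (w (J[p := a])) else 0)"
    unfolding p_def by (rule Omega_0[where act=act, OF Gam_in[OF w] l(1) act_zero])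
  have "kt m k (Omega sc act m 0 l w) J = Omega sc act m 0 l w J" if k: "is_unitary k" for k J
  proof (cases "length J = m")
    case True
    define y where "y = (\<lambda>I. kact k (w I))"
    have yX: "y I \<in> X" for I by (simp add: y_def kact_in[OF k wX])
    define e where "e = (\<lambda>I i j. act (0, munit i j) (y I))"
    have eX: "e I i j \<in> X" for I i j by (simp add: e_def act_in yX)
    have orth: "(\<Sum>c\<in>UNIV. cnj (k $ i $ c) * (k $ j $ c)) = (if i = j then 1 else 0)" for i j
    proof -
      have "(\<Sum>c\<in>UNIV. k $ i $ c * cnj (k $ j $ c)) = (if i = j then 1 else 0)"
        using k by (simp add: is_unitary_def vec_eq_iff matrix_matrix_mult_def adj_def mat_def)
      from arg_cong[OF this, of cnj] show ?thesis by (simp split: if_splits)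
    qed
    have conj: "kact k (act (0, munit a c) (w I)) =
        (\<Sum>i\<in>UNIV. \<Sum>j\<in>UNIV. sc (cnj (k $ i $ a) * (k $ j $ c)) (e I i j))" for a c I
    proof -
      have ent: "(cnjm k ** munit a c ** adj (cnjm k)) $ i $ j = cnj (k $ i $ a) * (k $ j $ c)" for i j
      proof -
        have "(cnjm k ** munit a c) $ i $ h = (if h = c then cnj (k $ i $ a) else 0)" for h
          by (simp add: matrix_matrix_mult_def cnjm_def munit_def if_distrib[where f="\<lambda>x. _ * x"] cong: if_cong)
        then show ?thesis
          by (simp add: matrix_matrix_mult_def[of "_ ** _"] adj_def cnjm_def if_distrib[where f="\<lambda>x. x * _"] cong: if_cong)
      qed
      have "k ** 0 ** adj k = 0" by (simp add: matrix_matrix_mult_def vec_eq_iff)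
      then have "kact k (act (0, munit a c) (w I)) = act (0, cnjm k ** munit a c ** adj (cnjm k)) (y I)"
        using kact_act[OF k wX, of "(0, munit a c)" I] by (simp add: y_def)
      also have "\<dots> = (\<Sum>i\<in>UNIV. \<Sum>j\<in>UNIV. sc (cnj (k $ i $ a) * (k $ j $ c)) (e I i j))"
        unfolding act_0_matrix[OF yX, of "cnjm k ** munit a c ** adj (cnjm k)" I] ent e_def ..
      finally show ?thesis .
    qed
    have "kt m k (Omega sc act m 0 l w) J
        = (\<Sum>I\<in>words m. sc (tcoef m k J I) (\<Sum>a\<in>UNIV. kact k (act (0, munit a (I ! p)) (w (I[p := a])))))"
      using True by (simp add: kten_eq Om words_def kact_sum[OF k] act_in wX)
    also have "\<dots> = (\<Sum>I\<in>words m. \<Sum>a\<in>UNIV. \<Sum>i\<in>UNIV. \<Sum>j\<in>UNIV.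
        sc (tcoef m k J I * (cnj (k $ i $ a) * (k $ j $ (I ! p)))) (e (I[p := a]) i j))"
      by (simp add: conj sc_sum sum_in sc_in eX sc_mult)
    also have "\<dots> = (\<Sum>I\<in>words m. \<Sum>c\<in>UNIV. \<Sum>i\<in>UNIV. \<Sum>j\<in>UNIV.
        sc (tcoef m k J (I[p := c]) * (cnj (k $ i $ (I ! p)) * (k $ j $ c))) (e I i j))"
      unfolding sum_words_UNIV_exchange[OF p, of "\<lambda>I a. \<Sum>i\<in>UNIV. \<Sum>j\<in>UNIV.
        sc (tcoef m k J I * (cnj (k $ i $ a) * (k $ j $ (I ! p)))) (e (I[p := a]) i j)"]
      using p by (intro sum.cong refl) (simp add: words_def)
    also have "\<dots> = (\<Sum>I\<in>words m. \<Sum>c\<in>UNIV. \<Sum>i\<in>UNIV. \<Sum>j\<in>UNIV.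
        sc (tcoef m k (J[p := i]) I * (cnj (k $ (J ! p) $ c) * (k $ j $ c))) (e I i j))"
      using tcoef_update[OF p True] by (intro sum.cong refl) (simp add: words_def mult.assoc[symmetric])
    also have "\<dots> = (\<Sum>I\<in>words m. \<Sum>i\<in>UNIV. \<Sum>c\<in>UNIV. \<Sum>j\<in>UNIV.
        sc (tcoef m k (J[p := i]) I * (cnj (k $ (J ! p) $ c) * (k $ j $ c))) (e I i j))"
      by (intro sum.cong refl sum.swap)
    also have "\<dots> = (\<Sum>I\<in>words m. \<Sum>i\<in>UNIV. \<Sum>j\<in>UNIV. \<Sum>c\<in>UNIV.
        sc (tcoef m k (J[p := i]) I * (cnj (k $ (J ! p) $ c) * (k $ j $ c))) (e I i j))"
      by (intro sum.cong refl sum.swap)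
    also have "\<dots> = (\<Sum>I\<in>words m. \<Sum>i\<in>UNIV. \<Sum>j\<in>UNIV.
        sc (tcoef m k (J[p := i]) I * (if J ! p = j then 1 else 0)) (e I i j))"
      unfolding orth[symmetric] sum_distrib_left by (simp add: sum_sc eX)
    also have "\<dots> = (\<Sum>I\<in>words m. \<Sum>i\<in>UNIV. \<Sum>j\<in>UNIV. if J ! p = j then sc (tcoef m k (J[p := i]) I) (e I i j) else 0)"
      by (intro sum.cong refl) (simp add: sc_0 eX)
    also have "\<dots> = (\<Sum>I\<in>words m. \<Sum>i\<in>UNIV. sc (tcoef m k (J[p := i]) I) (e I i (J ! p)))" by simp
    also have "\<dots> = (\<Sum>i\<in>UNIV. \<Sum>I\<in>words m. sc (tcoef m k (J[p := i]) I) (e I i (J ! p)))" by (rule sum.swap)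
    also have "\<dots> = (\<Sum>i\<in>UNIV. act (0, munit i (J ! p)) (kt m k w (J[p := i])))"
      using True by (simp add: kten_eq act_sum sc_in kact_in[OF k wX] act_sc e_def y_def)
    also have "\<dots> = Omega sc act m 0 l w J" using True by (simp add: Gam_inv[OF w k] Om)
    finally show ?thesis .
  qed (simp add: kten_eq Om)
  moreover have "Omega sc act m 0 l w \<in> tspace X m"
    by (auto simp: tspace_def Om zero_in intro!: sum_in act_in wX)
  ultimately show ?thesis by (simp add: GammaF_eq fun_eq_iff)
qed

lemma Gam_GY:
  assumes w: "w \<in> Gam m" and l: "1 \<le> l" "l \<le> m"
  shows "GY sc act m l w \<in> Gam m"
  unfolding GY_def
proof (intro Gam_add Gam_sum Gam_sc w)
  fix x assume x: "x \<in> {..<l}"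
  show "Omega sc act m x l w \<in> Gam m"
  proof (cases "x = 0")
    case False
    then show ?thesis
      using x l Omega_swp[OF Gam_in[OF w], of x l act] Gam_place[OF w place_involution_swp, of "x - 1" "l - 1"]
      by simp
  qed (simp add: Gam_Omega_0[OF w l])
qed

text \<open>Summing the infinitesimal invariance under \<open>munit a (J ! p)\<close> at \<open>J[p := a]\<close> over \<open>a\<close>
  exchanges the action of the second factor of the Lie algebra for that of the first.\<close>

lemma invariant_exchange:
  assumes w: "w \<in> Gam m" and J: "length J = m" and p: "p < m"
  shows "(\<Sum>a\<in>UNIV. act (munit (J ! p) a, 0) (w (J[p := a])))
    = (\<Sum>a\<in>UNIV. act (0, munit a (J ! p)) (w (J[p := a])))
      + (\<Sum>s\<in>{..<m} - {p}. w (swp s p J)) + sc (of_nat CARD('n)) (w J)"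
proof -
  have wX: "w I \<in> X" for I by (rule tspaceD(1)[OF Gam_in[OF w]])
  have eq: "act (munit (J ! p) a, 0) (w (J[p := a])) = act (0, munit a (J ! p)) (w (J[p := a]))
      + (\<Sum>s<m. if s = p then w J else if a = J ! s then w (swp s p J) else 0)" for a
  proof -
    let ?K = "J[p := a]" and ?E = "munit a (J ! p)"
    have 1: "act (- transpose ?E, ?E) (w ?K) + (\<Sum>s<m. \<Sum>i\<in>UNIV. sc (?E $ (?K ! s) $ i) (w (?K[s := i]))) = 0"
      using J by (intro invariant_infinitesimal[OF w]) simp
    \<comment> \<open>Adding the transposed matrix unit in the first factor leaves the second factor
      alone.\<close>
    have "(- transpose ?E + munit (J ! p) a, ?E + 0) = (0, ?E)"
      by (simp add: transpose_def munit_def vec_eq_iff)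
    then have 2: "act (- transpose ?E, ?E) (w ?K) + act (munit (J ! p) a, 0) (w ?K) = act (0, ?E) (w ?K)"
      using act_plus[OF wX, of "(- transpose ?E, ?E)" "(munit (J ! p) a, 0)" ?K] by simp
    \<comment> \<open>Slot \<open>p\<close> of \<open>?K\<close> carries \<open>a\<close>, and
      restoring its letter gives \<open>w J\<close>. Another slot contributes only if it carries
      \<open>a\<close> too, and then the result is a transposition of \<open>J\<close>.\<close>
    have "(\<Sum>i\<in>UNIV. sc (?E $ (?K ! s) $ i) (w (?K[s := i])))
        = (if s = p then w J else if a = J ! s then w (swp s p J) else 0)" if s: "s < m" for s
    proof -
      have "(\<Sum>i\<in>UNIV. sc (?E $ (?K ! s) $ i) (w (?K[s := i])))
          = (\<Sum>i\<in>UNIV. if i = J ! p then (if ?K ! s = a then w (?K[s := J ! p]) else 0) else 0)"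
        by (intro sum.cong) (auto simp: munit_def sc_0 sc_1 wX)
      also have "\<dots> = (if ?K ! s = a then w (?K[s := J ! p]) else 0)" by simp
      also have "\<dots> = (if s = p then w J else if a = J ! s then w (swp s p J) else 0)"
      proof (cases "s = p")
        case True
        then show ?thesis using p J by simp
      next
        case False
        then have "?K[s := J ! p] = J[s := J ! p, p := a]" by (rule list_update_swap[symmetric])
        then show ?thesis using False by (auto simp: swp_def)
      qed
      finally show ?thesis .
    qed
    then have "(\<Sum>s<m. \<Sum>i\<in>UNIV. sc (?E $ (?K ! s) $ i) (w (?K[s := i])))
        = (\<Sum>s<m. if s = p then w J else if a = J ! s then w (swp s p J) else 0)" by simp
    with 1 have "act (- transpose ?E, ?E) (w ?K)
        = - (\<Sum>s<m. if s = p then w J else if a = J ! s then w (swp s p J) else 0)"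
      by (simp only: eq_neg_iff_add_eq_0)
    with 2 show ?thesis by (simp only: minus_add_eq_swap)
  qed
  have "(\<Sum>a\<in>UNIV. \<Sum>s<m. if s = p then w J else if a = J ! s then w (swp s p J) else 0)
      = (\<Sum>s<m. \<Sum>a\<in>(UNIV::'n set). if s = p then w J else if a = J ! s then w (swp s p J) else 0)"
    by (rule sum.swap)
  \<comment> \<open>The slot s = p yields \<open>w J\<close> once for every \<open>a\<close>, which
    is the origin of \<open>CARD('n)\<close>.\<close>
  also have "\<dots> = (\<Sum>s<m. if s = p then (\<Sum>a\<in>(UNIV::'n set). w J) else w (swp s p J))"
    by (intro sum.cong) auto
  also have "\<dots> = (\<Sum>a\<in>(UNIV::'n set). w J) + (\<Sum>s\<in>{..<m} - {p}. w (swp s p J))"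
    using p by (subst sum.remove[of _ p]) (auto intro!: sum.cong)
  also have "(\<Sum>a\<in>(UNIV::'n set). w J) = sc (\<Sum>a\<in>(UNIV::'n set). 1) (w J)"
    unfolding sum_sc[OF wX] by (simp add: sc_1 wX)
  finally show ?thesis unfolding eq sum.distrib by (simp add: add_ac)
qed

end

section \<open>The pairing\<close>

text \<open>With all functions as carrier, arithmetic with functionals needs no membership
  conditions.\<close>

interpretation hd: complex_space "UNIV :: ('x \<Rightarrow> complex) set" hd_sc
  by unfold_locales (auto simp: cvs_def hd_sc_def fun_eq_iff fun_ops algebra_simps)

lemma hd_act_zero: "hd_act X act E 0 = 0"
  by (simp add: hd_act_def fun_eq_iff fun_ops)

text \<open>Coefficients in \<open>lin_comb\<close> are attached to vectors, so those of coinciding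
  \<open>u i\<close> have to be merged.\<close>

lemma sum_in_lin_comb:
  assumes "finite A"
  shows "(\<Sum>i\<in>A. hd_sc (c i) (u i)) \<in> lin_comb hd_sc (u ` A)"
proof -
  have "(\<Sum>i\<in>A. hd_sc (c i) (u i)) = (\<Sum>b\<in>u ` A. \<Sum>i\<in>{i \<in> A. u i = b}. hd_sc (c i) (u i))"
    by (rule sum.image_gen[OF assms])
  also have "\<dots> = (\<Sum>b\<in>u ` A. hd_sc (\<Sum>i\<in>{i \<in> A. u i = b}. c i) b)"
    by (intro sum.cong refl) (simp add: hd.sum_sc)
  finally show ?thesis
    unfolding lin_comb_def using assms
    by (intro CollectI exI[of _ "u ` A"] exI[of _ "\<lambda>b. \<Sum>i\<in>{i \<in> A. u i = b}. c i"]) auto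
qed

definition pairing :: "nat \<Rightarrow> ('n::finite list \<Rightarrow> 'x \<Rightarrow> complex) \<Rightarrow> ('n list \<Rightarrow> 'x) \<Rightarrow> complex" where
  "pairing m u w = (\<Sum>J\<in>words m. u J (w J))"

text \<open>The pure tensor of \<open>x\<close> with the basis vector of the word
  \<open>J\<close>.\<close>

definition single :: "'n list \<Rightarrow> 'x \<Rightarrow> 'n list \<Rightarrow> 'x::zero" where
  "single J x = (\<lambda>I. if I = J then x else 0)"

context hc_module
begin

abbreviation GamH :: "nat \<Rightarrow> ('n list \<Rightarrow> 'x \<Rightarrow> complex) set" where
  "GamH m \<equiv> GammaF (hd_carrier X sc kact) hd_sc (hd_kact X kact) m"

lemma GamH_off: "u \<in> GamH m \<Longrightarrow> x \<notin> X \<Longrightarrow> u J x = 0"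
  and GamH_add: "u \<in> GamH m \<Longrightarrow> x \<in> X \<Longrightarrow> y \<in> X \<Longrightarrow> u J (x + y) = u J x + u J y"
  and GamH_sc: "u \<in> GamH m \<Longrightarrow> x \<in> X \<Longrightarrow> u J (sc c x) = cnj c * u J x"
  and GamH_tspace: "u \<in> GamH m \<Longrightarrow> u \<in> tspace UNIV m"
  by (auto simp: GammaF_def hd_carrier_def tspace_def)

lemma GamH_zero: "u \<in> GamH m \<Longrightarrow> u J 0 = 0"
  using GamH_add[of u m 0 0 J] zero_in by simp

lemma GamH_uminus: "u \<in> GamH m \<Longrightarrow> x \<in> X \<Longrightarrow> u J (- x) = - u J x"
  using GamH_sc[of u m x J "- 1"] by (simp add: sc_m1)

lemma GamH_sum:
  "u \<in> GamH m \<Longrightarrow> (\<And>i. i \<in> A \<Longrightarrow> f i \<in> X) \<Longrightarrow> u J (sum f A) = (\<Sum>i\<in>A. u J (f i))"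
  by (induction A rule: infinite_finite_induct) (auto simp: GamH_zero GamH_add sum_in)

lemma GamH_inv:
  assumes "u \<in> GamH m" "is_unitary k" "length J = m" "x \<in> X"
  shows "u J x = (\<Sum>I\<in>words m. tcoef m k J I * u I (kact (adj k) x))"
proof -
  have "u J x = kten hd_sc (hd_kact X kact) m k u J x" using assms(1,2) by (simp add: GammaF_def)
  also have "\<dots> = (\<Sum>I\<in>words m. tcoef m k J I * u I (kact (adj k) x))"
    using assms(3,4) by (simp add: kten_eq fun_sum_apply hd_sc_def hd_kact_def)
  finally show ?thesis .
qed

lemma pairing_add:
  "u \<in> GamH m \<Longrightarrow> v \<in> tspace X m \<Longrightarrow> w \<in> tspace X m \<Longrightarrow> pairing m u (v + w) = pairing m u v + pairing m u w"
  by (simp add: pairing_def fun_ops GamH_add tspaceD sum.distrib)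

lemma pairing_sc:
  "u \<in> GamH m \<Longrightarrow> w \<in> tspace X m \<Longrightarrow> pairing m u (Gsc sc c w) = cnj c * pairing m u w"
  by (simp add: pairing_def Gsc_def GamH_sc tspaceD sum_distrib_left)

lemma pairing_diff:
  assumes "u \<in> GamH m" "v \<in> tspace X m" "w \<in> tspace X m"
  shows "pairing m u (v - w) = pairing m u v - pairing m u w"
  using pairing_add[OF assms(1,2) T.sc_in[OF assms(3)], of "- 1"] pairing_sc[OF assms(1,3), of "- 1"]
    T.sc_m1[OF assms(3)] by simp

text \<open>Conjugate linearity turns the coefficient of \<open>k\<close> into that of
  \<open>adj k\<close>, its inverse, and the invariance of \<open>u\<close> absorbs it.\<close>

lemma pairing_kt:
  assumes u: "u \<in> GamH m" and w: "w \<in> tspace X m" and k: "is_unitary k"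
  shows "pairing m u (kt m k w) = pairing m u w"
proof -
  have kX: "kact k (w I) \<in> X" for I using kact_in[OF k tspaceD(1)[OF w]] .
  have "pairing m u (kt m k w) = (\<Sum>J\<in>words m. \<Sum>I\<in>words m. tcoef m (adj k) I J * u J (kact k (w I)))"
    unfolding pairing_def
    by (intro sum.cong refl) (simp add: kten_eq words_def GamH_sum[OF u] sc_in kX GamH_sc[OF u] tcoef_adj)
  also have "\<dots> = (\<Sum>I\<in>words m. \<Sum>J\<in>words m. tcoef m (adj k) I J * u J (kact k (w I)))" by (rule sum.swap)
  also have "\<dots> = pairing m u w"
    unfolding pairing_def using GamH_inv[OF u is_unitary_adj[OF k] _ tspaceD(1)[OF w]]
    by (intro sum.cong refl) (simp add: words_def adj_adj)
  finally show ?thesis .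
qed

lemma pairing_displ: "v \<in> displ m \<Longrightarrow> u \<in> GamH m \<Longrightarrow> pairing m u v = 0"
proof (induction rule: displ_induct)
  case zero
  then show ?case by (simp add: pairing_def fun_ops GamH_zero)
next
  case (step v w k)
  then show ?case by (simp add: pairing_add pairing_diff pairing_kt displ_in kt_in T.diff_in)
qed

lemma single_in: "x \<in> X \<Longrightarrow> length J = m \<Longrightarrow> single J x \<in> tspace X m"
  by (auto simp: single_def tspace_def zero_in)

lemma pairing_single:
  assumes "u \<in> GamH m" "length J = m"
  shows "pairing m u (single J x) = u J x"
proof -
  have "pairing m u (single J x) = (\<Sum>I\<in>words m. if I = J then u I x else 0)"
    unfolding pairing_def single_def using assms by (intro sum.cong) (auto simp: GamH_zero)
  also have "\<dots> = u J x" unfolding sum.delta[OF finite_words] using assms by (simp add: words_def)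
  finally show ?thesis .
qed

text \<open>A pure tensor differs from an invariant by a displacement, which pairs to 0, so the
  values on invariants determine every coordinate.\<close>

lemma pairing_nondegenerate:
  assumes u: "u \<in> GamH m" "v \<in> GamH m" and eq: "\<And>w. w \<in> Gam m \<Longrightarrow> pairing m u w = pairing m v w"
  shows "u = v"
proof (intro ext)
  fix J x
  show "u J x = v J x"
  proof (cases "length J = m \<and> x \<in> X")
    case True
    then have s: "single J x \<in> tspace X m" by (simp add: single_in)
    then obtain p where p: "p \<in> Gam m" "p - single J x \<in> displ m" using ex1_invariant by blast
    have "pairing m u' (single J x) = pairing m u' p" if "u' \<in> GamH m" for u'
      using pairing_displ[OF p(2) that] pairing_diff[OF that Gam_in[OF p(1)] s] by simp
    then show ?thesis using eq[OF p(1)] u True by (simp add: pairing_single[symmetric])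
  next
    case False
    then show ?thesis
      using u hd.tspaceD(2)[OF GamH_tspace[OF u(1)]] hd.tspaceD(2)[OF GamH_tspace[OF u(2)]]
      by (auto simp: GamH_off fun_ops)
  qed
qed

text \<open>Compose \<open>f\<close> with the projection \<open>P\<close> onto the invariants; the
  values of this extension \<open>F\<close> on pure tensors are the coordinates of the required
  \<open>u\<close>.\<close>

lemma pairing_surjective:
  assumes f: "f \<in> hm_dual_carrier (Gam m) (Gsc sc)"
  shows "\<exists>u\<in>GamH m. \<forall>w\<in>Gam m. pairing m u w = f w"
proof -
  have f_add: "f (v + w) = f v + f w" if "v \<in> Gam m" "w \<in> Gam m" for v w
    using f that by (simp add: hm_dual_carrier_def)
  have f_sc: "f (Gsc sc c w) = cnj c * f w" if "w \<in> Gam m" for w c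
    using f that by (simp add: hm_dual_carrier_def)
  define P where "P = (\<lambda>w. THE p. p \<in> Gam m \<and> p - w \<in> displ m)"
  have P: "P w \<in> Gam m" "P w - w \<in> displ m" if "w \<in> tspace X m" for w
    using theI'[OF ex1_invariant[OF that]] by (simp_all add: P_def)
  have P_eq: "P w = p" if "w \<in> tspace X m" "p \<in> Gam m" "p - w \<in> displ m" for w p
    using ex1_invariant[OF that(1)] P[OF that(1)] that by blast
  define F where "F = (\<lambda>w. f (P w))"
  have F_Gam: "F w = f w" if "w \<in> Gam m" for w
    using P_eq[OF Gam_in[OF that] that] by (simp add: F_def displ_zero)
  have F_add: "F (v + w) = F v + F w" if vw: "v \<in> tspace X m" "w \<in> tspace X m" for v w
  proof -
    have "P (v + w) = P v + P w"
      using displ_add[OF P(2)[OF vw(2)] P(2)[OF vw(1)]] vw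
      by (intro P_eq) (simp_all add: T.add_in Gam_add P algebra_simps)
    then show ?thesis using vw by (simp add: F_def f_add P)
  qed
  have F_sc: "F (Gsc sc c w) = cnj c * F w" if w: "w \<in> tspace X m" for w c
  proof -
    have "P (Gsc sc c w) = Gsc sc c (P w)"
      using displ_scale[OF P(2)[OF w], of c] w
      by (intro P_eq) (simp_all add: T.sc_in Gam_sc P T.sc_diff[of _ m] Gam_in)
    then show ?thesis using w by (simp add: F_def f_sc P)
  qed
  have F_kt: "F (kt m k w) = F w" if w: "w \<in> tspace X m" and k: "is_unitary k" for k w
  proof -
    have "P w - w - (kt m k w - w) \<in> displ m"
      by (rule displ_diff[OF displacement_in[OF w k] P(2)[OF w]])
    then have "P (kt m k w) = P w" using w k by (intro P_eq) (simp_all add: kt_in P)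
    then show ?thesis by (simp add: F_def)
  qed
  have F_0: "F 0 = 0" using F_add[OF T.zero_in T.zero_in] by simp
  have F_sum: "F (\<Sum>i\<in>A. g i) = (\<Sum>i\<in>A. F (g i))" if "finite A" "\<And>i. i \<in> A \<Longrightarrow> g i \<in> tspace X m"
    for A and g :: "'n list \<Rightarrow> 'n list \<Rightarrow> 'x"
    using that by (induction A rule: finite_induct) (auto simp: F_0 F_add T.sum_in)
  have expand: "w = (\<Sum>J\<in>words m. single J (w J))" if "w \<in> tspace X m" for w
  proof
    fix I
    have "(\<Sum>J\<in>words m. single J (w J)) I = (\<Sum>J\<in>words m. if I = J then w J else 0)"
      unfolding fun_sum_apply by (simp add: single_def)
    also have "\<dots> = w I"
      unfolding sum.delta'[OF finite_words] using tspaceD(2)[OF that] by (simp add: words_def)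
    finally show "w I = (\<Sum>J\<in>words m. single J (w J)) I" by simp
  qed
  define u where "u = (\<lambda>J x. if length J = m \<and> x \<in> X then F (single J x) else 0)"
  have Fu: "F w = (\<Sum>J\<in>words m. u J (w J))" if w: "w \<in> tspace X m" for w
  proof -
    have "F w = (\<Sum>J\<in>words m. F (single J (w J)))"
      using arg_cong[OF expand[OF w], of F] F_sum[OF finite_words, of m "\<lambda>J. single J (w J)"]
      by (simp add: words_def single_in tspaceD(1)[OF w])
    then show ?thesis by (simp add: u_def words_def tspaceD(1)[OF w])
  qed
  have u_sc: "u J (sc c x) = cnj c * u J x" if x: "x \<in> X" for J c x
  proof -
    have "single J (sc c x) = Gsc sc c (single J x)" by (auto simp: single_def Gsc_def sc_zero)
    then show ?thesis using x F_sc[OF single_in[OF x, of J m]] by (simp add: u_def sc_in)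
  qed
  have u_add: "u J (x + y) = u J x + u J y" if "x \<in> X" "y \<in> X" for J x y
  proof -
    have "single J (x + y) = single J x + single J y" by (auto simp: single_def fun_ops)
    then show ?thesis
      using that F_add[OF single_in[of x J m] single_in[of y J m]] by (simp add: u_def add_in)
  qed
  have u_kact: "F (single J (kact k x)) = (\<Sum>I\<in>words m. cnj (tcoef m (adj k) I J) * u I x)"
    if J: "length J = m" and x: "x \<in> X" and k: "is_unitary k" for J x k
  proof -
    \<comment> \<open>\<open>F\<close> is invariant, so the tensor may first be moved by
      \<open>adj k\<close>. This undoes \<open>k\<close> on \<open>X\<close> and leaves only the
      coefficients of the tensor factors.\<close>
    have e: "kt m (adj k) (single J (kact k x)) I = sc (tcoef m (adj k) I J) x" if I: "I \<in> words m" for I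
    proof -
      have "kt m (adj k) (single J (kact k x)) I
          = (\<Sum>H\<in>words m. if H = J then sc (tcoef m (adj k) I H) (kact (adj k) (kact k x)) else 0)"
        using I by (auto simp: kten_eq words_def single_def kact_zero is_unitary_adj k sc_zero intro!: sum.cong)
      also have "\<dots> = sc (tcoef m (adj k) I J) (kact (adj k) (kact k x))"
        unfolding sum.delta[OF finite_words] using J by (simp add: words_def)
      also have "kact (adj k) (kact k x) = x"
        using kact_mult[of "adj k" k x] k x by (simp add: is_unitary_adj is_unitary_left kact_1)
      finally show ?thesis .
    qed
    have s: "single J (kact k x) \<in> tspace X m" using J x k by (simp add: single_in kact_in)
    have "F (single J (kact k x)) = F (kt m (adj k) (single J (kact k x)))"
      using F_kt[OF s is_unitary_adj[OF k]] by simp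
    also have "\<dots> = (\<Sum>I\<in>words m. u I (kt m (adj k) (single J (kact k x)) I))"
      by (rule Fu[OF kt_in[OF is_unitary_adj[OF k] s]])
    also have "\<dots> = (\<Sum>I\<in>words m. cnj (tcoef m (adj k) I J) * u I x)"
      using x by (intro sum.cong refl) (simp add: e u_sc)
    finally show ?thesis .
  qed
  have Fs: "u J x = F (single J x)" if "length J = m" "x \<in> X" for J x
    using that by (simp add: u_def)
  \<comment> \<open>K-finiteness of \<open>u J\<close>: all its translates lie in the span of the
    finitely many \<open>u I\<close>.\<close>
  have hdk: "hd_kact X kact k (u J) = (\<Sum>I\<in>words m. hd_sc (if length J = m then cnj (tcoef m k I J) else 0) (u I))"
    if k: "is_unitary k" for k J
  proof
    fix x
    show "hd_kact X kact k (u J) x = (\<Sum>I\<in>words m. hd_sc (if length J = m then cnj (tcoef m k I J) else 0) (u I)) x"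
    proof (cases "length J = m \<and> x \<in> X")
      case True
      then show ?thesis
        using u_kact[OF _ _ is_unitary_adj[OF k], of J x] kact_in[OF is_unitary_adj[OF k], of x]
        by (simp add: hd_kact_def fun_sum_apply hd_sc_def adj_adj Fs)
    next
      case False
      then show ?thesis by (auto simp: hd_kact_def fun_sum_apply hd_sc_def u_def)
    qed
  qed
  have "u J \<in> hd_carrier X sc kact" for J
    unfolding hd_carrier_def mem_Collect_eq
  proof (intro conjI allI impI ballI exI)
    show "finite (u ` words m)" by (simp add: finite_words)
    show "{hd_kact X kact k (u J) |k. is_unitary k} \<subseteq> lin_comb hd_sc (u ` words m)"
      using sum_in_lin_comb[OF finite_words] by (auto simp: hdk)
  qed (auto simp: u_add u_sc, simp add: u_def)
  moreover have "u J = 0" if "length J \<noteq> m" for J using that by (simp add: u_def fun_eq_iff fun_ops)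
  \<comment> \<open>Invariance of \<open>F\<close> under \<open>adj k\<close>, read on pure tensors,
    is invariance of its coordinate family under \<open>k\<close>.\<close>
  moreover have "kten hd_sc (hd_kact X kact) m k u = u" if k: "is_unitary k" for k
  proof (intro ext)
    fix J x
    show "kten hd_sc (hd_kact X kact) m k u J x = u J x"
    proof (cases "length J = m \<and> x \<in> X")
      case True
      then have s: "single J x \<in> tspace X m" by (simp add: single_in)
      have kX: "kact (adj k) x \<in> X" using True k by (simp add: kact_in is_unitary_adj)
      have e: "kt m (adj k) (single J x) I = sc (tcoef m (adj k) I J) (kact (adj k) x)" if I: "I \<in> words m" for I
      proof -
        have "kt m (adj k) (single J x) I
            = (\<Sum>H\<in>words m. if H = J then sc (tcoef m (adj k) I H) (kact (adj k) x) else 0)"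
          using I by (auto simp: kten_eq words_def single_def kact_zero is_unitary_adj k sc_zero intro!: sum.cong)
        also have "\<dots> = sc (tcoef m (adj k) I J) (kact (adj k) x)"
          unfolding sum.delta[OF finite_words] using True by (simp add: words_def)
        finally show ?thesis .
      qed
      have "u J x = F (kt m (adj k) (single J x))"
        using True F_kt[OF s is_unitary_adj[OF k]] by (simp add: u_def)
      also have "\<dots> = (\<Sum>I\<in>words m. u I (kt m (adj k) (single J x) I))"
        by (rule Fu[OF kt_in[OF is_unitary_adj[OF k] s]])
      also have "\<dots> = (\<Sum>I\<in>words m. tcoef m k J I * u I (kact (adj k) x))"
        by (intro sum.cong refl) (simp add: e u_sc kX tcoef_adj adj_adj)
      also have "\<dots> = kten hd_sc (hd_kact X kact) m k u J x"
        using True by (simp add: kten_eq fun_sum_apply hd_sc_def hd_kact_def)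
      finally show ?thesis by simp
    next
      case False
      then show ?thesis by (auto simp: kten_eq fun_sum_apply fun_ops hd_sc_def hd_kact_def u_def)
    qed
  qed
  ultimately have "u \<in> GamH m" by (simp add: GammaF_def)
  moreover have "pairing m u w = f w" if "w \<in> Gam m" for w
    using Fu[OF Gam_in[OF that]] F_Gam[OF that] by (simp add: pairing_def)
  ultimately show ?thesis by blast
qed

section \<open>Adjoints of the Hecke generators\<close>

lemma pairing_place:
  assumes "place_involution m h"
  shows "pairing m (\<lambda>J. u (h J)) w = pairing m u (\<lambda>J. w (h J))"
proof -
  have "pairing m (\<lambda>J. u (h J)) w = (\<Sum>J\<in>words m. u (h J) (w (h (h J))))"
    unfolding pairing_def using assms by (intro sum.cong) (auto simp: place_involution_def words_def)
  also have "\<dots> = pairing m u (\<lambda>J. w (h J))"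
    unfolding pairing_def by (rule sum.reindex_bij_betw[OF place_involution_bij[OF assms]])
  finally show ?thesis .
qed

lemma pairing_GS:
  assumes u: "u \<in> GamH m" and w: "w \<in> Gam m" and a: "1 \<le> a" "a < m"
  shows "pairing m (GS hd_sc (hd_act X act) m a u) w = pairing m u (GS sc act m a w)"
proof -
  have "pairing m (GS hd_sc (hd_act X act) m a u) w = - pairing m (\<lambda>J. u (swp (a - 1) a J)) w"
    by (simp add: hd.GS_swp[OF GamH_tspace[OF u] a] pairing_def fun_ops sum_negf)
  also have "\<dots> = - pairing m u (\<lambda>J. w (swp (a - 1) a J))"
    using a by (simp add: pairing_place place_involution_swp)
  also have "\<dots> = pairing m u (GS sc act m a w)"
    by (simp add: GS_swp[OF Gam_in[OF w] a] pairing_def GamH_uminus[OF u] tspaceD(1)[OF Gam_in[OF w]] sum_negf)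
  finally show ?thesis .
qed

text \<open>Conjugation by the longest element reverses the tensor factors; its sign cancels.\<close>

lemma w0_conj_GY:
  assumes w: "w \<in> Gam m" and l: "1 \<le> l" "l \<le> m"
  shows "length J = m \<Longrightarrow> word_act (GS sc act m) (w0word m) (GY sc act m (m + 1 - l) (word_act (GS sc act m) (rev (w0word m)) w)) J
    = (\<Sum>a\<in>UNIV. act (0, munit a (J ! (l - 1))) (w (J[l - 1 := a])))
      + (\<Sum>x\<in>{l..<m}. w (swp x (l - 1) J)) + sc (of_nat CARD('n) / 2) (w J)"
    and "word_act (GS sc act m) (w0word m) (GY sc act m (m + 1 - l) (word_act (GS sc act m) (rev (w0word m)) w)) \<in> Gam m"
proof -
  define e :: complex where "e = (- 1) ^ length (w0word m)"
  have ee: "e * e = 1" unfolding e_def by (simp add: power_add[symmetric])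
  define v where "v = (\<lambda>J. w (rev J))"
  have wX: "w I \<in> X" for I by (rule tspaceD(1)[OF Gam_in[OF w]])
  have v: "v \<in> Gam m" unfolding v_def by (rule Gam_place[OF w place_involution_rev])
  have bnd: "a \<in> set (w0word m) \<Longrightarrow> 1 \<le> a \<and> a < m" for a by (rule set_w0word)
  have act_rev: "word_act (GS sc act m) ws z = Gsc sc e (\<lambda>J. z (rev J))"
    if "z \<in> tspace X m" "ws = w0word m \<or> ws = rev (w0word m)" for z ws
  proof
    fix J
    have "word_act (GS sc act m) ws z J = sc e (z (fold (\<lambda>a. swp (a - 1) a) ws J))"
      using word_act_GS[of ws m z act] that bnd by (auto simp: e_def)
    also have "\<dots> = sc e (z (rev J))"
    proof (cases "length J = m")
      case True
      then show ?thesis using that(2) fold_swp_w0word[of J m] fold_swp_rev_w0word[of J m] by auto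
    next
      case False
      have "length (fold (\<lambda>a. swp (a - 1) a) ws J) = length J"
        by (induction ws arbitrary: J) auto
      then show ?thesis using False tspaceD(2)[OF that(1)] by simp
    qed
    finally show "word_act (GS sc act m) ws z J = Gsc sc e (\<lambda>J. z (rev J)) J" by (simp add: Gsc_def)
  qed
  have l': "1 \<le> m + 1 - l" "m + 1 - l \<le> m" using l by auto
  have gy: "GY sc act m (m + 1 - l) (Gsc sc e v) \<in> Gam m" by (rule Gam_GY[OF Gam_sc[OF v] l'])
  have eq: "word_act (GS sc act m) (w0word m) (GY sc act m (m + 1 - l) (word_act (GS sc act m) (rev (w0word m)) w))
     = Gsc sc e (\<lambda>J. GY sc act m (m + 1 - l) (Gsc sc e v) (rev J))"
    using act_rev[OF Gam_in[OF w], of "rev (w0word m)"] act_rev[OF Gam_in[OF gy], of "w0word m"] by (simp add: v_def)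
  show "word_act (GS sc act m) (w0word m) (GY sc act m (m + 1 - l) (word_act (GS sc act m) (rev (w0word m)) w)) \<in> Gam m"
    unfolding eq by (intro Gam_sc Gam_place[OF gy place_involution_rev])
  have sce: "sc e (sc e x) = x" if "x \<in> X" for x using sc_mult[OF that, of e e] ee that by (simp add: sc_1)
  \<comment> \<open>Slot m + 1 - l is list position m - l, which the reversal sends to position l -
    1, that is, to slot \<open>l\<close>.\<close>
  have idx: "m + 1 - l - 1 = m - l" "m - l < m" "m - 1 - (m - l) = l - 1" using l by auto
  have vX: "v I \<in> X" for I by (simp add: v_def wX)
  assume J: "length J = m"
  have "Gsc sc e (\<lambda>J. GY sc act m (m + 1 - l) (Gsc sc e v) (rev J)) J =
     (\<Sum>a\<in>UNIV. act (0, munit a (rev J ! (m - l))) (v ((rev J)[m - l := a])))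
      + (\<Sum>x<m - l. v (swp x (m - l) (rev J))) + sc (of_nat CARD('n) / 2) (v (rev J))"
  proof -
    have "GY sc act m (m + 1 - l) (Gsc sc e v) (rev J) =
      sc e ((\<Sum>a\<in>UNIV. act (0, munit a (rev J ! (m - l))) (v ((rev J)[m - l := a])))
      + (\<Sum>x<m - l. v (swp x (m - l) (rev J))) + sc (of_nat CARD('n) / 2) (v (rev J)))"
      using J GY_eq[where act=act, OF Gam_in[OF Gam_sc[OF v]] l' act_zero, of "rev J"]
      by (simp add: idx(1) Gsc_def act_sc vX sc_add sc_sum add_in sum_in act_in sc_in sc_mult[symmetric] mult.commute)
    then show ?thesis by (simp add: Gsc_def sce vX add_in sum_in act_in sc_in)
  qed
  also have "(\<Sum>a\<in>UNIV. act (0, munit a (rev J ! (m - l))) (v ((rev J)[m - l := a])))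
      = (\<Sum>a\<in>UNIV. act (0, munit a (J ! (l - 1))) (w (J[l - 1 := a])))"
    using J idx l by (simp add: v_def rev_update_rev rev_nth)
  also have "(\<Sum>x<m - l. v (swp x (m - l) (rev J))) = (\<Sum>x<m - l. w (swp (m - 1 - x) (l - 1) J))"
    using J idx l by (intro sum.cong refl) (simp add: v_def rev_swp_rev)
  \<comment> \<open>The reflection of positions takes those below m - l to those from
    \<open>l\<close> on, the slots after slot \<open>l\<close>.\<close>
  also have "\<dots> = (\<Sum>x\<in>{l..<m}. w (swp x (l - 1) J))"
    using l by (intro sum.reindex_bij_witness[where i="\<lambda>x. m - 1 - x" and j="\<lambda>x. m - 1 - x"]) auto
  finally show "word_act (GS sc act m) (w0word m) (GY sc act m (m + 1 - l) (word_act (GS sc act m) (rev (w0word m)) w)) J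
    = (\<Sum>a\<in>UNIV. act (0, munit a (J ! (l - 1))) (w (J[l - 1 := a])))
      + (\<Sum>x\<in>{l..<m}. w (swp x (l - 1) J)) + sc (of_nat CARD('n) / 2) (w J)"
    unfolding eq by (simp add: v_def)
qed

text \<open>The shift is exactly half of the \<open>CARD('n)\<close> that
  \<open>invariant_exchange\<close> produces, so it reappears with the opposite sign.\<close>

lemma pairing_GY:
  assumes u: "u \<in> GamH m" and w: "w \<in> Gam m" and l: "1 \<le> l" "l \<le> m"
  shows "pairing m (GY hd_sc (hd_act X act) m l u) w = pairing m u
    (- word_act (GS sc act m) (w0word m) (GY sc act m (m + 1 - l) (word_act (GS sc act m) (rev (w0word m)) w)))"
proof -
  define p where "p = l - 1"
  have p: "p < m" using l by (simp add: p_def)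
  have wX: "w I \<in> X" for I by (rule tspaceD(1)[OF Gam_in[OF w]])
  define O0 where "O0 = (\<lambda>J. \<Sum>a\<in>UNIV. act (0, munit a (J ! p)) (w (J[p := a])))"
  have O0: "O0 J = (\<Sum>a\<in>UNIV. act (0, munit a (J ! p)) (w (J[p := a])))" for J by (simp add: O0_def)
  have O0X: "O0 J \<in> X" for J by (simp add: O0_def sum_in act_in wX)
  define n where "n = (of_nat CARD('n) :: complex)"
  \<comment> \<open>The Hermitian dual exchanges the two factors of the Lie algebra with a sign, and
    conjugation fixes the real matrix units.\<close>
  have gy: "GY hd_sc (hd_act X act) m l u J (w J) =
      - (\<Sum>a\<in>UNIV. u (J[p := a]) (act (munit a (J ! p), 0) (w J)))
      + (\<Sum>x<p. u (swp x p J) (w J)) + n / 2 * u J (w J)" if J: "length J = m" for J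
  proof -
    have c: "cnjm (munit a b) = munit a b" "cnjm 0 = 0" for a b :: 'n
      by (simp_all add: cnjm_def munit_def vec_eq_iff)
    show ?thesis
      using J hd.GY_eq[where act="hd_act X act", OF GamH_tspace[OF u] l hd_act_zero, of J, folded p_def]
      by (simp add: n_def fun_ops fun_sum_apply hd_sc_def hd_act_def wX c sum_negf)
  qed
  have "pairing m (GY hd_sc (hd_act X act) m l u) w =
      - (\<Sum>J\<in>words m. \<Sum>a\<in>UNIV. u (J[p := a]) (act (munit a (J ! p), 0) (w J)))
      + (\<Sum>J\<in>words m. \<Sum>x<p. u (swp x p J) (w J)) + (\<Sum>J\<in>words m. n / 2 * u J (w J))"
    by (simp add: pairing_def gy words_def sum.distrib sum_negf sum_subtractf)
  \<comment> \<open>The letter exchange moves the substitution from \<open>u\<close> to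
    \<open>w\<close> and transposes the matrix unit, as \<open>invariant_exchange\<close>
    needs.\<close>
  also have "(\<Sum>J\<in>words m. \<Sum>a\<in>UNIV. u (J[p := a]) (act (munit a (J ! p), 0) (w J)))
      = (\<Sum>J\<in>words m. u J (\<Sum>a\<in>UNIV. act (munit (J ! p) a, 0) (w (J[p := a]))))"
    unfolding sum_words_UNIV_exchange[OF p, of "\<lambda>J a. u (J[p := a]) (act (munit a (J ! p), 0) (w J))"]
    using p by (intro sum.cong refl) (simp add: words_def GamH_sum[OF u] act_in wX)
  also have "(\<Sum>J\<in>words m. \<Sum>x<p. u (swp x p J) (w J)) = (\<Sum>x<p. \<Sum>J\<in>words m. u (swp x p J) (w J))"
    by (rule sum.swap)
  also have "\<dots> = (\<Sum>x<p. \<Sum>J\<in>words m. u J (w (swp x p J)))"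
    using p pairing_place[OF place_involution_swp, of _ m p u w] unfolding pairing_def by (rule_tac sum.cong[OF refl]) simp
  also have "\<dots> = (\<Sum>J\<in>words m. \<Sum>x<p. u J (w (swp x p J)))" by (rule sum.swap)
  also have "- (\<Sum>J\<in>words m. u J (\<Sum>a\<in>UNIV. act (munit (J ! p) a, 0) (w (J[p := a]))))
      + (\<Sum>J\<in>words m. \<Sum>x<p. u J (w (swp x p J))) + (\<Sum>J\<in>words m. n / 2 * u J (w J))
    = (\<Sum>J\<in>words m. - u J (\<Sum>a\<in>UNIV. act (munit (J ! p) a, 0) (w (J[p := a])))
        + (\<Sum>x<p. u J (w (swp x p J))) + n / 2 * u J (w J))"
    by (simp add: sum.distrib sum_negf sum_subtractf)
  also have "\<dots> = (\<Sum>J\<in>words m. - (u J (O0 J) + (\<Sum>x\<in>{l..<m}. u J (w (swp x p J))) + n / 2 * u J (w J)))"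
  proof (intro sum.cong refl)
    fix J :: "'n list" assume "J \<in> words m"
    then have J: "length J = m" by (simp add: words_def)
    \<comment> \<open>Positions below \<open>p\<close> cancel against the transpositions in y_l;
      those from \<open>l\<close> on survive.\<close>
    have un: "{..<m} - {p} = {..<p} \<union> {l..<m}" using p l by (auto simp: p_def)
    have split: "(\<Sum>s\<in>{..<m} - {p}. u J (w (swp s p J)))
        = (\<Sum>x<p. u J (w (swp x p J))) + (\<Sum>x\<in>{l..<m}. u J (w (swp x p J)))"
      unfolding un using l by (intro sum.union_disjoint) (auto simp: p_def)
    have "u J (\<Sum>a\<in>UNIV. act (munit (J ! p) a, 0) (w (J[p := a])))
        = u J (O0 J) + (\<Sum>s\<in>{..<m} - {p}. u J (w (swp s p J))) + n * u J (w J)"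
      unfolding invariant_exchange[OF w J p] O0[symmetric]
      by (simp add: GamH_add[OF u] GamH_sum[OF u] GamH_sc[OF u] add_in sum_in sc_in wX O0X n_def)
    then show "- u J (\<Sum>a\<in>UNIV. act (munit (J ! p) a, 0) (w (J[p := a])))
        + (\<Sum>x<p. u J (w (swp x p J))) + n / 2 * u J (w J)
      = - (u J (O0 J) + (\<Sum>x\<in>{l..<m}. u J (w (swp x p J))) + n / 2 * u J (w J))"
      unfolding split by (simp add: field_simps)
  qed
  also have "\<dots> = pairing m u
    (- word_act (GS sc act m) (w0word m) (GY sc act m (m + 1 - l) (word_act (GS sc act m) (rev (w0word m)) w)))"
    unfolding pairing_def
  proof (intro sum.cong refl)
    fix J :: "'n list" assume "J \<in> words m"
    then have J: "length J = m" by (simp add: words_def)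
    show "- (u J (O0 J) + (\<Sum>x\<in>{l..<m}. u J (w (swp x p J))) + n / 2 * u J (w J)) = u J
      ((- word_act (GS sc act m) (w0word m) (GY sc act m (m + 1 - l) (word_act (GS sc act m) (rev (w0word m)) w))) J)"
      unfolding uminus_apply w0_conj_GY(1)[OF w l J] p_def[symmetric] O0[symmetric]
      by (subst GamH_uminus[OF u]) (simp_all add: GamH_add[OF u] GamH_sum[OF u] GamH_sc[OF u] add_in sum_in sc_in wX O0X n_def)
  qed
  finally show ?thesis .
qed

end

theorem theorem7p4:
  fixes X :: "('x::ab_group_add) set" and sc :: "complex \<Rightarrow> 'x \<Rightarrow> 'x"
    and act :: "('n::finite) cmat \<times> 'n cmat \<Rightarrow> 'x \<Rightarrow> 'x" and kact :: "'n cmat \<Rightarrow> 'x \<Rightarrow> 'x"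
    and m :: nat
  assumes "HC_module X sc act kact"
  shows "hm_iso m
     (GammaF (hd_carrier X sc kact) hd_sc (hd_kact X kact) m)
     (Gsc hd_sc)
     (GS hd_sc (hd_act X act) m)
     (GY hd_sc (hd_act X act) m)
     (hm_dual_carrier (GammaF X sc kact m) (Gsc sc))
     hm_dual_sc
     (hm_dual_S (GammaF X sc kact m) (GS sc act m))
     (hm_dual_Y m (GammaF X sc kact m) (GS sc act m) (GY sc act m))"
proof -
  interpret hc_module X sc act kact by unfold_locales (rule assms)
  \<comment> \<open>Extended by 0 off the invariants, as \<open>hm_dual_carrier\<close>
    demands.\<close>
  define \<Phi> where "\<Phi> = (\<lambda>u w. if w \<in> Gam m then pairing m u w else 0)"
  have carrier: "\<Phi> u \<in> hm_dual_carrier (Gam m) (Gsc sc)" if "u \<in> GamH m" for u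
    using that
    by (simp add: hm_dual_carrier_def \<Phi>_def Gam_add Gam_sc pairing_add pairing_sc Gam_in)
  have "bij_betw \<Phi> (GamH m) (hm_dual_carrier (Gam m) (Gsc sc))"
    unfolding bij_betw_def
  proof (intro conjI)
    show "inj_on \<Phi> (GamH m)"
    proof (intro inj_onI pairing_nondegenerate)
      fix u v w assume "\<Phi> u = \<Phi> v" "w \<in> Gam m"
      then have "\<Phi> u w = \<Phi> v w" by simp
      with \<open>w \<in> Gam m\<close> show "pairing m u w = pairing m v w" by (simp add: \<Phi>_def)
    qed
    show "\<Phi> ` GamH m = hm_dual_carrier (Gam m) (Gsc sc)"
    proof
      show "\<Phi> ` GamH m \<subseteq> hm_dual_carrier (Gam m) (Gsc sc)" using carrier by blast
      show "hm_dual_carrier (Gam m) (Gsc sc) \<subseteq> \<Phi> ` GamH m"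
      proof
        fix f assume f: "f \<in> hm_dual_carrier (Gam m) (Gsc sc)"
        then obtain u where u: "u \<in> GamH m" "\<forall>w\<in>Gam m. pairing m u w = f w"
          using pairing_surjective by blast
        have "f = \<Phi> u" using u(2) f by (auto simp: \<Phi>_def hm_dual_carrier_def)
        then show "f \<in> \<Phi> ` GamH m" using u(1) by blast
      qed
    qed
  qed
  moreover have "\<Phi> (u + v) = \<Phi> u + \<Phi> v" for u v
    by (auto simp: \<Phi>_def pairing_def fun_eq_iff fun_ops sum.distrib)
  moreover have "\<Phi> (Gsc hd_sc c u) = hm_dual_sc c (\<Phi> u)" for c u
    by (auto simp: \<Phi>_def pairing_def Gsc_def hd_sc_def hm_dual_sc_def fun_eq_iff sum_distrib_left)
  moreover have "\<Phi> (GS hd_sc (hd_act X act) m a u) = hm_dual_S (Gam m) (GS sc act m) a (\<Phi> u)"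
    if "1 \<le> a \<and> a < m" "u \<in> GamH m" for a u
    using that by (auto simp: \<Phi>_def hm_dual_S_def fun_eq_iff pairing_GS Gam_GS)
  moreover have "\<Phi> (GY hd_sc (hd_act X act) m l u) = hm_dual_Y m (Gam m) (GS sc act m) (GY sc act m) l (\<Phi> u)"
    if "1 \<le> l \<and> l \<le> m" "u \<in> GamH m" for l u
  proof
    fix w
    show "\<Phi> (GY hd_sc (hd_act X act) m l u) w = hm_dual_Y m (Gam m) (GS sc act m) (GY sc act m) l (\<Phi> u) w"
    proof (cases "w \<in> Gam m")
      case True
      have l: "1 \<le> l" "l \<le> m" using that by auto
      show ?thesis
        \<comment> \<open>The vector handed to \<open>\<Phi> u\<close> has to be invariant again, so
          that its value there is the pairing and not the default 0.\<close>
        unfolding \<Phi>_def hm_dual_Y_def if_P[OF True] if_P[OF Gam_uminus[OF w0_conj_GY(2)[OF True l]]]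
        by (rule pairing_GY[OF that(2) True l])
    qed (simp add: \<Phi>_def hm_dual_Y_def)
  qed
  ultimately show ?thesis unfolding hm_iso_def by blast
qed

end
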